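(* Let $q>1$ be a constant. Let $\Omega\subset\mathbb{R}^2$ be a $C^2$ domain which is star-shaped with respect to the origin with an admissible radius function $\rho$ (with respect to $q$). Assume that there is a relatively open subset $\mathcal{N}$ of $[0,2\pi)$ (viewed in $\mathbb{R}/(2\pi\mathbb{Z})$) with $|\mathcal{N}|=\pi$ and $\overline{\mathcal{N}\cup(\mathcal{N}+\pi)}=[0,2\pi)$ (in the sense of $\mathbb{R}/(2\pi\mathbb{Z})$) such that $\rho'=0$ in $\mathcal{N}$ and $\rho'\neq0$ almost everywhere in $\mathcal{N}+\pi$. Let $\phi$ be a $C^1$ function on $\mathbb{S}^1$ which is not identically zero. Then there are at most finitely many wave numbers $k>0$ such that $\Omega$ is non-scattering in the presence of the incident wave $v=\mathbf{H}[k,\phi]$.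
   Context: We identify $\mathbb{S}^1$ with $[0,2\pi)$ (and with $\mathbb{R}/(2\pi\mathbb{Z})$) via $\theta\mapsto\vec\theta=(\cos\theta,\sin\theta)^T$; for $\xi\in\mathbb{S}^1$, $\theta_\xi$ denotes its angular coordinate. A bounded, simply connected $C^2$ domain $\Omega\subset\mathbb{R}^2$ containing the origin is star-shaped with respect to the origin if $\partial\Omega=\{\rho(\theta)\vec\theta:\theta\in[0,2\pi)\}$ for a positive $2\pi$-periodic $C^2$ function $\rho$, called its radius function. Given $q>1$, $\rho$ is admissible (with respect to $q$) if $(\ln\rho)''(t)<\sqrt{q}/(1+\sqrt{q})$ for all $t$. For $k>0$ and $\phi\in L^2(\mathbb{S}^1)$ the Herglotz wave is $\mathbf{H}[k,\phi](x)=\int_{-\pi}^{\pi}\phi(\xi)e^{\mathrm{i}k\xi\cdot x}\,d\theta_\xi$. $\Omega$ is non-scattering in the presence of $\mathbf{H}[k,\phi]$ (index of refraction the constant $q$) if there exists $u\in H^1(\Omega)$ with $\Delta u+k^2qu=0$ in $\Omega$ and $u=\mathbf{H}[k,\phi]$, $\partial_\nu u=\partial_\nu\mathbf{H}[k,\phi]$ on $\partial\Omega$. *)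

theory Defs
  imports "HOL-Analysis.Analysis"
begin

text \<open>Points of the plane are pairs (x1, x2) :: real \<times> real.
  Angles are real numbers; functions on the circle are 2pi-periodic functions on the reals.\<close>

definition periodic2pi :: "(real \<Rightarrow> 'a) \<Rightarrow> bool" where
  "periodic2pi f \<longleftrightarrow> (\<forall>t. f (t + 2 * pi) = f t)"

definition C2_real :: "(real \<Rightarrow> real) \<Rightarrow> bool" where
  "C2_real f \<longleftrightarrow> (\<exists>f1 f2. (\<forall>t. (f has_real_derivative f1 t) (at t)) \<and>
      (\<forall>t. (f1 has_real_derivative f2 t) (at t)) \<and> continuous_on UNIV f2)"

definition radius_function :: "(real \<Rightarrow> real) \<Rightarrow> bool" where
  "radius_function \<rho> \<longleftrightarrow> (\<forall>t. \<rho> t > 0) \<and> periodic2pi \<rho> \<and> C2_real \<rho>"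

definition star_domain :: "(real \<Rightarrow> real) \<Rightarrow> (real \<times> real) set" where
  "star_domain \<rho> = {(r * cos t, r * sin t) | r t. 0 \<le> r \<and> r < \<rho> t}"

definition admissible :: "real \<Rightarrow> (real \<Rightarrow> real) \<Rightarrow> bool" where
  "admissible q \<rho> \<longleftrightarrow> (\<forall>t. deriv (deriv (\<lambda>s. ln (\<rho> s))) t < sqrt q / (1 + sqrt q))"

text \<open>Lift of a subset of [0,2pi) to a 2pi-periodic subset of R (i.e. view it in R/2piZ).\<close>
definition circ_lift :: "real set \<Rightarrow> real set" where
  "circ_lift N = {t. \<exists>n::int. t - 2 * pi * of_int n \<in> N}"

definition circ_shift_pi :: "real set \<Rightarrow> real set" where
  "circ_shift_pi N = {0..<2*pi} \<inter> circ_lift ((\<lambda>t. t + pi) ` N)"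

definition herglotz :: "real \<Rightarrow> (real \<Rightarrow> complex) \<Rightarrow> real \<times> real \<Rightarrow> complex" where
  "herglotz k \<phi> x = integral {-pi..pi}
     (\<lambda>\<theta>. \<phi> \<theta> * exp (\<i> * of_real (k * (cos \<theta> * fst x + sin \<theta> * snd x))))"

definition Cc1 :: "(real \<times> real) set \<Rightarrow> (real \<times> real \<Rightarrow> complex) \<Rightarrow>
    (real \<times> real \<Rightarrow> complex) \<Rightarrow> (real \<times> real \<Rightarrow> complex) \<Rightarrow> bool" where
  "Cc1 S \<psi> \<psi>1 \<psi>2 \<longleftrightarrow>
     (\<forall>x. (\<psi> has_derivative (\<lambda>h. of_real (fst h) * \<psi>1 x + of_real (snd h) * \<psi>2 x)) (at x)) \<and>
     continuous_on UNIV \<psi>1 \<and> continuous_on UNIV \<psi>2 \<and>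
     compact (closure {x. \<psi> x \<noteq> 0}) \<and> closure {x. \<psi> x \<noteq> 0} \<subseteq> S"

definition L2 :: "(real \<times> real) set \<Rightarrow> (real \<times> real \<Rightarrow> complex) \<Rightarrow> bool" where
  "L2 \<Omega> f \<longleftrightarrow> set_borel_measurable lborel \<Omega> f \<and>
     set_integrable lborel \<Omega> (\<lambda>x. (cmod (f x))\<^sup>2)"

definition H1 :: "(real \<times> real) set \<Rightarrow> (real \<times> real \<Rightarrow> complex) \<Rightarrow>
    (real \<times> real \<Rightarrow> complex) \<Rightarrow> (real \<times> real \<Rightarrow> complex) \<Rightarrow> bool" where
  "H1 \<Omega> u g1 g2 \<longleftrightarrow> L2 \<Omega> u \<and> L2 \<Omega> g1 \<and> L2 \<Omega> g2 \<and>
     (\<forall>\<psi> \<psi>1 \<psi>2. Cc1 \<Omega> \<psi> \<psi>1 \<psi>2 \<longrightarrow>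
        (LINT x:\<Omega>|lborel. u x * \<psi>1 x) = - (LINT x:\<Omega>|lborel. g1 x * \<psi> x) \<and>
        (LINT x:\<Omega>|lborel. u x * \<psi>2 x) = - (LINT x:\<Omega>|lborel. g2 x * \<psi> x))"

definition H1_0 :: "(real \<times> real) set \<Rightarrow> (real \<times> real \<Rightarrow> complex) \<Rightarrow>
    (real \<times> real \<Rightarrow> complex) \<Rightarrow> (real \<times> real \<Rightarrow> complex) \<Rightarrow> bool" where
  "H1_0 \<Omega> w h1 h2 \<longleftrightarrow> H1 \<Omega> w h1 h2 \<and>
     (\<exists>f f1 f2. (\<forall>n. Cc1 \<Omega> (f n) (f1 n) (f2 n)) \<and>
        (\<lambda>n. LINT x:\<Omega>|lborel. (cmod (f n x - w x))\<^sup>2 + (cmod (f1 n x - h1 x))\<^sup>2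
                                + (cmod (f2 n x - h2 x))\<^sup>2) \<longlonglongrightarrow> 0)"

definition pd1 :: "(real \<times> real \<Rightarrow> complex) \<Rightarrow> real \<times> real \<Rightarrow> complex" where
  "pd1 v x = frechet_derivative v (at x) (1, 0)"
definition pd2 :: "(real \<times> real \<Rightarrow> complex) \<Rightarrow> real \<times> real \<Rightarrow> complex" where
  "pd2 v x = frechet_derivative v (at x) (0, 1)"

text \<open>Boundary parametrisation gamma(t) = rho(t) (cos t, sin t), t \<in> [0, 2pi], and the
  outward normal scaled by |gamma'(t)|, i.e. (gamma2'(t), - gamma1'(t)).\<close>
definition bdry :: "(real \<Rightarrow> real) \<Rightarrow> real \<Rightarrow> real \<times> real" where
  "bdry \<rho> t = (\<rho> t * cos t, \<rho> t * sin t)"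
definition bdry_normal :: "(real \<Rightarrow> real) \<Rightarrow> real \<Rightarrow> real \<times> real" where
  "bdry_normal \<rho> t = (deriv \<rho> t * sin t + \<rho> t * cos t, \<rho> t * sin t - deriv \<rho> t * cos t)"

text \<open>Non-scattering: there is u \<in> H^1(Omega) (weak gradient g1, g2) with
  Delta u + k^2 q u = 0 weakly in Omega, u = v on the boundary (u - v \<in> H^1_0(Omega)),
  and d_nu u = d_nu v on the boundary in the weak (Green's formula) sense:
  for all C^1_c(R^2) test functions psi,
  int_Omega (grad u . grad psi - k^2 q u psi) = int_{bdry Omega} d_nu v psi ds.\<close>
definition non_scattering :: "real \<Rightarrow> (real \<Rightarrow> real) \<Rightarrow> real \<Rightarrow> (real \<times> real \<Rightarrow> complex) \<Rightarrow> bool" where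
  "non_scattering q \<rho> k v \<longleftrightarrow>
    (let \<Omega> = star_domain \<rho> in
     \<exists>u g1 g2. H1 \<Omega> u g1 g2 \<and>
       (\<forall>\<psi> \<psi>1 \<psi>2. Cc1 \<Omega> \<psi> \<psi>1 \<psi>2 \<longrightarrow>
          (LINT x:\<Omega>|lborel. g1 x * \<psi>1 x + g2 x * \<psi>2 x - of_real (k\<^sup>2 * q) * u x * \<psi> x) = 0) \<and>
       H1_0 \<Omega> (\<lambda>x. u x - v x) (\<lambda>x. g1 x - pd1 v x) (\<lambda>x. g2 x - pd2 v x) \<and>
       (\<forall>\<psi> \<psi>1 \<psi>2. Cc1 UNIV \<psi> \<psi>1 \<psi>2 \<longrightarrow>
          (LINT x:\<Omega>|lborel. g1 x * \<psi>1 x + g2 x * \<psi>2 x - of_real (k\<^sup>2 * q) * u x * \<psi> x)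
          = integral {0..2*pi} (\<lambda>t. frechet_derivative v (at (bdry \<rho> t)) (bdry_normal \<rho> t)
                                     * \<psi> (bdry \<rho> t))))"

end

theory Submission
  imports Defs "HOL-Complex_Analysis.Complex_Analysis" "HOL-Real_Asymp.Real_Asymp"
begin

text \<open>
  If \<open>\<Omega>\<close> is non-scattering for the Herglotz wave \<open>v\<close> with density \<open>\<phi>\<close>, Green's formula shows that
  \<open>\<partial>\<^sub>\<nu>v w - v \<partial>\<^sub>\<nu>w\<close> integrates to zero over the boundary for every Herglotz wave \<open>w\<close> of
  wave number \<open>k \<surd>q\<close> and every density \<open>g\<close>. This integral is entire in \<open>k\<close>, so infinitely many
  non-scattering \<open>k\<close> yield zeros along a sequence \<open>k\<^sub>n \<rightarrow> \<infinity>\<close>, common to all \<open>g\<close>.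

  On the boundary, one-dimensional stationary phase replaces \<open>v\<close> by
  \<open>\<phi>(t) \<beta> exp(i k \<rho>(t)) + \<phi>(t+\<pi>) cnj \<beta> exp(-i k \<rho>(t))\<close>, up to a factor \<open>(k \<rho>(t))\<^bsup>-1/2\<^esup>\<close>,
  and similarly for \<open>w\<close>. If \<open>g\<close> is supported where \<open>\<rho>\<close> is a constant \<open>R\<close>, the terms
  containing \<open>g(t+\<pi>)\<close> oscillate and vanish in the limit because \<open>\<rho>' \<noteq> 0\<close> almost everywhere there.
  What remains forces \<open>(\<surd>q - 1) |a| = (\<surd>q + 1) |b|\<close> for \<open>a = \<integral>\<phi> g\<close> and
  \<open>b = \<integral>\<phi>(\<cdot>+\<pi>) g\<close>; translating \<open>g\<close> by \<open>\<pi>\<close> gives the same relation with \<open>a\<close> and \<open>b\<close> exchanged.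
  Hence \<open>a = b = 0\<close>, so \<open>\<phi>\<close> vanishes on a dense set.
\<close>

section \<open>Oscillatory integrals\<close>

text \<open>Along the zeros \<open>ks\<close> the two surviving terms carry unrelated phases such as
  \<open>cis (k * ((1 + \<sigma>) * R))\<close> and \<open>cis (k * ((\<sigma> - 1) * R))\<close>,
  with \<open>\<sigma> = sqrt q\<close>, so no limit can be taken and only moduli can be compared.
  One modulus relation has nonzero solutions; the two together do not, because (\<sigma> + 1) /
  (\<sigma> - 1) differs from its inverse. Analyticity in k is what produces large zeros even if the
  non-scattering wave numbers stay bounded: they then accumulate, and every pairing vanishes
  identically. The radius may take different constants on different components of the set where it
  is stationary, so the test density is a bump around a single point. The phase on the boundary
  depends on the boundary point t, so stationary phase is needed with an error uniform in t; for C^1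
  amplitudes an error of order s^(-2/3), against the leading s^(-1/2), is within reach by elementary
  means. The total field u is only in H^1. Green's formula for it is therefore assembled from the
  weak Neumann condition and from the approximation of u - v by test functions.\<close>

lemma has_vector_derivative_cis [derivative_intros]:
  assumes "(f has_real_derivative f') (at x within S)"
  shows "((\<lambda>x. cis (f x)) has_vector_derivative (\<i> * of_real f' * cis (f x))) (at x within S)"
proof -
  have "((\<lambda>x. \<i> * complex_of_real (f x)) has_vector_derivative \<i> * of_real f') (at x within S)"
    using assms by (intro has_vector_derivative_mult_right has_vector_derivative_of_real)
       (simp add: has_real_derivative_iff_has_vector_derivative)
  from field_vector_diff_chain_within[OF this DERIV_subset[OF DERIV_exp subset_UNIV]]
  have "((\<lambda>x. exp (\<i> * complex_of_real (f x))) has_vector_derivative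
      (\<i> * of_real f' * exp (\<i> * complex_of_real (f x)))) (at x within S)"
    by (simp add: o_def)
  then show ?thesis by (simp add: cis_conv_exp)
qed

lemma continuous_on_cis' [continuous_intros]:
  "continuous_on S f \<Longrightarrow> continuous_on S (\<lambda>x. cis (f x))"
  by (simp add: cis_conv_exp continuous_intros)

lemma continuous_on_Icc_bounded:
  fixes f :: "real \<Rightarrow> 'a::real_normed_vector"
  assumes "continuous_on {a..b} f"
  obtains K where "K \<ge> 0" "\<And>x. x \<in> {a..b} \<Longrightarrow> norm (f x) \<le> K"
proof -
  obtain K where "\<forall>y \<in> f ` {a..b}. norm y \<le> K"
    using compact_imp_bounded[OF compact_continuous_image[OF assms compact_Icc]]
    by (auto simp: bounded_iff)
  then show ?thesis by (intro that[of "max 0 K"]) (auto simp: le_max_iff_disj)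
qed

text \<open>Integration by parts: \<open>p' * cis (s * p)\<close> is the derivative of
  \<open>cis (s * p)\<close> divided by i s. Keeping \<open>p'\<close> as a factor of the integrand
  avoids dividing by it, so \<open>p\<close> may have stationary points; later uses put a reciprocal
  of \<open>p'\<close>, regularised if necessary, into \<open>c\<close>.\<close>

lemma norm_oscillatory_integral_le:
  fixes c c' :: "real \<Rightarrow> complex" and p p' :: "real \<Rightarrow> real"
  assumes "a \<le> b" "s \<noteq> 0"
    and p: "\<And>x. x \<in> {a..b} \<Longrightarrow> (p has_real_derivative p' x) (at x within {a..b})"
    and p': "continuous_on {a..b} p'"
    and c: "\<And>x. x \<in> {a..b} \<Longrightarrow> (c has_vector_derivative c' x) (at x within {a..b})"
    and c': "continuous_on {a..b} c'"
    and A: "\<And>x. x \<in> {a..b} \<Longrightarrow> norm (c x) \<le> A"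
    and K: "\<And>x. x \<in> {a..b} \<Longrightarrow> norm (c' x) \<le> K"
  shows "norm (integral {a..b} (\<lambda>x. c x * of_real (p' x) * cis (s * p x))) \<le> (2 * A + K * (b - a)) / \<bar>s\<bar>"
proof -
  have pc: "continuous_on {a..b} p"
    using p by (rule DERIV_continuous_on)
  have cc: "continuous_on {a..b} c"
    using c by (rule continuous_on_vector_derivative)
  note [continuous_intros] = pc cc p' c'
  define I where "I = integral {a..b} (\<lambda>x. c x * of_real (p' x) * cis (s * p x))"
  define J where "J = integral {a..b} (\<lambda>x. c' x * cis (s * p x))"
  have "((\<lambda>x. c x * (\<i> * of_real (s * p' x) * cis (s * p x)) + c' x * cis (s * p x)) has_integral
      (c b * cis (s * p b) - c a * cis (s * p a))) {a..b}"
    by (rule fundamental_theorem_of_calculus[OF \<open>a \<le> b\<close>])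
       (auto intro!: derivative_eq_intros has_vector_derivative_mult p c)
  moreover have "((\<lambda>x. c x * (\<i> * of_real (s * p' x) * cis (s * p x)) + c' x * cis (s * p x)) has_integral
      (\<i> * of_real s) * I + J) {a..b}"
  proof (rule has_integral_add)
    have "((\<lambda>x. c x * of_real (p' x) * cis (s * p x)) has_integral I) {a..b}"
      unfolding I_def by (intro integrable_integral integrable_continuous_real continuous_intros)
    then have "((\<lambda>x. (\<i> * of_real s) * (c x * of_real (p' x) * cis (s * p x))) has_integral (\<i> * of_real s) * I) {a..b}"
      by (rule has_integral_mult_right)
    then show "((\<lambda>x. c x * (\<i> * of_real (s * p' x) * cis (s * p x))) has_integral (\<i> * of_real s) * I) {a..b}"
      by (simp add: mult_ac)
    show "((\<lambda>x. c' x * cis (s * p x)) has_integral J) {a..b}"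
      unfolding J_def by (intro integrable_integral integrable_continuous_real continuous_intros)
  qed
  ultimately have eq: "(\<i> * of_real s) * I = c b * cis (s * p b) - c a * cis (s * p a) - J"
    using has_integral_unique by (metis (no_types, lifting) add_diff_cancel_right')
  have J: "norm J \<le> K * (b - a)"
    unfolding J_def using K
    by (intro integral_bound \<open>a \<le> b\<close> continuous_intros) (auto simp: norm_mult)
  have "\<bar>s\<bar> * norm I = norm (c b * cis (s * p b) - c a * cis (s * p a) - J)"
    unfolding eq[symmetric] by (simp add: norm_mult)
  also have "\<dots> \<le> norm (c b * cis (s * p b)) + norm (c a * cis (s * p a)) + norm J"
    by (meson add_mono norm_triangle_ineq4 order_refl order_trans)
  also have "\<dots> \<le> 2 * A + K * (b - a)"
    using A[of a] A[of b] \<open>a \<le> b\<close> J by (simp add: norm_mult)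
  finally show ?thesis
    using \<open>s \<noteq> 0\<close> unfolding I_def by (simp add: field_simps)
qed

text \<open>The weight \<open>W d = d\<^sup>2 / (p'\<^sup>2 + d\<^sup>2)\<close> cuts out the stationary points: the part of \<open>h\<close> carrying
  \<open>1 - W d\<close> is integrated by parts, the rest is small in \<open>L\<^sup>1\<close> as \<open>d\<close> tends to zero.\<close>

lemma oscillatory_integral_tendsto_0:
  fixes h h' :: "real \<Rightarrow> complex" and p p' p'' :: "real \<Rightarrow> real"
  assumes "a \<le> b"
    and p: "\<And>x. (p has_real_derivative p' x) (at x)"
    and p': "\<And>x. (p' has_real_derivative p'' x) (at x)"
    and p'': "continuous_on UNIV p''"
    and h: "\<And>x. (h has_vector_derivative h' x) (at x)"
    and h': "continuous_on UNIV h'"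
    and ae: "AE x in lborel. x \<in> {a..b} \<longrightarrow> h x = 0 \<or> p' x \<noteq> 0"
  shows "((\<lambda>k. integral {a..b} (\<lambda>x. h x * cis (k * p x))) \<longlongrightarrow> 0) at_top"
proof -
  have pc: "continuous_on S p" for S
    by (meson DERIV_continuous_on has_field_derivative_at_within p)
  have pc': "continuous_on S p'" for S
    by (meson DERIV_continuous_on has_field_derivative_at_within p')
  have hc: "continuous_on S h" for S
    by (meson continuous_on_vector_derivative has_vector_derivative_at_within h)
  have pc'': "continuous_on S p''" for S
    using continuous_on_subset[OF p''] by auto
  have hc': "continuous_on S h'" for S
    using continuous_on_subset[OF h'] by auto
  note [continuous_intros] = pc pc' pc'' hc hc'
  define W where "W d x = d\<^sup>2 / ((p' x)\<^sup>2 + d\<^sup>2)" for d x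
  have W01: "0 \<le> W d x" "W d x \<le> 1" for d x
    unfolding W_def by (auto simp: divide_le_eq_1 sum_power2_gt_zero_iff)
  have Wc [continuous_intros]: "continuous_on S (W d)" if "d > 0" for d S
    unfolding W_def using that by (intro continuous_intros) (auto simp: add_nonneg_eq_0_iff)
  define D where "D d = integral {a..b} (\<lambda>x. norm (h x) * W d x)" for d
  \<comment> \<open>Dominated convergence: the integrand tends to 0 where \<open>p' x\<close> is
    nonzero and is 0 where \<open>h x = 0\<close>; by \<open>ae\<close> this covers almost every
    point of the interval.\<close>
  have D: "(\<lambda>n. D (1 / real (Suc n))) \<longlonglongrightarrow> 0"
  proof -
    let ?s = "\<lambda>n x. indicator {a..b} x *\<^sub>R (norm (h x) * W (1 / real (Suc n)) x)"
    have "(\<lambda>n. \<integral>x. ?s n x \<partial>lborel) \<longlonglongrightarrow> (\<integral>x. 0 \<partial>(lborel::real measure))"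
    proof (rule integral_dominated_convergence)
      show "integrable lborel (\<lambda>x. indicator {a..b} x *\<^sub>R norm (h x))"
        using borel_integrable_atLeastAtMost'[of a b "\<lambda>x. norm (h x)"]
        by (auto simp: set_integrable_def intro!: continuous_intros)
      show "?s n \<in> borel_measurable lborel" for n
        using borel_integrable_atLeastAtMost'[of a b "\<lambda>x. norm (h x) * W (1 / real (Suc n)) x"]
        by (simp add: set_integrable_def continuous_intros borel_measurable_integrable del: of_nat_Suc)
      show "AE x in lborel. norm (?s n x) \<le> indicator {a..b} x *\<^sub>R norm (h x)" for n
        using W01 by (auto intro!: AE_I2 simp: indicator_def abs_mult intro: mult_left_le)
      show "AE x in lborel. (\<lambda>n. ?s n x) \<longlonglongrightarrow> 0"
        using ae
      proof eventually_elim
        case (elim x)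
        show ?case
        proof (cases "x \<in> {a..b} \<and> h x \<noteq> 0")
          case True
          then have "p' x \<noteq> 0" using elim by auto
          have "(\<lambda>n. 1 / real (Suc n)) \<longlonglongrightarrow> 0"
            by (rule LIMSEQ_Suc) (rule lim_1_over_n)
          then have "(\<lambda>n. W (1 / real (Suc n)) x) \<longlonglongrightarrow> 0\<^sup>2 / ((p' x)\<^sup>2 + 0\<^sup>2)"
            unfolding W_def using \<open>p' x \<noteq> 0\<close> by (intro tendsto_intros) auto
          then have "(\<lambda>n. W (1 / real (Suc n)) x) \<longlonglongrightarrow> 0" by simp
          then show ?thesis
            by (intro tendsto_eq_intros) auto
        qed auto
      qed
    qed auto
    moreover have "(\<integral>x. ?s n x \<partial>lborel) = D (1 / real (Suc n))" for n
      unfolding D_def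
      using set_borel_integral_eq_integral(2)[OF borel_integrable_atLeastAtMost'[of a b "\<lambda>x. norm (h x) * W (1 / real (Suc n)) x"]]
      by (simp add: set_lebesgue_integral_def continuous_intros)
    ultimately show ?thesis by simp
  qed
  show ?thesis
  proof (rule tendstoI)
    fix e :: real assume "e > 0"
    then have "\<forall>\<^sub>F n in sequentially. dist (D (1 / real (Suc n))) 0 < e / 2"
      using D by (intro tendstoD) auto
    then obtain n where n: "\<bar>D (1 / real (Suc n))\<bar> < e / 2"
      by (auto simp: eventually_sequentially dist_real_def)
    define d where "d = 1 / real (Suc n)"
    have "d > 0" by (simp add: d_def)
    then have d0: "(p' x)\<^sup>2 + d\<^sup>2 > 0" for x by (simp add: add_nonneg_pos)
    then have d1: "(p' x)\<^sup>2 + d\<^sup>2 \<noteq> 0" for x by (metis less_irrefl)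
    \<comment> \<open>A regularised 1 / p': one has \<open>r x * p' x = 1 - W d x\<close>, with a
      denominator bounded below by \<open>d^2\<close>. For the fixed \<open>d\<close> the amplitude
      \<open>c\<close> is thus C^1 and has finite bounds \<open>A\<close> and
      \<open>K\<close>.\<close>
    define r where "r x = p' x / ((p' x)\<^sup>2 + d\<^sup>2)" for x
    define r' where "r' x = (p'' x * ((p' x)\<^sup>2 + d\<^sup>2) - p' x * (2 * p' x * p'' x)) / ((p' x)\<^sup>2 + d\<^sup>2)\<^sup>2" for x
    define c where "c x = of_real (r x) * h x" for x
    define c' where "c' x = of_real (r x) * h' x + of_real (r' x) * h x" for x
    have r: "(r has_real_derivative r' x) (at x)" for x
      unfolding r_def r'_def using d1[of x]
      by (auto intro!: derivative_eq_intros p' simp: power2_eq_square)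
    have c: "(c has_vector_derivative c' x) (at x)" for x
      unfolding c_def c'_def
      by (intro has_vector_derivative_mult has_vector_derivative_of_real h)
         (use r in \<open>simp add: has_real_derivative_iff_has_vector_derivative\<close>)
    have cc': "continuous_on {a..b} c'" unfolding c'_def r_def r'_def
      using d1 by (intro continuous_intros) auto
    have cc: "continuous_on {a..b} c" unfolding c_def r_def 
      using d1 by (intro continuous_intros) auto
    obtain A where A: "\<And>x. x \<in> {a..b} \<Longrightarrow> norm (c x) \<le> A"
      using continuous_on_Icc_bounded[OF cc] by metis
    obtain K where K: "\<And>x. x \<in> {a..b} \<Longrightarrow> norm (c' x) \<le> K"
      using continuous_on_Icc_bounded[OF cc'] by metis
    have "((\<lambda>k. (2 * A + K * (b - a)) / \<bar>k\<bar>) \<longlongrightarrow> 0) at_top"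
      by real_asymp
    then have "\<forall>\<^sub>F k in at_top. dist ((2 * A + K * (b - a)) / \<bar>k\<bar>) 0 < e / 2"
      using \<open>e > 0\<close> by (intro tendstoD) auto
    then show "\<forall>\<^sub>F k in at_top. dist (integral {a..b} (\<lambda>x. h x * cis (k * p x))) 0 < e"
      using eventually_gt_at_top[of 0]
    proof eventually_elim
      case (elim k)
      have split: "h x = c x * of_real (p' x) + h x * of_real (W d x)" for x
      proof -
        have "r x * p' x + W d x = 1"
          unfolding r_def W_def using d1[of x] by (simp add: power2_eq_square flip: add_divide_distrib)
        then have "of_real (r x) * of_real (p' x) + of_real (W d x) = (1::complex)"
          by (metis of_real_1 of_real_add of_real_mult)
        then have "h x = h x * (of_real (r x) * of_real (p' x) + of_real (W d x))" by simp
        then show ?thesis unfolding c_def by (simp only: ring_distribs mult_ac)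
      qed
      have "integral {a..b} (\<lambda>x. h x * cis (k * p x)) =
          integral {a..b} (\<lambda>x. c x * of_real (p' x) * cis (k * p x) + h x * of_real (W d x) * cis (k * p x))"
        by (subst split) (simp add: ring_distribs)
      also have "\<dots> = integral {a..b} (\<lambda>x. c x * of_real (p' x) * cis (k * p x)) + 
          integral {a..b} (\<lambda>x. h x * of_real (W d x) * cis (k * p x))"
        using \<open>d > 0\<close> by (intro integral_add integrable_continuous_real continuous_intros cc)
      finally have eq: "integral {a..b} (\<lambda>x. h x * cis (k * p x)) = \<dots>" .
      have "norm (integral {a..b} (\<lambda>x. c x * of_real (p' x) * cis (k * p x))) \<le> (2 * A + K * (b - a)) / \<bar>k\<bar>"
        using elim \<open>a \<le> b\<close> A K
        by (intro norm_oscillatory_integral_le[where c'=c'])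
           (auto intro: has_field_derivative_at_within p has_vector_derivative_at_within c intro!: continuous_intros cc')
      moreover have "norm (integral {a..b} (\<lambda>x. h x * of_real (W d x) * cis (k * p x))) \<le> D d"
        unfolding D_def using W01 \<open>d > 0\<close>
        by (intro integral_norm_bound_integral integrable_continuous_real continuous_intros)
           (auto simp: norm_mult)
      moreover have "(2 * A + K * (b - a)) / \<bar>k\<bar> < e / 2" "D d < e / 2"
        using elim(1) n unfolding d_def dist_real_def diff_zero by linarith+
      ultimately show ?case
        unfolding eq using norm_triangle_ineq[of "integral {a..b} (\<lambda>x. c x * of_real (p' x) * cis (k * p x))"
           "integral {a..b} (\<lambda>x. h x * of_real (W d x) * cis (k * p x))"]
        by (simp only: dist_norm diff_zero)
    qed
  qed
qed

text \<open>Taylor gives x - sin x <= x^3 / 6, and x^2 <= 4 turns this into 2 x / 3. The range up to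
  2 covers [0, pi/2], where the bound controls 1 / sin x.\<close>

lemma sin_ge_third:
  fixes x :: real
  assumes "0 \<le> x" "x \<le> 2"
  shows "sin x \<ge> x / 3"
proof -
  have "\<bar>sin x - (\<Sum>m<3. sin_coeff m * x ^ m)\<bar> \<le> inverse (fact 3) * \<bar>x\<bar> ^ 3"
    by (rule Maclaurin_sin_bound)
  moreover have "(\<Sum>m<3. sin_coeff m * x ^ m) = x"
    by (simp add: sin_coeff_def numeral_eq_Suc)
  moreover have "x ^ 3 \<le> 4 * x"
    using mult_mono[OF assms(2) assms(2)] assms
    by (simp add: power3_eq_cube mult_right_mono)
  moreover have "x - sin x \<le> \<bar>sin x - x\<bar>" by linarith
  ultimately show ?thesis using assms(1) by (simp add: fact_numeral)
qed

text \<open>The integrand is the derivative of i / y times itself, up to a term of modulus 1 / y^2.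
  The boundary terms 1 / Y + 1 / Z and the remainder 1 / Y - 1 / Z add up to 2 / Y, a tail bound
  independent of Z.\<close>

lemma integral_cis_square_le:
  assumes "0 < Y" "Y \<le> Z"
  shows "norm (integral {Y..Z} (\<lambda>y. cis (- (y\<^sup>2 / 2)))) \<le> 2 / Y"
proof -
  let ?e = "\<lambda>y::real. cis (- (y\<^sup>2 / 2))"
  have nz: "y \<noteq> 0" if "y \<in> {Y..Z}" for y using that assms by auto
  have 1: "((\<lambda>y. \<i> * of_real (1 / y) * (\<i> * of_real (- y) * ?e y) + \<i> * of_real (- 1 / y\<^sup>2) * ?e y) has_integral
      (\<i> * of_real (1 / Z) * ?e Z - \<i> * of_real (1 / Y) * ?e Y)) {Y..Z}"
  proof (rule fundamental_theorem_of_calculus[OF \<open>Y \<le> Z\<close>])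
    fix y assume y: "y \<in> {Y..Z}"
    have "((\<lambda>y. 1 / y) has_real_derivative (- 1 / y\<^sup>2)) (at y within {Y..Z})"
      using nz[OF y] by (auto intro!: derivative_eq_intros simp: power2_eq_square)
    then have "((\<lambda>y. \<i> * of_real (1 / y)) has_vector_derivative \<i> * of_real (- 1 / y\<^sup>2)) (at y within {Y..Z})"
      by (intro has_vector_derivative_mult_right has_vector_derivative_of_real)
    then show "((\<lambda>y. \<i> * of_real (1 / y) * ?e y) has_vector_derivative
      \<i> * of_real (1 / y) * (\<i> * of_real (- y) * ?e y) + \<i> * of_real (- 1 / y\<^sup>2) * ?e y) (at y within {Y..Z})"
      by (rule has_vector_derivative_mult) (auto intro!: derivative_eq_intros)
  qed
  have ce: "continuous_on {Y..Z} ?e" by (auto intro!: continuous_intros)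
  have inv: "continuous_on {Y..Z} (\<lambda>y. - 1 / y\<^sup>2)"
    by (intro continuous_intros) (use nz in auto)
  have c2: "continuous_on {Y..Z} (\<lambda>y. \<i> * of_real (- 1 / y\<^sup>2) * ?e y)"
    by (intro continuous_intros inv ce)
  have "((\<lambda>y. ?e y + \<i> * of_real (- 1 / y\<^sup>2) * ?e y) has_integral
      (\<i> * of_real (1 / Z) * ?e Z - \<i> * of_real (1 / Y) * ?e Y)) {Y..Z}"
    by (rule has_integral_eq[OF _ 1]) (use nz in \<open>auto simp flip: of_real_mult\<close>)
  then have eq: "integral {Y..Z} ?e = \<i> * of_real (1 / Z) * ?e Z - \<i> * of_real (1 / Y) * ?e Y
      - integral {Y..Z} (\<lambda>y. \<i> * of_real (- 1 / y\<^sup>2) * ?e y)"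
    using integral_add[OF integrable_continuous_real[OF ce] integrable_continuous_real[OF c2]]
    by (simp add: integral_unique)
  have 3: "((\<lambda>y. 1 / y\<^sup>2) has_integral (- 1 / Z - (- 1 / Y))) {Y..Z}"
    by (rule fundamental_theorem_of_calculus[OF \<open>Y \<le> Z\<close>])
       (use nz in \<open>auto intro!: derivative_eq_intros simp: power2_eq_square has_real_derivative_iff_has_vector_derivative[symmetric]\<close>)
  have "norm (integral {Y..Z} (\<lambda>y. \<i> * of_real (- 1 / y\<^sup>2) * ?e y)) \<le> integral {Y..Z} (\<lambda>y. 1 / y\<^sup>2)"
    by (intro integral_norm_bound_integral integrable_continuous_real[OF c2] has_integral_integrable[OF 3])
      (auto simp: norm_mult norm_divide norm_power)
  also have "\<dots> = 1 / Y - 1 / Z"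
    using 3 by (simp add: integral_unique)
  finally have 4: "norm (integral {Y..Z} (\<lambda>y. \<i> * of_real (- 1 / y\<^sup>2) * ?e y)) \<le> 1 / Y - 1 / Z" .
  have "norm (integral {Y..Z} ?e) \<le> norm (\<i> * of_real (1 / Z) * ?e Z) + norm (\<i> * of_real (1 / Y) * ?e Y)
      + norm (integral {Y..Z} (\<lambda>y. \<i> * of_real (- 1 / y\<^sup>2) * ?e y))"
    unfolding eq by (meson add_mono norm_triangle_ineq4 order_refl order_trans)
  also have "\<dots> \<le> 1 / Z + 1 / Y + (1 / Y - 1 / Z)"
    using 4 assms by (intro add_mono) (auto simp: norm_mult norm_divide)
  finally show ?thesis by simp
qed

text \<open>Both sides have the same derivative in \<open>Y\<close> (substitute \<open>y = Y x\<close>) and agree at \<open>Y = 0\<close>.\<close>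

lemma fresnel_square:
  assumes "Y \<ge> 0"
  shows "(integral {0..Y} (\<lambda>y. cis (- (y\<^sup>2 / 2))))\<^sup>2 =
    - (\<i> * of_real (pi / 2)) +
     2 * \<i> * integral {0..1} (\<lambda>x. of_real (1 / (1 + x\<^sup>2)) * cis (Y\<^sup>2 / 2 * - (1 + x\<^sup>2)))"
proof -
  let ?e = "\<lambda>y::real. cis (- (y\<^sup>2 / 2))"
  define F where "F Y = integral {0..Y} ?e" for Y
  define G where "G Y = integral {0..1} (\<lambda>x. of_real (1 / (1 + x\<^sup>2)) * cis (Y\<^sup>2 / 2 * - (1 + x\<^sup>2)))" for Y :: real
  define G' where "G' Y = integral {0..1} (\<lambda>x. - \<i> * of_real Y * cis (Y\<^sup>2 / 2 * - (1 + x\<^sup>2)))" for Y :: real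
  have nz: "1 + x\<^sup>2 \<noteq> 0" for x :: real
    by (metis add.commute add_nonneg_eq_0_iff zero_le_power2 zero_neq_one zero_le_one)
  have F: "(F has_vector_derivative ?e z) (at z within {0..Y})" if "z \<in> {0..Y}" for z
    unfolding F_def using that by (intro integral_has_vector_derivative continuous_intros) auto
  have "(G has_vector_derivative G' z) (at z within UNIV)" for z
    unfolding G_def G'_def interval_cbox
  proof (rule leibniz_rule_vector_derivative[where U=UNIV])
    fix x z :: real
    have "((\<lambda>x. cis (x\<^sup>2 / 2 * - (1 + z\<^sup>2))) has_vector_derivative
       (\<i> * of_real (- (x * (1 + z\<^sup>2))) * cis (x\<^sup>2 / 2 * - (1 + z\<^sup>2)))) (at x within UNIV)"
      by (rule has_vector_derivative_cis) (auto intro!: derivative_eq_intros simp: field_simps)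
    then have "((\<lambda>x. of_real (1 / (1 + z\<^sup>2)) * cis (x\<^sup>2 / 2 * - (1 + z\<^sup>2))) has_vector_derivative
       of_real (1 / (1 + z\<^sup>2)) * (\<i> * of_real (- (x * (1 + z\<^sup>2))) * cis (x\<^sup>2 / 2 * - (1 + z\<^sup>2)))) (at x within UNIV)"
      by (rule has_vector_derivative_mult_right)
    moreover have "of_real (1 / (1 + z\<^sup>2)) * (\<i> * of_real (- (x * (1 + z\<^sup>2))) * cis (x\<^sup>2 / 2 * - (1 + z\<^sup>2)))
       = \<i> * of_real (1 / (1 + z\<^sup>2) * - (x * (1 + z\<^sup>2))) * cis (x\<^sup>2 / 2 * - (1 + z\<^sup>2))"
      by (simp only: of_real_mult mult_ac)
    moreover have "1 / (1 + z\<^sup>2) * - (x * (1 + z\<^sup>2)) = - x"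
      using nz[of z] by simp
    ultimately show "((\<lambda>x. of_real (1 / (1 + z\<^sup>2)) * cis (x\<^sup>2 / 2 * - (1 + z\<^sup>2))) has_vector_derivative
       - \<i> * of_real x * cis (x\<^sup>2 / 2 * - (1 + z\<^sup>2))) (at x within UNIV)"
      by simp
  next
    show "(\<lambda>x. complex_of_real (1 / (1 + x\<^sup>2)) * cis (z\<^sup>2 / 2 * - (1 + x\<^sup>2))) integrable_on cbox 0 1" for z :: real
      using nz by (intro integrable_continuous continuous_intros) auto
  qed (auto simp: split_beta intro!: continuous_intros)
  then have G: "(G has_vector_derivative G' z) (at z within {0..Y})" for z
    using has_vector_derivative_within_subset by blast
  have FG: "2 * (F z * ?e z) = 2 * \<i> * G' z" if "z \<in> {0..Y}" for z
  proof -
    have "((\<lambda>x. z *\<^sub>R ?e (z * x)) has_integral integral {z * 0..z * 1} ?e) {0..1}"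
      by (rule has_integral_substitution[where c=0 and d=z])
         (use that in \<open>auto intro!: continuous_intros derivative_eq_intros simp: mult_left_le\<close>)
    then have "((\<lambda>x. (z *\<^sub>R ?e (z * x)) * ?e z) has_integral F z * ?e z) {0..1}"
      unfolding F_def by (intro has_integral_mult_left) simp
    moreover have "z *\<^sub>R ?e (z * x) * ?e z = \<i> * (- \<i> * of_real z * cis (z\<^sup>2 / 2 * - (1 + x\<^sup>2)))" for x
      by (simp add: scaleR_conv_of_real cis_mult algebra_simps power_mult_distrib add_divide_distrib diff_divide_distrib)
    ultimately have "((\<lambda>x. \<i> * (- \<i> * of_real z * cis (z\<^sup>2 / 2 * - (1 + x\<^sup>2)))) has_integral F z * ?e z) {0..1}"
      by simp
    moreover have "((\<lambda>x. \<i> * (- \<i> * of_real z * cis (z\<^sup>2 / 2 * - (1 + x\<^sup>2)))) has_integral \<i> * G' z) {0..1}"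
      unfolding G'_def
      by (intro has_integral_mult_right integrable_integral integrable_continuous_real continuous_intros)
    ultimately have "F z * ?e z = \<i> * G' z"
      by (rule has_integral_unique)
    then show ?thesis by simp
  qed
  have "((\<lambda>z. F z * F z - 2 * \<i> * G z) has_vector_derivative 0) (at z within {0..Y})" if "z \<in> {0..Y}" for z
    using FG[OF that] by (auto intro!: derivative_eq_intros has_vector_derivative_mult F G that simp: mult.commute)
  then obtain c where c: "\<And>z. z \<in> {0..Y} \<Longrightarrow> F z * F z - 2 * \<i> * G z = c"
    using has_vector_derivative_zero_constant[of "{0..Y}" "\<lambda>z. F z * F z - 2 * \<i> * G z"] by auto
  \<comment> \<open>At Y = 0 the phase disappears and the right-hand integral is arctan 1; this is
    where pi enters.\<close>
  have "((\<lambda>x. 1 / (1 + x\<^sup>2)) has_integral arctan 1 - arctan 0) {0..1::real}"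
    by (rule fundamental_theorem_of_calculus)
       (auto intro!: derivative_eq_intros simp: has_real_derivative_iff_has_vector_derivative[symmetric] inverse_eq_divide)
  then have "((\<lambda>x. complex_of_real (1 / (1 + x\<^sup>2))) has_integral of_real (pi / 4)) {0..1::real}"
    by (intro has_integral_of_real) (simp add: arctan_one)
  then have "G 0 = of_real (pi / 4)"
    unfolding G_def by (simp add: integral_unique)
  moreover have "c = - (2 * \<i> * G 0)"
    using c[of 0] assms by (simp add: F_def)
  ultimately have "c = - (\<i> * of_real (pi / 2))" by (simp add: mult.commute)
  then have "F Y * F Y = - (\<i> * of_real (pi / 2)) + 2 * \<i> * G Y"
    using c[of Y] assms by (simp add: algebra_simps)
  then show ?thesis
    by (simp only: F_def G_def power2_eq_square)
qed

text \<open>The complete Fresnel integral over the half-line, sqrt (pi / 2) * exp (- i pi / 4).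
  \<open>Lim\<close> by itself asserts no convergence, so existence of the limit and non-vanishing
  are proved together; the proof determines the square, - i pi / 2.\<close>

definition fresnel_const :: complex where
  "fresnel_const = Lim at_top (\<lambda>Y. integral {0..Y} (\<lambda>y. cis (- (y\<^sup>2 / 2))))"

lemma tendsto_fresnel_const: "((\<lambda>Y. integral {0..Y} (\<lambda>y. cis (- (y\<^sup>2 / 2)))) \<longlongrightarrow> fresnel_const) at_top"
  and fresnel_const_nonzero: "fresnel_const \<noteq> 0"
proof -
  let ?e = "\<lambda>y::real. cis (- (y\<^sup>2 / 2))"
  define F where "F Y = integral {0..Y} ?e" for Y
  have diff: "norm (F Z - F Y) \<le> 2 / Y" if "0 < Y" "Y \<le> Z" for Y Z
  proof -
    have "F Y + integral {Y..Z} ?e = F Z"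
      unfolding F_def using that
      by (intro Henstock_Kurzweil_Integration.integral_combine integrable_continuous_real continuous_intros) auto
    then show ?thesis using integral_cis_square_le[OF that] by (metis add_diff_cancel_left')
  qed
  have "Cauchy (\<lambda>n. F (real n))"
  proof (rule CauchyI)
    fix e :: real assume "e > 0"
    obtain M where M: "real M > 2 / e" using reals_Archimedean2 by blast
    have "real M > 0" using M \<open>e > 0\<close> by (meson divide_pos_pos less_trans zero_less_numeral)
    have "2 / real M < e" using M \<open>e > 0\<close> \<open>real M > 0\<close> by (simp add: field_simps)
    have *: "norm (F (real m) - F (real n)) < e" if "n \<ge> M" "m \<ge> n" for m n
    proof -
      have "norm (F (real m) - F (real n)) \<le> 2 / real n"
        using that \<open>real M > 0\<close> by (intro diff) auto
      also have "\<dots> \<le> 2 / real M"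
        using that \<open>real M > 0\<close> by (intro divide_left_mono) auto
      finally show ?thesis using \<open>2 / real M < e\<close> by simp
    qed
    show "\<exists>M. \<forall>m\<ge>M. \<forall>n\<ge>M. norm (F (real m) - F (real n)) < e"
      using * by (metis nle_le norm_minus_commute)
  qed
  then obtain L where L: "(\<lambda>n. F (real n)) \<longlonglongrightarrow> L"
    using Cauchy_convergent_iff convergent_def by blast
  \<comment> \<open>The tail bound survives the limit along the integers and then gives convergence
    along all reals.\<close>
  have bound: "norm (L - F Y) \<le> 2 / Y" if "Y > 0" for Y
  proof (rule tendsto_upperbound)
    show "((\<lambda>n. norm (F (real n) - F Y)) \<longlongrightarrow> norm (L - F Y)) sequentially"
      by (intro tendsto_intros L)
    show "\<forall>\<^sub>F n in sequentially. norm (F (real n) - F Y) \<le> 2 / Y"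
      using eventually_ge_at_top[of "nat \<lceil>Y\<rceil>"]
    proof eventually_elim
      case (elim n) then show ?case using that by (intro diff) linarith+
    qed
  qed auto
  have FL: "(F \<longlongrightarrow> L) at_top"
  proof (rule LIM_zero_cancel)
    show "((\<lambda>Y. F Y - L) \<longlongrightarrow> 0) at_top"
    proof (rule Lim_null_comparison)
      show "\<forall>\<^sub>F Y in at_top. norm (F Y - L) \<le> 2 / Y"
        using eventually_gt_at_top[of 0]
        by eventually_elim (metis bound norm_minus_commute)
      show "((\<lambda>Y::real. 2 / Y) \<longlongrightarrow> 0) at_top" by real_asymp
    qed
  qed
  define h :: "real \<Rightarrow> complex" where "h x = of_real (1 / (1 + x\<^sup>2))" for x
  have nz: "1 + x\<^sup>2 \<noteq> 0" for x :: real
    by (metis add.commute add_nonneg_eq_0_iff zero_le_power2 zero_neq_one zero_le_one)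
  \<comment> \<open>The phase - (1 + x^2) is stationary only at x = 0, a null set, so the integral
    on the right of \<open>fresnel_square\<close> tends to 0 and only - i pi / 2 is left.\<close>
  have "((\<lambda>k. integral {0..1} (\<lambda>x. h x * cis (k * - (1 + x\<^sup>2)))) \<longlongrightarrow> 0) at_top"
  proof (rule oscillatory_integral_tendsto_0[where p'="\<lambda>x. - (2 * x)" and p''="\<lambda>x. - 2"
       and h'="\<lambda>x. of_real (- (2 * x) / (1 + x\<^sup>2)\<^sup>2)"])
    show "(h has_vector_derivative of_real (- (2 * x) / (1 + x\<^sup>2)\<^sup>2)) (at x)" for x
      unfolding h_def
      by (intro has_vector_derivative_of_real)
         (use nz in \<open>auto intro!: derivative_eq_intros simp: power2_eq_square\<close>)
    show "AE x in lborel. x \<in> {0..1} \<longrightarrow> h x = 0 \<or> - (2 * x) \<noteq> 0"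
      using AE_lborel_singleton[of "0::real"] by eventually_elim auto
    show "continuous_on UNIV (\<lambda>x::real. complex_of_real (- (2 * x) / (1 + x\<^sup>2)\<^sup>2))"
      using nz by (intro continuous_intros) auto
  qed (auto intro!: derivative_eq_intros continuous_intros)
  then have "((\<lambda>Y. integral {0..1} (\<lambda>x. h x * cis (Y\<^sup>2 / 2 * - (1 + x\<^sup>2)))) \<longlongrightarrow> 0) at_top"
    by (rule filterlim_compose) real_asymp
  then have "((\<lambda>Y. - (\<i> * of_real (pi / 2)) + 2 * \<i> * integral {0..1} (\<lambda>x. h x * cis (Y\<^sup>2 / 2 * - (1 + x\<^sup>2))))
      \<longlongrightarrow> - (\<i> * of_real (pi / 2))) at_top"
    by (auto intro!: tendsto_eq_intros)
  moreover have "\<forall>\<^sub>F Y in at_top. - (\<i> * of_real (pi / 2)) + 2 * \<i> * integral {0..1} (\<lambda>x. h x * cis (Y\<^sup>2 / 2 * - (1 + x\<^sup>2)))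
      = (F Y)\<^sup>2"
    using eventually_ge_at_top[of 0]
    by eventually_elim (simp add: fresnel_square F_def h_def)
  ultimately have "((\<lambda>Y. (F Y)\<^sup>2) \<longlongrightarrow> - (\<i> * of_real (pi / 2))) at_top"
    by (rule Lim_transform_eventually)
  then have "L\<^sup>2 = - (\<i> * of_real (pi / 2))"
    using FL tendsto_power tendsto_unique trivial_limit_at_top_linorder by blast
  then have "L \<noteq> 0" by auto
  moreover have "fresnel_const = L"
    unfolding fresnel_const_def using FL unfolding F_def by (intro tendsto_Lim) auto
  ultimately show "((\<lambda>Y. integral {0..Y} ?e) \<longlongrightarrow> fresnel_const) at_top" "fresnel_const \<noteq> 0"
    using FL by (auto simp: F_def[abs_def])
qed


text \<open>The integrand \<open>c - c 0\<close> is estimated trivially on \<open>[0, d]\<close> and integrated by parts on \<open>[d, pi/2]\<close>.\<close>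

lemma quarter_circle_integral_approx:
  fixes c c' :: "real \<Rightarrow> complex"
  assumes "s \<noteq> 0" "0 < d" "d \<le> 1"
    and c: "\<And>x. x \<in> {0..pi/2} \<Longrightarrow> (c has_vector_derivative c' x) (at x within {0..pi/2})"
    and c': "continuous_on {0..pi/2} c'"
    and M: "\<And>x. x \<in> {0..pi/2} \<Longrightarrow> norm (c' x) \<le> M"
  shows "norm (integral {0..pi/2} (\<lambda>x. c x * cis (s * cos x)) - c 0 * integral {0..pi/2} (\<lambda>x. cis (s * cos x)))
    \<le> M * (d\<^sup>2 + 30 / (\<bar>s\<bar> * d))"
proof -
  have dp: "d \<le> pi / 2" using assms pi_ge_two by linarith
  have p2: "pi / 2 \<le> 2" using pi_less_4 by simp
  have M0: "M \<ge> 0" using M[of 0] norm_ge_zero order_trans pi_ge_zero by (metis atLeastAtMost_iff divide_nonneg_pos order_refl zero_less_numeral)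
  have cc: "continuous_on {0..pi/2} c"
    using c by (rule continuous_on_vector_derivative)
  \<comment> \<open>Subtracting the value at the stationary point x = 0 makes the amplitude O(x);
    this compensates the factor 1 / sin x that appears when the derivative - sin x of the phase is
    divided out.\<close>
  define b where "b x = c x - c 0" for x
  have b: "(b has_vector_derivative c' x) (at x within {0..pi/2})" if "x \<in> {0..pi/2}" for x
    unfolding b_def using that by (auto intro!: derivative_eq_intros c)
  have bc: "continuous_on {0..pi/2} b" unfolding b_def by (intro continuous_intros cc)
  have bx: "norm (b x) \<le> M * x" if "x \<in> {0..pi/2}" for x
  proof -
    have "(c' has_integral (c x - c 0)) {0..x}"
      using that by (intro fundamental_theorem_of_calculus)
        (auto intro: has_vector_derivative_within_subset[OF c])
    then have "b x = integral {0..x} c'" by (simp add: b_def integral_unique)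
    also have "norm \<dots> \<le> M * (x - 0)"
      using that M by (intro integral_bound continuous_on_subset[OF c']) auto
    finally show ?thesis by simp
  qed
  have I: "(\<lambda>x. b x * cis (s * cos x)) integrable_on {0..pi/2}"
    by (intro integrable_continuous_real continuous_intros bc)
  have "integral {0..pi/2} (\<lambda>x. c x * cis (s * cos x)) - c 0 * integral {0..pi/2} (\<lambda>x. cis (s * cos x))
     = integral {0..pi/2} (\<lambda>x. c x * cis (s * cos x)) - integral {0..pi/2} (\<lambda>x. c 0 * cis (s * cos x))"
    by simp
  also have "\<dots> = integral {0..pi/2} (\<lambda>x. c x * cis (s * cos x) - c 0 * cis (s * cos x))"
    by (intro integral_diff[symmetric] integrable_continuous_real continuous_intros cc)
  also have "\<dots> = integral {0..pi/2} (\<lambda>x. b x * cis (s * cos x))"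
    by (simp add: b_def algebra_simps)
  also have "\<dots> = integral {0..d} (\<lambda>x. b x * cis (s * cos x)) + integral {d..pi/2} (\<lambda>x. b x * cis (s * cos x))"
    using Henstock_Kurzweil_Integration.integral_combine[OF _ dp I] \<open>0 < d\<close> by simp
  finally have eq: "integral {0..pi/2} (\<lambda>x. c x * cis (s * cos x)) - c 0 * integral {0..pi/2} (\<lambda>x. cis (s * cos x)) = \<dots>" .
  have 1: "norm (integral {0..d} (\<lambda>x. b x * cis (s * cos x))) \<le> M * d * (d - 0)"
  proof (rule integral_bound)
    show "continuous_on {0..d} (\<lambda>x. b x * cis (s * cos x))"
      using dp by (intro continuous_intros continuous_on_subset[OF bc]) auto
    fix x assume "x \<in> {0..d}"
    then show "norm (b x * cis (s * cos x)) \<le> M * d"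
      using bx[of x] dp M0 mult_left_mono[of x d M] by (simp add: norm_mult)
  qed (use assms in auto)
  have sx: "sin x \<ge> x / 3" "sin x > 0" "x > 0" if "x \<in> {d..pi/2}" for x
  proof -
    show "sin x \<ge> x / 3" using that p2 \<open>0 < d\<close> by (intro sin_ge_third) auto
    show "x > 0" using that \<open>0 < d\<close> by auto
    with \<open>sin x \<ge> x / 3\<close> show "sin x > 0" by linarith
  qed
  have sub: "{d..pi/2} \<subseteq> {0..pi/2}" using \<open>0 < d\<close> by auto
  define r where "r x = - 1 / sin x" for x :: real
  define r' where "r' x = cos x / (sin x)\<^sup>2" for x :: real
  have r: "(r has_real_derivative r' x) (at x within S)" if "x \<in> {d..pi/2}" for x S
    unfolding r_def r'_def using sx[OF that]
    by (auto intro!: derivative_eq_intros simp: power2_eq_square)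
  have rb: "\<bar>r x\<bar> \<le> 3 / x" "\<bar>r' x\<bar> \<le> 9 / x\<^sup>2" if "x \<in> {d..pi/2}" for x
  proof -
    have "inverse (sin x) \<le> inverse (x / 3)"
      using sx[OF that] by (intro le_imp_inverse_le) auto
    then have *: "1 / sin x \<le> 3 / x" by (simp add: inverse_eq_divide)
    then show "\<bar>r x\<bar> \<le> 3 / x" unfolding r_def using sx[OF that] by (simp add: abs_divide)
    have "\<bar>r' x\<bar> = \<bar>cos x\<bar> * (1 / sin x)\<^sup>2" by (simp add: r'_def abs_mult power_divide)
    also have "\<dots> \<le> 1 * (3 / x)\<^sup>2"
      using * sx[OF that] by (intro mult_mono power_mono) auto
    finally show "\<bar>r' x\<bar> \<le> 9 / x\<^sup>2" by (simp add: power_divide)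
  qed
  have rc: "continuous_on {d..pi/2} r" using r by (rule DERIV_continuous_on)
  have rc': "continuous_on {d..pi/2} r'" unfolding r'_def using sx(2) by (intro continuous_intros) fastforce+
  have "norm (integral {d..pi/2} (\<lambda>x. (of_real (r x) * b x) * of_real (- sin x) * cis (s * cos x)))
     \<le> (2 * (3 * M) + (12 * M / d) * (pi/2 - d)) / \<bar>s\<bar>"
  proof (rule norm_oscillatory_integral_le[where c'="\<lambda>x. of_real (r x) * c' x + of_real (r' x) * b x"])
    show "((\<lambda>x. of_real (r x) * b x) has_vector_derivative of_real (r x) * c' x + of_real (r' x) * b x) (at x within {d..pi/2})"
      if "x \<in> {d..pi/2}" for x
      using that sub by (intro has_vector_derivative_mult has_vector_derivative_of_real r
          has_vector_derivative_within_subset[OF b sub]) auto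
    show "continuous_on {d..pi/2} (\<lambda>x. of_real (r x) * c' x + of_real (r' x) * b x)"
      by (intro continuous_intros rc rc' continuous_on_subset[OF bc sub] continuous_on_subset[OF c' sub])
    show "norm (of_real (r x) * b x) \<le> 3 * M" if x: "x \<in> {d..pi/2}" for x
    proof -
      have "norm (of_real (r x) * b x) \<le> (3 / x) * (M * x)"
        unfolding norm_mult norm_of_real using rb[OF x] bx[of x] sub x sx[OF x] by (intro mult_mono) auto
      then show ?thesis using sx[OF x] by simp
    qed
    show "norm (of_real (r x) * c' x + of_real (r' x) * b x) \<le> 12 * M / d" if x: "x \<in> {d..pi/2}" for x
    proof -
      have "norm (of_real (r x) * c' x) \<le> (3 / x) * M"
        unfolding norm_mult norm_of_real using rb[OF x] M[of x] sub x sx[OF x] by (intro mult_mono) auto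
      moreover have "norm (of_real (r' x) * b x) \<le> (9 / x\<^sup>2) * (M * x)"
        unfolding norm_mult norm_of_real using rb[OF x] bx[of x] sub x sx[OF x] by (intro mult_mono) auto
      moreover have "(9 / x\<^sup>2) * (M * x) = 9 * M / x"
        using sx[OF x] by (simp add: power2_eq_square)
      ultimately have "norm (of_real (r x) * c' x + of_real (r' x) * b x) \<le> 3 * M / x + 9 * M / x"
        using norm_triangle_ineq[of "of_real (r x) * c' x" "of_real (r' x) * b x"] by simp
      also have "\<dots> = 12 * M / x" by (simp flip: add_divide_distrib)
      also have "\<dots> \<le> 12 * M / d"
        using x \<open>0 < d\<close> M0 by (intro divide_left_mono) auto
      finally show ?thesis .
    qed
  qed (use dp \<open>s \<noteq> 0\<close> in \<open>auto intro!: derivative_eq_intros continuous_intros\<close>)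
  also have "integral {d..pi/2} (\<lambda>x. (of_real (r x) * b x) * of_real (- sin x) * cis (s * cos x))
     = integral {d..pi/2} (\<lambda>x. b x * cis (s * cos x))"
  proof (rule Henstock_Kurzweil_Integration.integral_cong)
    fix x assume "x \<in> {d..pi/2}"
    then have "r x * (- sin x) = 1" using sx(2)[of x] by (simp add: r_def)
    then have "of_real (r x) * of_real (- sin x) = (1::complex)"
      by (metis of_real_1 of_real_mult)
    then have "of_real (r x) * of_real (- sin x) * (b x * cis (s * cos x)) = b x * cis (s * cos x)" by simp
    then show "(of_real (r x) * b x) * of_real (- sin x) * cis (s * cos x) = b x * cis (s * cos x)"
      by (simp only: mult_ac)
  qed
  finally have 2: "norm (integral {d..pi/2} (\<lambda>x. b x * cis (s * cos x))) \<le> (2 * (3 * M) + (12 * M / d) * (pi/2 - d)) / \<bar>s\<bar>" .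
  \<comment> \<open>The bound d <= 1 turns 6 M into 6 M / d, and pi/2 - d <= 2 gives 24 M / d; hence
    the constant 30.\<close>
  have "2 * (3 * M) + (12 * M / d) * (pi/2 - d) \<le> 6 * M / d + (12 * M / d) * 2"
  proof (intro add_mono mult_left_mono)
    show "2 * (3 * M) \<le> 6 * M / d"
      using assms M0 by (simp add: le_divide_eq mult_left_le)
  qed (use p2 assms M0 in auto)
  also have "\<dots> = 30 * M / d" by (simp flip: add_divide_distrib)
  finally have 3: "(2 * (3 * M) + (12 * M / d) * (pi/2 - d)) / \<bar>s\<bar> \<le> 30 * M / d / \<bar>s\<bar>"
    by (intro divide_right_mono) auto
  have "M * (d\<^sup>2 + 30 / (\<bar>s\<bar> * d)) = M * d * (d - 0) + 30 * M / d / \<bar>s\<bar>"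
    by (simp add: algebra_simps power2_eq_square)
  then show ?thesis
    unfolding eq using 1 2 3 norm_triangle_ineq[of "integral {0..d} (\<lambda>x. b x * cis (s * cos x))" "integral {d..pi/2} (\<lambda>x. b x * cis (s * cos x))"]
    by linarith
qed

section \<open>Stationary phase on the circle\<close>

text \<open>The leading coefficient \<open>\<surd>(2 \<pi>) exp (-i \<pi> / 4)\<close> of stationary phase; only \<open>phase_const \<noteq> 0\<close> matters.\<close>

definition phase_const :: complex where
  "phase_const = 2 * fresnel_const"

lemma phase_const_nonzero: "phase_const \<noteq> 0"
  by (simp add: phase_const_def fresnel_const_nonzero)

text \<open>The real part is pi/2 times the Bessel function J_0, the imaginary part pi/2 times the
  Struve function H_0.\<close>

definition quarter_wave :: "real \<Rightarrow> complex" where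
  "quarter_wave s = integral {0..pi/2} (\<lambda>x. cis (s * cos x))"

lemma quarter_wave_minus: "quarter_wave (- s) = cnj (quarter_wave s)"
  by (simp add: quarter_wave_def cis_cnj integral_cnj)

text \<open>The choice d = |s|^(-1/3) balances d^2 against 1 / (|s| d): both become |s|^(-2/3),
  which is o(|s|^(-1/2)), below the order of the leading term. The hypothesis |s| >= 1 gives d <=
  1.\<close>

lemma quarter_circle_integral_approx':
  fixes c c' :: "real \<Rightarrow> complex"
  assumes "\<bar>s\<bar> \<ge> 1"
    and c: "\<And>x. x \<in> {0..pi/2} \<Longrightarrow> (c has_vector_derivative c' x) (at x within {0..pi/2})"
    and c': "continuous_on {0..pi/2} c'"
    and M: "\<And>x. x \<in> {0..pi/2} \<Longrightarrow> norm (c' x) \<le> M"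
  shows "norm (integral {0..pi/2} (\<lambda>x. c x * cis (s * cos x)) - c 0 * quarter_wave s)
    \<le> M * (31 * \<bar>s\<bar> powr (-2/3))"
proof -
  define d where "d = \<bar>s\<bar> powr (-1/3)"
  have "0 < d" "d \<le> 1"
    using assms(1) powr_mono[of "-1/3" 0 "\<bar>s\<bar>"] by (auto simp: d_def split: if_splits)
  have "d\<^sup>2 = \<bar>s\<bar> powr (-2/3)"
    unfolding d_def power2_eq_square powr_add[symmetric] by simp
  moreover have "30 / (\<bar>s\<bar> * d) = 30 * \<bar>s\<bar> powr (-2/3)"
  proof -
    have "\<bar>s\<bar> * d = \<bar>s\<bar> powr 1 * \<bar>s\<bar> powr (-1/3)" using assms(1) by (simp add: d_def)
    also have "\<dots> = \<bar>s\<bar> powr (2/3)" unfolding powr_add[symmetric] by simp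
    finally show ?thesis by (simp add: powr_minus_divide)
  qed
  ultimately have "d\<^sup>2 + 30 / (\<bar>s\<bar> * d) = 31 * \<bar>s\<bar> powr (-2/3)" by simp
  then show ?thesis
    using quarter_circle_integral_approx[OF _ \<open>0 < d\<close> \<open>d \<le> 1\<close> c c' M, of s] assms(1)
    by (simp add: quarter_wave_def)
qed

text \<open>With the weight cos (x / 2) the substitution y = 2 sqrt s sin (x / 2) is exact, since s
  cos x = s - y^2 / 2; the weighted integral \<open>H s\<close> is then an incomplete Fresnel
  integral whose upper limit grows with s. The weight equals 1 at the stationary point, so removing
  it costs only the error of \<open>quarter_circle_integral_approx'\<close>.\<close>

lemma quarter_wave_asymp:
  "((\<lambda>s. of_real (sqrt s) * cis (- s) * quarter_wave s) \<longlongrightarrow> fresnel_const) at_top"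
proof -
  define F where "F Y = integral {0..Y} (\<lambda>y. cis (- (y\<^sup>2 / 2)))" for Y
  define H where "H s = integral {0..pi/2} (\<lambda>x. of_real (cos (x / 2)) * cis (s * cos x))" for s
  have H: "of_real (sqrt s) * cis (- s) * H s = F (2 * sqrt s * sin (pi / 4))" if "s > 0" for s
  proof -
    have s0: "sqrt s \<ge> 0" "s \<ge> 0" using that by auto
    have "((\<lambda>x. (sqrt s * cos (x / 2)) *\<^sub>R cis (- ((2 * sqrt s * sin (x / 2))\<^sup>2 / 2))) has_integral
        integral {2 * sqrt s * sin (0 / 2)..2 * sqrt s * sin (pi / 2 / 2)} (\<lambda>y. cis (- (y\<^sup>2 / 2)))) {0..pi/2}"
    proof (rule has_integral_substitution[where c="- 2 * sqrt s" and d="2 * sqrt s"])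
      show "2 * sqrt s * sin (0 / 2) \<le> 2 * sqrt s * sin (pi / 2 / 2)"
        using s0 by (simp add: sin_ge_zero)
      show "(\<lambda>x. 2 * sqrt s * sin (x / 2)) ` {0..pi / 2} \<subseteq> {- 2 * sqrt s..2 * sqrt s}"
      proof clarify
        fix x :: real
        have "\<bar>2 * sqrt s * sin (x / 2)\<bar> \<le> 2 * sqrt s * 1"
          unfolding abs_mult using s0 by (intro mult_mono) auto
        then show "2 * sqrt s * sin (x / 2) \<in> {- 2 * sqrt s..2 * sqrt s}"
          by (auto simp: abs_le_iff)
      qed
    qed (auto intro!: continuous_intros derivative_eq_intros)
    moreover have "(sqrt s * cos (x / 2)) *\<^sub>R cis (- ((2 * sqrt s * sin (x / 2))\<^sup>2 / 2))
      = of_real (sqrt s) * cis (- s) * (of_real (cos (x / 2)) * cis (s * cos x))" for x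
    proof -
      have "cos x = 1 - 2 * (sin (x / 2))\<^sup>2"
        using cos_double_sin[of "x / 2"] by simp
      then have "- ((2 * sqrt s * sin (x / 2))\<^sup>2 / 2) = - s + s * cos x"
        using s0 by (simp only: power_mult_distrib real_sqrt_pow2) (simp add: algebra_simps)
      then show ?thesis by (simp add: scaleR_conv_of_real cis_mult mult_ac)
    qed
    ultimately have "((\<lambda>x. of_real (sqrt s) * cis (- s) * (of_real (cos (x / 2)) * cis (s * cos x))) has_integral
       F (2 * sqrt s * sin (pi / 4))) {0..pi/2}" by (simp add: F_def)
    from integral_unique[OF this] show ?thesis
      by (simp only: H_def integral_mult_right)
  qed
  have "((\<lambda>s. F (2 * sqrt s * sin (pi / 4))) \<longlongrightarrow> fresnel_const) at_top"
  proof (rule filterlim_compose[OF tendsto_fresnel_const[folded F_def]])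
    have "LIM s at_top. sqrt 2 * sqrt s :> at_top"
      by (rule filterlim_tendsto_pos_mult_at_top[OF tendsto_const _ sqrt_at_top]) simp
    then show "LIM s at_top. 2 * sqrt s * sin (pi / 4) :> at_top"
      by (simp add: sin_45 mult.commute)
  qed
  then have 1: "((\<lambda>s. of_real (sqrt s) * cis (- s) * H s) \<longlongrightarrow> fresnel_const) at_top"
    by (rule Lim_transform_eventually)
       (use eventually_gt_at_top[of 0] in \<open>eventually_elim, simp add: H\<close>)
  have 2: "((\<lambda>s. of_real (sqrt s) * cis (- s) * (H s - quarter_wave s)) \<longlongrightarrow> 0) at_top"
  proof (rule Lim_null_comparison)
    show "\<forall>\<^sub>F s in at_top. norm (of_real (sqrt s) * cis (- s) * (H s - quarter_wave s)) \<le>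
        sqrt s * ((1/2) * (31 * s powr (-2/3)))"
      using eventually_ge_at_top[of 1]
    proof eventually_elim
      case (elim s)
      have "norm (H s - of_real (cos (0 / 2)) * quarter_wave s) \<le> (1/2) * (31 * \<bar>s\<bar> powr (-2/3))"
        unfolding H_def
      proof (rule quarter_circle_integral_approx'[where c'="\<lambda>x. of_real (- sin (x / 2) / 2)"])
        show "((\<lambda>x. complex_of_real (cos (x / 2))) has_vector_derivative of_real (- sin (x / 2) / 2)) (at x within {0..pi/2})" for x
          by (intro has_vector_derivative_of_real) (auto intro!: derivative_eq_intros)
      qed (use elim in \<open>auto intro!: continuous_intros simp: norm_divide\<close>)
      then show ?case using elim by (simp add: norm_mult mult_left_mono)
    qed
    show "((\<lambda>s. sqrt s * ((1/2) * (31 * s powr (-2/3)))) \<longlongrightarrow> 0) at_top"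
      by real_asymp
  qed
  show ?thesis
    using tendsto_diff[OF 1 2] by (simp add: algebra_simps)
qed

text \<open>The period is taken as [-pi/2, 3 pi/2] so that the stationary points 0 and pi of the
  cosine are interior, each of the four quarter arcs having one of them as an endpoint. The error
  function is chosen before the amplitude, which enters only through a C^1 bound; this gives
  uniformity over the boundary points later.\<close>

lemma stationary_phase_circle:
  obtains \<epsilon> :: "real \<Rightarrow> real" where "(\<epsilon> \<longlongrightarrow> 0) at_top"
    "\<And>(a :: real \<Rightarrow> complex) a' M s. s \<ge> 1 \<Longrightarrow> (\<And>x. (a has_vector_derivative a' x) (at x)) \<Longrightarrow> continuous_on UNIV a' \<Longrightarrow>
      (\<And>x. x \<in> {-pi/2..3*pi/2} \<Longrightarrow> norm (a x) \<le> M) \<Longrightarrow>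
      (\<And>x. x \<in> {-pi/2..3*pi/2} \<Longrightarrow> norm (a' x) \<le> M) \<Longrightarrow>
      norm (of_real (sqrt s) * integral {-pi/2..3*pi/2} (\<lambda>x. a x * cis (s * cos x))
        - (a 0 * phase_const * cis s + a pi * cnj phase_const * cis (- s))) \<le> M * \<epsilon> s"
proof -
  define L where "L = fresnel_const"
  note L = quarter_wave_asymp[folded L_def]
  define \<eta> where "\<eta> s = norm (of_real (sqrt s) * cis (- s) * quarter_wave s - L)" for s
  define \<epsilon> where "\<epsilon> s = 4 * (sqrt s * (31 * s powr (-2/3))) + 4 * \<eta> s" for s
  have "(\<eta> \<longlongrightarrow> 0) at_top"
    unfolding \<eta>_def by (intro tendsto_norm_zero LIM_zero L)
  moreover have "((\<lambda>s. sqrt s * (31 * s powr (-2/3))) \<longlongrightarrow> 0) at_top"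
    by real_asymp
  ultimately have \<epsilon>: "(\<epsilon> \<longlongrightarrow> 0) at_top"
    unfolding \<epsilon>_def by (intro tendsto_add_zero tendsto_mult_right_zero)
  show ?thesis
  proof (rule that[OF \<epsilon>], unfold phase_const_def L_def[symmetric])
    fix a a' :: "real \<Rightarrow> complex" and M s :: real
    assume s: "s \<ge> 1" and a: "\<And>x. (a has_vector_derivative a' x) (at x)" and a': "continuous_on UNIV a'"
      and M: "\<And>x. x \<in> {-pi/2..3*pi/2} \<Longrightarrow> norm (a x) \<le> M"
      and M': "\<And>x. x \<in> {-pi/2..3*pi/2} \<Longrightarrow> norm (a' x) \<le> M"
    have M12: "norm (a 0) \<le> M" "norm (a pi) \<le> M"       by (rule M, unfold atLeastAtMost_iff, use pi_gt_zero in linarith)+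
    have ac: "continuous_on S a" for S
      by (meson a continuous_on_vector_derivative has_vector_derivative_at_within)
    have M0: "M \<ge> 0" using norm_ge_zero[of "a 0"] M12(1) by linarith
    let ?f = "\<lambda>x. a x * cis (s * cos x)"
    have fc: "continuous_on S ?f" for S by (intro continuous_intros ac)
    have fi: "?f integrable_on {u..v}" for u v by (intro integrable_continuous_real fc)
    define Q1 where "Q1 = integral {0..pi/2} (\<lambda>x. a x * cis (s * cos x))"
    define Q2 where "Q2 = integral {0..pi/2} (\<lambda>x. a (- x) * cis (s * cos x))"
    \<comment> \<open>On the two arcs at pi, cos (pi - x) = cos (pi + x) = - cos x, so s is replaced
      by -s and \<open>quarter_wave\<close> by its conjugate.\<close>
    define Q3 where "Q3 = integral {0..pi/2} (\<lambda>x. a (pi - x) * cis (- s * cos x))"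
    define Q4 where "Q4 = integral {0..pi/2} (\<lambda>x. a (pi + x) * cis (- s * cos x))"
    have "integral {-pi/2..3*pi/2} ?f = integral {-pi/2..0} ?f + (integral {0..pi/2} ?f + (integral {pi/2..pi} ?f + integral {pi..3*pi/2} ?f))"
      by (simp add: Henstock_Kurzweil_Integration.integral_combine fi)
    moreover have "integral {-pi/2..0} ?f = Q2"
      using Henstock_Kurzweil_Integration.integral_reflect_real[where f="\<lambda>x. ?f (- x)" and a=0 and b="pi/2"] by (simp add: Q2_def)
    moreover have "integral {pi..3*pi/2} ?f = Q4"
      using integral_shift[of 0 pi "pi/2" ?f] fc by (simp add: Q4_def o_def add.commute)
    moreover have "integral {pi/2..pi} ?f = Q3"
      using integral_shift[of "-pi/2" pi 0 ?f] fc
        Henstock_Kurzweil_Integration.integral_reflect_real[where f="\<lambda>x. ?f (pi - x)" and a=0 and b="pi/2"]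
      by (simp add: Q3_def o_def add.commute)
    ultimately have I: "integral {-pi/2..3*pi/2} ?f = Q2 + (Q1 + (Q3 + Q4))"
      by (simp add: Q1_def)
    let ?E = "M * (31 * s powr (-2/3))"
    let ?q = "quarter_wave s"
    have E1: "norm (Q1 - a 0 * ?q) \<le> ?E"
      using quarter_circle_integral_approx'[of s a a' M, OF _ has_vector_derivative_at_within[OF a] continuous_on_subset[OF a']]
        s M' unfolding Q1_def by simp
    have rd: "((\<lambda>x. a (u + v * x)) has_vector_derivative v *\<^sub>R a' (u + v * x)) (at x within S)" for u v x S
    proof -
      have "((\<lambda>x. u + v * x) has_vector_derivative v) (at x within S)"
        by (auto intro!: derivative_eq_intros)
      from vector_diff_chain_within[OF this has_vector_derivative_at_within[OF a]]
      show ?thesis by (simp add: o_def)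
    qed
    have rc: "continuous_on S (\<lambda>x. v *\<^sub>R a' (u + v * x))" for u v S
      by (intro continuous_intros continuous_on_compose2[OF a']) auto
    have E2: "norm (Q2 - a 0 * ?q) \<le> ?E"
      using quarter_circle_integral_approx'[of s "\<lambda>x. a (0 + (-1) * x)" "\<lambda>x. (-1) *\<^sub>R a' (0 + (-1) * x)" M,
         OF _ rd rc] s M' unfolding Q2_def by simp
    have E3: "norm (Q3 - a pi * cnj ?q) \<le> ?E"
      using quarter_circle_integral_approx'[of "- s" "\<lambda>x. a (pi + (-1) * x)" "\<lambda>x. (-1) *\<^sub>R a' (pi + (-1) * x)" M,
         OF _ rd rc] s M' unfolding Q3_def by (simp add: quarter_wave_minus)
    have E4: "norm (Q4 - a pi * cnj ?q) \<le> ?E"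
      using quarter_circle_integral_approx'[of "- s" "\<lambda>x. a (pi + 1 * x)" "\<lambda>x. 1 *\<^sub>R a' (pi + 1 * x)" M,
         OF _ rd rc] s M' unfolding Q4_def by (simp add: quarter_wave_minus)
    have sq: "norm (of_real (sqrt s) * z) \<le> sqrt s * e" if "norm z \<le> e" for z :: complex and e
      using that s by (simp add: norm_mult mult_left_mono)
    have \<eta>1: "norm (of_real (sqrt s) * ?q - L * cis s) = \<eta> s"
    proof -
      have "of_real (sqrt s) * ?q - L * cis s = cis s * (of_real (sqrt s) * cis (- s) * ?q - L)"
      proof -
        have "cis s * (of_real (sqrt s) * cis (- s) * ?q - L) = (cis s * cis (- s)) * (of_real (sqrt s) * ?q) - L * cis s"
          by (simp only: right_diff_distrib mult_ac)
        then show ?thesis by (simp add: cis_mult)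
      qed
      then show ?thesis by (simp add: norm_mult \<eta>_def)
    qed
    have \<eta>2: "norm (of_real (sqrt s) * cnj ?q - cnj L * cis (- s)) = \<eta> s"
      unfolding \<eta>1[symmetric] by (subst complex_mod_cnj[symmetric]) (simp add: cis_cnj)
    have split: "of_real (sqrt s) * integral {-pi/2..3*pi/2} ?f - (a 0 * (2 * L) * cis s + a pi * cnj (2 * L) * cis (- s))
      = of_real (sqrt s) * (Q1 - a 0 * ?q) + of_real (sqrt s) * (Q2 - a 0 * ?q)
        + of_real (sqrt s) * (Q3 - a pi * cnj ?q) + of_real (sqrt s) * (Q4 - a pi * cnj ?q)
        + 2 * a 0 * (of_real (sqrt s) * ?q - L * cis s) + 2 * a pi * (of_real (sqrt s) * cnj ?q - cnj L * cis (- s))"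
      unfolding I by (simp add: algebra_simps)
    have "norm (of_real (sqrt s) * integral {-pi/2..3*pi/2} ?f - (a 0 * (2 * L) * cis s + a pi * cnj (2 * L) * cis (- s)))
      \<le> norm (of_real (sqrt s) * (Q1 - a 0 * ?q)) + norm (of_real (sqrt s) * (Q2 - a 0 * ?q))
        + norm (of_real (sqrt s) * (Q3 - a pi * cnj ?q)) + norm (of_real (sqrt s) * (Q4 - a pi * cnj ?q))
        + norm (2 * a 0 * (of_real (sqrt s) * ?q - L * cis s)) + norm (2 * a pi * (of_real (sqrt s) * cnj ?q - cnj L * cis (- s)))"
      unfolding split by (intro norm_triangle_le add_mono order_refl)
    also have "\<dots> \<le> sqrt s * ?E + sqrt s * ?E + sqrt s * ?E + sqrt s * ?E + 2 * M * \<eta> s + 2 * M * \<eta> s"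
    proof (intro add_mono)
      show "norm (2 * a 0 * (of_real (sqrt s) * ?q - L * cis s)) \<le> 2 * M * \<eta> s"
        "norm (2 * a pi * (of_real (sqrt s) * cnj ?q - cnj L * cis (- s))) \<le> 2 * M * \<eta> s"
        unfolding norm_mult \<eta>1 \<eta>2 using M12 by (auto intro!: mult_right_mono simp: \<eta>_def)
    qed (rule sq[OF E1] sq[OF E2] sq[OF E3] sq[OF E4])+
    also have "\<dots> = M * \<epsilon> s" by (simp add: \<epsilon>_def algebra_simps)
    finally show "norm (of_real (sqrt s) * integral {-pi/2..3*pi/2} ?f
        - (a 0 * (2 * L) * cis s + a pi * cnj (2 * L) * cis (- s))) \<le> M * \<epsilon> s" .
  qed
qed

lemma integral_periodic_shift:
  fixes f :: "real \<Rightarrow> 'a::euclidean_space"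
  assumes f: "continuous_on UNIV f" and per: "\<And>x. f (x + T) = f x" and "T \<ge> 0"
  shows "integral {a..a + T} f = integral {b..b + T} f"
proof -
  have *: "integral {a..a + T} f = integral {b..b + T} f" if "a \<le> b" for a b
  proof -
    have fc: "continuous_on S f" for S by (rule continuous_on_subset[OF f]) simp
    have fi: "f integrable_on {u..v}" for u v by (intro integrable_continuous_real fc)
    have "integral {a..a + T} f + integral {a + T..b + T} f = integral {a..b + T} f"
      using \<open>T \<ge> 0\<close> that by (intro Henstock_Kurzweil_Integration.integral_combine fi) auto
    moreover have "integral {a..b} f + integral {b..b + T} f = integral {a..b + T} f"
      using \<open>T \<ge> 0\<close> that by (intro Henstock_Kurzweil_Integration.integral_combine fi) auto
    moreover have "integral {a + T..b + T} f = integral {a..b} f"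
      using integral_shift[OF fc, where a=a and b=b and c=T] by (simp only: o_def per)
    ultimately have "integral {a..b} f + integral {a..a + T} f = integral {a..b} f + integral {b..b + T} f"
      by (metis add.commute)
    then show ?thesis by (simp only: add_left_cancel)
  qed
  show ?thesis using *[of a b] *[of b a, symmetric] linear[of a b] by blast
qed

section \<open>Star-shaped domains in polar coordinates\<close>

text \<open>The change-of-variables formula is applied on \<open>real ^ 2\<close>, where the
  Jacobian is \<open>det (matrix _)\<close>; this map carries its result to the pairs in which the
  domain is given.\<close>

definition pair_of_vec :: "real ^ 2 \<Rightarrow> real \<times> real" where
  "pair_of_vec x = (x $ 1, x $ 2)"

lemma continuous_on_pair_of_vec [continuous_intros]:
  "continuous_on S f \<Longrightarrow> continuous_on S (\<lambda>x. pair_of_vec (f x))"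
  unfolding pair_of_vec_def by (intro continuous_intros)

lemma measurable_pair_of_vec [measurable]: "pair_of_vec \<in> borel_measurable borel"
  by (intro borel_measurable_continuous_onI continuous_intros)

lemma distr_pair_of_vec: "distr lborel borel pair_of_vec = (lborel :: (real \<times> real) measure)"
proof (rule lborel_eqI[symmetric])
  fix l u :: "real \<times> real"
  assume lu: "\<And>b. b \<in> Basis \<Longrightarrow> l \<bullet> b \<le> u \<bullet> b"
  define l' u' :: "real ^ 2" where "l' = vector [fst l, snd l]" and "u' = vector [fst u, snd u]"
  have le: "fst l \<le> fst u" "snd l \<le> snd u"
    using lu[of "(1, 0)"] lu[of "(0, 1)"] by (auto simp: Basis_prod_def inner_prod_def)
  have "pair_of_vec -` box l u = box l' u'"
    by (auto simp: pair_of_vec_def mem_box_cart l'_def u'_def forall_2 mem_box Basis_prod_def inner_prod_def)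
  then have "emeasure (distr lborel borel pair_of_vec) (box l u) = emeasure lborel (box l' u')"
    by (simp add: emeasure_distr)
  also have "\<dots> = ennreal (measure lborel (cbox l' u'))"
    by (simp add: emeasure_lborel_box_eq emeasure_lborel_cbox_eq measure_def)
  also have "measure lborel (cbox l' u') = (fst u - fst l) * (snd u - snd l)"
    using le by (subst content_cbox_cart) (auto simp: l'_def u'_def UNIV_2 interval_ne_empty_cart forall_2)
  also have "\<dots> = (\<Prod>b\<in>Basis. (u - l) \<bullet> b)"
    by (simp add: Basis_prod_def inner_prod_def prod.union_disjoint)
  finally show "emeasure (distr lborel borel pair_of_vec) (box l u) = ennreal (\<Prod>b\<in>Basis. (u - l) \<bullet> b)" .
qed simp

lemma set_integral_pair_of_vec:
  fixes h :: "real \<times> real \<Rightarrow> complex"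
  assumes h: "continuous_on UNIV h" and A: "A \<in> sets borel"
  shows "(LINT x:pair_of_vec -` A|lborel. h (pair_of_vec x)) = (LINT x:A|lborel. h x)"
proof -
  have [measurable]: "h \<in> borel_measurable borel"
    using h by (rule borel_measurable_continuous_onI)
  have "(LINT x:A|lborel. h x) = (LINT x:A|distr lborel borel pair_of_vec. h x)"
    by (simp add: distr_pair_of_vec)
  also have "\<dots> = (LINT x:pair_of_vec -` A|lborel. h (pair_of_vec x))"
    unfolding set_lebesgue_integral_def using A
    by (subst integral_distr) (auto simp: indicator_def vimage_def)
  finally show ?thesis ..
qed

lemma set_integrable_bounded_continuous:
  fixes h :: "'a::euclidean_space \<Rightarrow> 'b::{banach, second_countable_topology}"
  assumes "continuous_on UNIV h" "A \<in> sets borel" "bounded A"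
  shows "set_integrable lborel A h"
proof (rule set_integrable_subset)
  have "continuous_on (closure A) h"
    by (rule continuous_on_subset[OF assms(1)]) simp
  then show "set_integrable lborel (closure A) h"
    unfolding set_integrable_def
    using borel_integrable_compact[of "closure A" h] assms(3) by (simp add: compact_closure)
qed (use assms closure_subset in auto)

lemma periodic_int:
  assumes per: "\<And>t. f (t + 2 * pi) = f t"
  shows "f (t + 2 * pi * of_int n) = f t"
proof -
  have nat: "f (t + 2 * pi * of_nat m) = f t" for t m
  proof (induction m)
    case (Suc m)
    then show ?case using per[of "t + 2 * pi * of_nat m"] by (simp add: algebra_simps)
  qed simp
  show ?thesis
    using nat[of t "nat n"] nat[of "t + 2 * pi * of_int n" "nat (- n)"]
    by (cases "n \<ge> 0") auto
qed

lemma radius_functionD: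
  assumes "radius_function \<rho>"
  shows "\<rho> t > 0" "\<rho> (t + 2 * pi) = \<rho> t" "(\<rho> has_real_derivative deriv \<rho> t) (at t)"
    "continuous_on S \<rho>" "continuous_on S (deriv \<rho>)"
    "\<rho> (t + 2 * pi * of_int n) = \<rho> t"
    "deriv \<rho> (t + 2 * pi) = deriv \<rho> t"
proof -
  obtain \<rho>1 \<rho>2 where 1: "\<And>t. (\<rho> has_real_derivative \<rho>1 t) (at t)"
      and 2: "\<And>t. (\<rho>1 has_real_derivative \<rho>2 t) (at t)"
    using assms unfolding radius_function_def C2_real_def by blast
  have eq: "deriv \<rho> = \<rho>1" using 1 DERIV_imp_deriv by blast
  show "\<rho> t > 0" using assms by (simp add: radius_function_def)
  show per: "\<rho> (t + 2 * pi) = \<rho> t" for t using assms by (simp add: radius_function_def periodic2pi_def)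
  show "(\<rho> has_real_derivative deriv \<rho> t) (at t)" using 1 eq by simp
  show "continuous_on S \<rho>" by (meson 1 DERIV_continuous_on has_field_derivative_at_within)
  show "continuous_on S (deriv \<rho>)" unfolding eq by (meson 2 DERIV_continuous_on has_field_derivative_at_within)
  show "\<rho> (t + 2 * pi * of_int n) = \<rho> t" by (rule periodic_int[where f=\<rho>, OF per])
  have "((\<lambda>x. \<rho> (x + 2 * pi)) has_real_derivative \<rho>1 (t + 2 * pi)) (at t)"
    using 1[of "t + 2 * pi"] by (subst DERIV_shift[symmetric])
  then have "(\<rho> has_real_derivative \<rho>1 (t + 2 * pi)) (at t)"
    by (simp add: per)
  then show "deriv \<rho> (t + 2 * pi) = deriv \<rho> t"
    unfolding eq using 1 DERIV_unique by blast
qed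

lemma radius_function_lower_bound:
  assumes "radius_function \<rho>"
  obtains m where "m > 0" "\<And>t. t \<in> {0..2*pi} \<Longrightarrow> m \<le> \<rho> t"
proof -
  have "\<exists>s\<in>{0..2*pi}. \<forall>t\<in>{0..2*pi}. \<rho> s \<le> \<rho> t"
    by (rule continuous_attains_inf) (auto intro: radius_functionD[OF assms])
  then show ?thesis using that radius_functionD(1)[OF assms] by metis
qed

lemma radius_function_second_derivE:
  assumes "radius_function \<rho>"
  obtains \<rho>2 where "\<And>t. (deriv \<rho> has_real_derivative \<rho>2 t) (at t)" "continuous_on UNIV \<rho>2"
proof -
  obtain \<rho>1 \<rho>2 where 1: "\<And>t. (\<rho> has_real_derivative \<rho>1 t) (at t)"
      and 2: "\<And>t. (\<rho>1 has_real_derivative \<rho>2 t) (at t)" "continuous_on UNIV \<rho>2"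
    using assms unfolding radius_function_def C2_real_def by blast
  have eq: "deriv \<rho> = \<rho>1" using 1 DERIV_imp_deriv by blast
  show ?thesis using that 2 unfolding eq by blast
qed

text \<open>The sum of squares recovers the radius, and dividing by it recovers cosine and sine. The
  angle is determined only away from the origin, hence the strict \<open>r > 0\<close>.\<close>

lemma ray_eq_imp_periodic:
  assumes "radius_function \<rho>" "r * cos t = r' * cos t'" "r * sin t = r' * sin t'" "r > 0" "r' \<ge> 0"
  shows "r = r'" "\<exists>n::int. t = t' + 2 * pi * of_int n" "\<rho> t = \<rho> t'"
proof -
  have sq: "(r * cos t)\<^sup>2 + (r * sin t)\<^sup>2 = r\<^sup>2" for r t :: real
    by (simp add: power_mult_distrib flip: distrib_left)
  have "r\<^sup>2 = r'\<^sup>2" using sq[of r t] sq[of r' t'] assms by simp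
  then show r: "r = r'" using assms by (simp add: power2_eq_iff_nonneg)
  then have "sin t = sin t' \<and> cos t = cos t'" using assms by simp
  then obtain n :: int where n: "t = t' + 2 * pi * of_int n"
    unfolding sin_cos_eq_iff by (auto simp: mult_ac)
  then show "\<exists>n::int. t = t' + 2 * pi * of_int n" by blast
  show "\<rho> t = \<rho> t'" unfolding n by (rule radius_functionD[OF assms(1)])
qed

text \<open>This makes the approximating test functions of \<open>H1_0\<close> vanish on the
  boundary curve, because their supports lie inside the domain.\<close>

lemma bdry_notin_star_domain:
  assumes "radius_function \<rho>"
  shows "bdry \<rho> t \<notin> star_domain \<rho>"
proof
  assume "bdry \<rho> t \<in> star_domain \<rho>"
  then obtain r t' where *: "\<rho> t * cos t = r * cos t'" "\<rho> t * sin t = r * sin t'" "0 \<le> r" "r < \<rho> t'"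
    by (auto simp: bdry_def star_domain_def)
  with ray_eq_imp_periodic[OF assms *(1,2)] radius_functionD[OF assms] show False by auto
qed

lemma polar_coordinates:
  fixes x :: "real \<times> real"
  obtains r t where "x = (r * cos t, r * sin t)" "0 \<le> r" "0 \<le> t" "t < 2 * pi"
proof -
  let ?z = "Complex (fst x) (snd x)"
  have z: "?z = of_real (norm ?z) * exp (\<i> * of_real (Arg2pi ?z))"
    by (rule Arg2pi_eq)
  have "x = (norm ?z * cos (Arg2pi ?z), norm ?z * sin (Arg2pi ?z))"
    using arg_cong[OF z, of Re] arg_cong[OF z, of Im] by (simp add: prod_eq_iff Re_exp Im_exp)
  then show ?thesis using that[of "norm ?z" "Arg2pi ?z"] Arg2pi_ge_0[of ?z] Arg2pi_lt_2pi[of ?z] by simp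
qed

text \<open>The complement is an F_sigma set: each \<open>K n\<close> is the polar image of a
  compact set of parameters with \<rho> t <= r <= n. The closed inequality is what makes the
  complement easier to handle than the domain itself.\<close>

lemma star_domain_measurable:
  assumes "radius_function \<rho>"
  shows "star_domain \<rho> \<in> sets borel" "bounded (star_domain \<rho>)"
proof -
  note R = radius_functionD[OF assms]
  let ?f = "\<lambda>(r, t). (r * cos t, r * sin t) :: real \<times> real"
  define K where "K n = ?f ` {(r, t). r \<in> {0..real n} \<and> t \<in> {0..2*pi} \<and> \<rho> t \<le> r}" for n :: nat
  have K: "compact (K n)" for n
  proof -
    have "closed {x. \<rho> (snd x) \<le> fst x}"
      by (intro closed_Collect_le continuous_intros continuous_on_compose2[OF R(4)]) auto
    then have "compact (({0..real n} \<times> {0..2*pi}) \<inter> {x. \<rho> (snd x) \<le> fst x})"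
      by (intro compact_Int_closed compact_Times) auto
    also have "({0..real n} \<times> {0..2*pi}) \<inter> {x. \<rho> (snd x) \<le> fst x} = {(r, t). r \<in> {0..real n} \<and> t \<in> {0..2*pi} \<and> \<rho> t \<le> r}"
      by auto
    finally show ?thesis
      unfolding K_def by (intro compact_continuous_image) (auto simp: split_beta intro!: continuous_intros)
  qed
  have "- star_domain \<rho> = (\<Union>n. K n)"
  proof (intro equalityI subsetI)
    fix x assume x: "x \<in> - star_domain \<rho>"
    obtain r t where rt: "x = (r * cos t, r * sin t)" "0 \<le> r" "0 \<le> t" "t < 2 * pi"
      by (rule polar_coordinates)
    have "\<rho> t \<le> r" using x rt by (force simp: star_domain_def not_less)
    moreover obtain n where "r \<le> real n" using real_arch_simple by blast
    ultimately show "x \<in> (\<Union>n. K n)" using rt unfolding K_def by (force simp: image_iff)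
  next
    fix x assume "x \<in> (\<Union>n. K n)"
    then obtain r t where x: "x = (r * cos t, r * sin t)" "\<rho> t \<le> r" unfolding K_def by auto
    show "x \<in> - star_domain \<rho>"
    proof
      assume "x \<in> star_domain \<rho>"
      then obtain r' t' where *: "r * cos t = r' * cos t'" "r * sin t = r' * sin t'" "0 \<le> r'" "r' < \<rho> t'"
        using x by (auto simp: star_domain_def)
      have "r > 0" using x R(1)[of t] by simp
      with ray_eq_imp_periodic[OF assms *(1,2)] * x show False by auto
    qed
  qed
  moreover have "(\<Union>n. K n) \<in> sets borel"
    using K by (intro sets.countable_UN) (auto intro: borel_compact)
  ultimately show "star_domain \<rho> \<in> sets borel"
    by (metis borel_comp double_complement)
  obtain C where C: "\<And>t. t \<in> {0..2*pi} \<Longrightarrow> norm (\<rho> t) \<le> C"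
    using continuous_on_Icc_bounded[OF R(4)] by metis
  show "bounded (star_domain \<rho>)"
  proof (rule boundedI)
    fix x assume "x \<in> star_domain \<rho>"
    then obtain r t where x: "x = (r * cos t, r * sin t)" "0 \<le> r" "r < \<rho> t" by (auto simp: star_domain_def)
    define n where "n = \<lfloor>t / (2 * pi)\<rfloor>"
    have "of_int n \<le> t / (2 * pi)" "t / (2 * pi) < of_int n + 1"
      unfolding n_def by linarith+
    then have "2 * pi * of_int n \<le> t" "t < 2 * pi * of_int n + 2 * pi"
      by (simp_all add: field_simps)
    then have "t - 2 * pi * of_int n \<in> {0..2*pi}" by auto
    then have "\<rho> t \<le> C" using C[of "t - 2 * pi * of_int n"] R(6)[of "t - 2 * pi * of_int n" n] by simp
    moreover have "norm x = r"
      using x by (simp add: norm_Pair power_mult_distrib flip: distrib_left)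
    ultimately show "norm x \<le> C" using x by simp
  qed
qed

(* The two meanings of the infix make the Jacobian below exponentially ambiguous. *)
no_notation fps_nth (infixl "$" 75)


text \<open>Measuring the radius in units of \<open>\<rho> t\<close> makes the parameter domain a
  rectangle for every shape. The Jacobian s * \<rho>^2 contains no derivative of \<rho>, because the
  part of the t-derivative involving it is radial, parallel to the s-derivative.\<close>

lemma integral_star_domain:
  fixes h :: "real \<times> real \<Rightarrow> complex"
  assumes \<rho>: "radius_function \<rho>" and h: "continuous_on UNIV h"
  shows "(LINT x:star_domain \<rho>|lborel. h x) =
    integral {0..2*pi} (\<lambda>t. integral {0..1} (\<lambda>s. of_real (s * (\<rho> t)\<^sup>2) * h (s *\<^sub>R bdry \<rho> t)))"
proof -
  note R = radius_functionD[OF \<rho>]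
  define g :: "real ^ 2 \<Rightarrow> real ^ 2" where
    "g x = vector [x $ 1 * \<rho> (x $ 2) * cos (x $ 2), x $ 1 * \<rho> (x $ 2) * sin (x $ 2)]" for x
  define g' :: "real ^ 2 \<Rightarrow> real ^ 2 \<Rightarrow> real ^ 2" where
    "g' x d = vector [d $ 1 * \<rho> (x $ 2) * cos (x $ 2) + x $ 1 * (deriv \<rho> (x $ 2) * d $ 2) * cos (x $ 2)
                        - x $ 1 * \<rho> (x $ 2) * (sin (x $ 2) * d $ 2),
                      d $ 1 * \<rho> (x $ 2) * sin (x $ 2) + x $ 1 * (deriv \<rho> (x $ 2) * d $ 2) * sin (x $ 2)
                        + x $ 1 * \<rho> (x $ 2) * (cos (x $ 2) * d $ 2)]" for x d
  define a b :: "real ^ 2" where "a = vector [0, 0]" and "b = vector [1, 2 * pi]"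
  have S: "x \<in> box a b \<longleftrightarrow> 0 < x $ 1 \<and> x $ 1 < 1 \<and> 0 < x $ 2 \<and> x $ 2 < 2 * pi" for x
    by (auto simp: mem_box_cart a_def b_def forall_2)
  have S': "cbox a b = pair_of_vec -` cbox (0, 0) (1, 2 * pi)"
    by (auto simp: mem_box_cart a_def b_def forall_2 pair_of_vec_def mem_box Basis_prod_def)
  have der: "(g has_derivative g' x) (at x within box a b)" for x
  proof -
    have nth: "((\<lambda>x::real^2. x $ i) has_derivative (\<lambda>d. d $ i)) (at x within box a b)" for i
      by (rule bounded_linear.has_derivative[OF bounded_linear_vec_nth has_derivative_ident])
    have \<rho>2: "((\<lambda>x::real^2. \<rho> (x $ 2)) has_derivative (\<lambda>d. deriv \<rho> (x $ 2) * d $ 2)) (at x within box a b)"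
      using has_derivative_compose[OF nth, of \<rho> "(*) (deriv \<rho> (x $ 2))" 2] R(3)[of "x $ 2"]
      by (simp add: has_field_derivative_def)
    have "((\<lambda>x. g x $ i) has_derivative (\<lambda>d. g' x d $ i)) (at x within box a b)" for i
      using exhaust_2[of i] unfolding g_def g'_def
      by (auto intro!: derivative_eq_intros nth \<rho>2 simp: algebra_simps)
    then show ?thesis
      by (simp add: has_derivative_componentwise_within[of g] Basis_vec_def inner_axis)
  qed
  have det: "det (matrix (g' x)) = x $ 1 * (\<rho> (x $ 2))\<^sup>2" for x
  proof -
    have "det (matrix (g' x)) = x $ 1 * (\<rho> (x $ 2))\<^sup>2 * ((cos (x $ 2))\<^sup>2 + (sin (x $ 2))\<^sup>2)"
      unfolding det_2 matrix_def g'_def by (simp add: axis_def algebra_simps power2_eq_square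
        del: sin_cos_squared_add sin_cos_squared_add2 sin_cos_squared_add3)
    then show ?thesis by simp
  qed
  have inj: "inj_on g (box a b)"
  proof (rule inj_onI)
    fix x y assume x: "x \<in> box a b" and y: "y \<in> box a b" and "g x = g y"
    then have eq: "x $ 1 * \<rho> (x $ 2) * cos (x $ 2) = y $ 1 * \<rho> (y $ 2) * cos (y $ 2)"
       "x $ 1 * \<rho> (x $ 2) * sin (x $ 2) = y $ 1 * \<rho> (y $ 2) * sin (y $ 2)"
      unfolding g_def by (auto simp: vec_eq_iff forall_2)
    have pos: "x $ 1 * \<rho> (x $ 2) > 0" "y $ 1 * \<rho> (y $ 2) \<ge> 0"
      using x y R(1) by (auto simp: S less_imp_le)
    from ray_eq_imp_periodic[OF \<rho> eq pos] obtain n :: int where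
      n: "x $ 1 * \<rho> (x $ 2) = y $ 1 * \<rho> (y $ 2)" "x $ 2 = y $ 2 + 2 * pi * of_int n" "\<rho> (x $ 2) = \<rho> (y $ 2)" by auto
    have "\<bar>2 * pi * of_int n\<bar> < 2 * pi" using x y n(2) by (auto simp: S)
    then have "\<bar>of_int n\<bar> < (1::real)" by (simp add: abs_mult)
    then have "n = 0" by linarith
    then have "x $ 2 = y $ 2" using n by simp
    moreover have "x $ 1 = y $ 1" using n R(1)[of "y $ 2"] by simp
    ultimately show "x = y" by (simp add: vec_eq_iff forall_2)
  qed
  \<comment> \<open>The change-of-variables theorem is applied to integrands with values in
    \<open>real ^ 2\<close>: complex values are packed by \<open>c2v\<close> and unpacked by the
    linear map \<open>v2c\<close>.\<close>
  define c2v :: "complex \<Rightarrow> real ^ 2" where "c2v z = (\<chi> i. if i = 1 then Re z else Im z)" for z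
  define v2c :: "real ^ 2 \<Rightarrow> complex" where "v2c y = of_real (y $ 1) + \<i> * of_real (y $ 2)" for y
  have v2c: "v2c (c2v z) = z" for z by (simp add: v2c_def c2v_def flip: complex_eq)
  have blv: "bounded_linear v2c"
    unfolding v2c_def by (intro bounded_linear_add bounded_linear_const_mult bounded_linear_of_real bounded_linear_compose[OF bounded_linear_of_real]
       bounded_linear_vec_nth)
  define K where "K x = of_real (fst x * (\<rho> (snd x))\<^sup>2) * h (fst x *\<^sub>R bdry \<rho> (snd x))" for x :: "real \<times> real"
  have bc: "continuous_on U (bdry \<rho>)" for U
    unfolding bdry_def by (intro continuous_intros R)
  have Kc: "continuous_on U K" for U
    unfolding K_def
    by (intro continuous_intros continuous_on_compose2[OF h] continuous_on_compose2[OF R(4)] continuous_on_compose2[OF bc]) auto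
  have Kg: "\<bar>det (matrix (g' x))\<bar> *\<^sub>R c2v (h (pair_of_vec (g x))) = c2v (K (pair_of_vec x))" if "x \<in> box a b" for x
  proof -
    have "pair_of_vec (g x) = x $ 1 *\<^sub>R bdry \<rho> (x $ 2)"
      by (simp add: pair_of_vec_def g_def bdry_def)
    then show ?thesis using that
      by (auto simp: det S K_def c2v_def vec_eq_iff forall_2 pair_of_vec_def)
  qed
  have c2vc: "continuous_on U (\<lambda>x. c2v (f x))" if "continuous_on U f" for U and f :: "real^2 \<Rightarrow> complex"
    unfolding c2v_def
  proof (rule continuous_on_vec_lambda)
    show "continuous_on U (\<lambda>x. if i = 1 then Re (f x) else Im (f x))" for i :: 2
      using that by (cases "i = 1") (auto intro!: continuous_intros)
  qed
  have ai: "(\<lambda>x. c2v (K (pair_of_vec x))) absolutely_integrable_on box a b"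
  proof (rule set_integrable_subset)
    show "(\<lambda>x. c2v (K (pair_of_vec x))) absolutely_integrable_on cbox a b"
      by (intro absolutely_integrable_continuous c2vc continuous_on_compose2[OF Kc[of UNIV]] continuous_intros) auto
  qed (auto simp: box_subset_cbox)
  define J where "J = integral (box a b) (\<lambda>x. c2v (K (pair_of_vec x)))"
  have "(\<lambda>x. \<bar>det (matrix (g' x))\<bar> *\<^sub>R c2v (h (pair_of_vec (g x)))) absolutely_integrable_on box a b \<and>
     integral (box a b) (\<lambda>x. \<bar>det (matrix (g' x))\<bar> *\<^sub>R c2v (h (pair_of_vec (g x)))) = J"
    unfolding J_def
  proof
    show "(\<lambda>x. \<bar>det (matrix (g' x))\<bar> *\<^sub>R c2v (h (pair_of_vec (g x)))) absolutely_integrable_on box a b"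
      using ai Kg by (subst set_integrable_cong[OF refl refl Kg])
    show "integral (box a b) (\<lambda>x. \<bar>det (matrix (g' x))\<bar> *\<^sub>R c2v (h (pair_of_vec (g x)))) =
      integral (box a b) (\<lambda>x. c2v (K (pair_of_vec x)))"
      by (rule Henstock_Kurzweil_Integration.integral_cong) (rule Kg)
  qed
  then have gi: "(\<lambda>y. c2v (h (pair_of_vec y))) absolutely_integrable_on g ` box a b"
       and gJ: "integral (g ` box a b) (\<lambda>y. c2v (h (pair_of_vec y))) = J"
    using has_absolute_integral_change_of_variables[of "box a b" g g' "\<lambda>y. c2v (h (pair_of_vec y))" J] der inj
    by auto
  \<comment> \<open>The open rectangle makes the map injective, but its image misses the ray of
    angle 0, origin included; that ray lies in this null line.\<close>
  define slit :: "(real \<times> real) set" where "slit = {x. snd x = 0}"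
  have slit: "slit \<in> null_sets lborel"
  proof -
    have "negligible {x::real \<times> real. (0, 1) \<bullet> x = 0}"
      by (rule negligible_hyperplane) (auto simp: zero_prod_def)
    moreover have "{x::real \<times> real. (0, 1) \<bullet> x = 0} = slit" by (auto simp: slit_def inner_prod_def)
    moreover have "closed slit" unfolding slit_def by (intro closed_Collect_eq continuous_intros)
    ultimately show ?thesis
      by (simp add: negligible_iff_null_sets null_sets_completion_iff)
  qed
  define D where "D = g ` box a b"
  have image: "x \<in> D \<longleftrightarrow> pair_of_vec x \<in> star_domain \<rho> - {(r, 0) |r. r \<ge> 0}" for x
  proof
    assume "x \<in> D"
    then obtain y where y: "y \<in> box a b" "x = g y" by (auto simp: D_def)
    define r t where "r = y $ 1 * \<rho> (y $ 2)" and "t = y $ 2"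
    have rt: "0 < r" "r < \<rho> t" "0 < t" "t < 2 * pi" using y R(1)[of t] by (auto simp: S r_def t_def)
    have x: "pair_of_vec x = (r * cos t, r * sin t)" by (simp add: y g_def pair_of_vec_def r_def t_def)
    have "pair_of_vec x \<notin> {(r, 0) |r. r \<ge> 0}"
    proof
      assume "pair_of_vec x \<in> {(r, 0) |r. r \<ge> 0}"
      then have "r * sin t = 0" "r * cos t \<ge> 0" using x by auto
      then have "sin t = 0" "cos t \<ge> 0" using rt by (auto simp: zero_le_mult_iff)
      then have "cos t = 1" using sin_cos_squared_add[of t] by (simp add: power2_eq_1_iff)
      then obtain n :: int where "t = of_int n * 2 * pi" using cos_one_2pi_int by auto
      then have "0 < of_int n * (2 * pi)" "of_int n * (2 * pi) < 1 * (2 * pi)" using rt by auto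
      then have "0 < real_of_int n" "real_of_int n < 1" using pi_gt_zero
        by (simp_all only: zero_less_mult_iff mult_less_cancel_right) auto
      then have "0 < n" "n < 1" by simp_all
      then show False by linarith
    qed
    moreover have "pair_of_vec x \<in> star_domain \<rho>"
      unfolding star_domain_def x using rt less_imp_le by blast
    ultimately show "pair_of_vec x \<in> star_domain \<rho> - {(r, 0) |r. r \<ge> 0}" by blast
  next
    assume x: "pair_of_vec x \<in> star_domain \<rho> - {(r, 0) |r. r \<ge> 0}"
    obtain r t where rt: "pair_of_vec x = (r * cos t, r * sin t)" "0 \<le> r" "0 \<le> t" "t < 2 * pi"
      by (rule polar_coordinates)
    have "r > 0" "t > 0" using x rt by (auto simp: less_le)
    obtain r' t' where rt': "pair_of_vec x = (r' * cos t', r' * sin t')" "0 \<le> r'" "r' < \<rho> t'"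
      using x by (auto simp: star_domain_def)
    have "r < \<rho> t"
      using ray_eq_imp_periodic[OF \<rho>, of r t r' t'] rt rt' \<open>r > 0\<close> by auto
    define y :: "real ^ 2" where "y = vector [r / \<rho> t, t]"
    have "y \<in> box a b"
      using rt \<open>r > 0\<close> \<open>t > 0\<close> \<open>r < \<rho> t\<close> R(1)[of t] by (auto simp: S y_def)
    moreover have "g y = x"
      using rt R(1)[of t] by (auto simp: g_def y_def vec_eq_iff forall_2 pair_of_vec_def)
    ultimately show "x \<in> D" unfolding D_def by blast
  qed
  have hm: "h \<in> borel_measurable borel"
    using h by (rule borel_measurable_continuous_onI)
  have im: "(\<lambda>x. indicator A x *\<^sub>R h x) \<in> borel_measurable lborel" if "A \<in> sets borel" for A
    using hm that by (intro borel_measurable_scaleR borel_measurable_indicator) auto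
  have Dsub: "{(r, 0::real) |r. r \<ge> (0::real)} \<subseteq> slit" by (auto simp: slit_def)
  have ray: "{(r, 0::real) |r. r \<ge> (0::real)} \<in> sets borel"
  proof -
    have "closed ({0::real..} \<times> {0::real})" by (intro closed_Times) auto
    moreover have "{(r, 0::real) |r. r \<ge> (0::real)} = {0..} \<times> {0}" by auto
    ultimately show ?thesis by (metis borel_closed)
  qed
  note SD = star_domain_measurable[OF \<rho>]
  let ?E = "star_domain \<rho> - {(r, 0) |r. r \<ge> 0}"
  have E: "?E \<in> sets borel" using ray SD(1) by (rule sets.Diff[rotated])
  have DE: "D = pair_of_vec -` ?E" using image by blast
  have Db: "D \<in> sets borel" unfolding DE using measurable_sets[OF measurable_pair_of_vec E] by simp
  have ci: "(\<lambda>x. h (pair_of_vec x)) absolutely_integrable_on D"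
    using absolutely_integrable_linear[OF gi blv] by (simp add: o_def v2c D_def)
  have "integral D (\<lambda>x. h (pair_of_vec x)) = v2c J"
    using integral_linear[OF _ blv, of "\<lambda>y. c2v (h (pair_of_vec y))" D] gi gJ
    by (simp add: o_def v2c D_def absolutely_integrable_on_def)
  also have "v2c J = integral (box a b) (\<lambda>x. K (pair_of_vec x))"
    unfolding J_def using integral_linear[OF _ blv, of "\<lambda>x. c2v (K (pair_of_vec x))" "box a b"] ai
    by (simp add: o_def v2c absolutely_integrable_on_def)
  also have "\<dots> = integral (cbox a b) (\<lambda>x. K (pair_of_vec x))"
    by (rule integral_open_interval)
  also have "\<dots> = (LINT x:cbox a b|lborel. K (pair_of_vec x))"
    by (intro set_borel_integral_eq_integral(2)[symmetric] set_integrable_bounded_continuous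
        continuous_on_compose2[OF Kc[of UNIV]] continuous_intros) auto
  also have "\<dots> = (LINT x:cbox (0, 0) (1, 2 * pi)|lborel. K x)"
    unfolding S' by (intro set_integral_pair_of_vec Kc) simp
  also have "\<dots> = integral (cbox (0, 0) (1, 2 * pi)) K"
    by (intro set_borel_integral_eq_integral(2) set_integrable_bounded_continuous Kc) auto
  also have "\<dots> = integral (cbox 0 1) (\<lambda>s. integral (cbox 0 (2 * pi)) (\<lambda>t. K (s, t)))"
    by (rule integral_prod_continuous) (rule Kc)
  also have "\<dots> = integral (cbox 0 (2 * pi)) (\<lambda>t. integral (cbox 0 1) (\<lambda>s. K (s, t)))"
    by (rule integral_swap_continuous) (simp add: Kc case_prod_eta)
  finally have 1: "integral D (\<lambda>x. h (pair_of_vec x)) = integral {0..2*pi} (\<lambda>t. integral {0..1} (\<lambda>s. K (s, t)))"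
    by simp
  have "integral D (\<lambda>x. h (pair_of_vec x)) = (LINT x:D|lebesgue. h (pair_of_vec x))"
    by (rule set_lebesgue_integral_eq_integral(2)[symmetric, OF ci])
  also have "\<dots> = (LINT x:D|lborel. h (pair_of_vec x))"
    unfolding set_lebesgue_integral_def using Db
    by (intro integral_completion borel_measurable_scaleR borel_measurable_indicator
        measurable_compose[OF _ hm]) auto
  also have "\<dots> = (LINT x:?E|lborel. h x)"
    unfolding DE by (rule set_integral_pair_of_vec[OF h E])
  also have "\<dots> = (LINT x:star_domain \<rho>|lborel. h x)"
    unfolding set_lebesgue_integral_def
  proof (rule integral_cong_AE)
    show "AE x in lborel. indicator ?E x *\<^sub>R h x = indicator (star_domain \<rho>) x *\<^sub>R h x"
      using AE_not_in[OF slit] by eventually_elim (use Dsub in \<open>auto simp: indicator_def\<close>)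
  qed (rule im[OF E] im[OF SD(1)])+
  finally show ?thesis using 1 by (simp add: K_def)
qed

section \<open>Green's formula\<close>

text \<open>The differentiability clauses of \<open>Cc1\<close> without its conditions on the
  support, so that it also applies to waves on the whole plane.\<close>

definition has_grad :: "(real \<times> real \<Rightarrow> complex) \<Rightarrow> (real \<times> real \<Rightarrow> complex) \<Rightarrow> (real \<times> real \<Rightarrow> complex) \<Rightarrow> bool" where
  "has_grad f f1 f2 \<longleftrightarrow>
     (\<forall>x. (f has_derivative (\<lambda>h. of_real (fst h) * f1 x + of_real (snd h) * f2 x)) (at x)) \<and>
     continuous_on UNIV f1 \<and> continuous_on UNIV f2"

lemma has_gradD:
  assumes "has_grad f f1 f2"
  shows "(f has_derivative (\<lambda>h. of_real (fst h) * f1 x + of_real (snd h) * f2 x)) (at x)"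
    "continuous_on S f" "continuous_on S f1" "continuous_on S f2"
proof -
  show *: "(f has_derivative (\<lambda>h. of_real (fst h) * f1 x + of_real (snd h) * f2 x)) (at x)" for x
    using assms unfolding has_grad_def by blast
  show "continuous_on S f"
    using * has_derivative_continuous continuous_at_imp_continuous_on by blast
  show "continuous_on S f1" "continuous_on S f2"
    using assms continuous_on_subset[of UNIV] by (auto simp: has_grad_def)
qed

lemma has_grad_compose_curve:
  assumes "has_grad f f1 f2" "(c has_vector_derivative d) (at x within S)"
  shows "((\<lambda>x. f (c x)) has_vector_derivative of_real (fst d) * f1 (c x) + of_real (snd d) * f2 (c x)) (at x within S)"
proof -
  have "((\<lambda>x. f (c x)) has_derivative (\<lambda>r. of_real (fst (r *\<^sub>R d)) * f1 (c x) + of_real (snd (r *\<^sub>R d)) * f2 (c x))) (at x within S)"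
    using has_derivative_compose[OF assms(2)[unfolded has_vector_derivative_def] has_gradD(1)[OF assms(1)]] .
  then show ?thesis
    unfolding has_vector_derivative_def by (simp add: scaleR_conv_of_real algebra_simps)
qed

lemma has_grad_mult:
  assumes "has_grad f f1 f2" "has_grad g g1 g2"
  shows "has_grad (\<lambda>x. f x * g x) (\<lambda>x. f1 x * g x + f x * g1 x) (\<lambda>x. f2 x * g x + f x * g2 x)"
  unfolding has_grad_def
proof (intro conjI allI)
  fix x
  show "((\<lambda>x. f x * g x) has_derivative (\<lambda>h. of_real (fst h) * (f1 x * g x + f x * g1 x) + of_real (snd h) * (f2 x * g x + f x * g2 x))) (at x)"
    by (rule has_derivative_eq_rhs[OF has_derivative_mult[OF has_gradD(1)[OF assms(1)] has_gradD(1)[OF assms(2)]]])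
       (auto simp: algebra_simps)
qed (intro continuous_intros has_gradD[OF assms(1)] has_gradD[OF assms(2)])+

lemma bdry_has_vector_derivative:
  assumes "radius_function \<rho>"
  shows "(bdry \<rho> has_vector_derivative (- snd (bdry_normal \<rho> t), fst (bdry_normal \<rho> t))) (at t within S)"
proof -
  have \<rho>: "(\<rho> has_real_derivative deriv \<rho> t) (at t within S)"
    using radius_functionD(3)[OF assms] has_field_derivative_at_within by blast
  have "((\<lambda>t. \<rho> t * cos t) has_vector_derivative - snd (bdry_normal \<rho> t)) (at t within S)"
    "((\<lambda>t. \<rho> t * sin t) has_vector_derivative fst (bdry_normal \<rho> t)) (at t within S)"
    unfolding has_real_derivative_iff_has_vector_derivative[symmetric] bdry_normal_def
    by (auto intro!: derivative_eq_intros \<rho>)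
  then show ?thesis
    unfolding bdry_def by (rule has_vector_derivative_Pair)
qed

lemma continuous_on_bdry:
  assumes "radius_function \<rho>"
  shows "continuous_on S (bdry \<rho>)" "continuous_on S (bdry_normal \<rho>)"
  unfolding bdry_def bdry_normal_def by (intro continuous_intros radius_functionD[OF assms])+

text \<open>In the coordinates \<open>x = s *\<^sub>R \<gamma> t\<close> the Jacobian times the divergence of a field \<open>F\<close> equals
  \<open>\<partial>\<^sub>s (s F \<bullet> n) - \<partial>\<^sub>t (F\<^sub>1 \<gamma>\<^sub>2 - F\<^sub>2 \<gamma>\<^sub>1)\<close>, and the second term integrates to zero by periodicity.\<close>

lemma divergence_theorem_star_domain:
  assumes \<rho>: "radius_function \<rho>" and F1: "has_grad F1 A11 A12" and F2: "has_grad F2 A21 A22"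
  shows "(LINT x:star_domain \<rho>|lborel. A11 x + A22 x) =
    integral {0..2*pi} (\<lambda>t. F1 (bdry \<rho> t) * of_real (fst (bdry_normal \<rho> t)) + F2 (bdry \<rho> t) * of_real (snd (bdry_normal \<rho> t)))"
proof -
  note R = radius_functionD[OF \<rho>]
  note G1 = has_gradD[OF F1]
  note G2 = has_gradD[OF F2]
  note bc = continuous_on_bdry[OF \<rho>]
  define p where "p s t = s *\<^sub>R bdry \<rho> t" for s t
  define n1 where "n1 t = complex_of_real (fst (bdry_normal \<rho> t))" for t
  define n2 where "n2 t = complex_of_real (snd (bdry_normal \<rho> t))" for t
  define c1 where "c1 t = complex_of_real (fst (bdry \<rho> t))" for t
  define c2 where "c2 t = complex_of_real (snd (bdry \<rho> t))" for t
  define P where "P s t = of_real s * (F1 (p s t) * n1 t + F2 (p s t) * n2 t)" for s t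
  define Ps where "Ps s t = (F1 (p s t) * n1 t + F2 (p s t) * n2 t)
     + of_real s * ((c1 t * A11 (p s t) + c2 t * A12 (p s t)) * n1 t + (c1 t * A21 (p s t) + c2 t * A22 (p s t)) * n2 t)" for s t
  define Q where "Q s t = F1 (p s t) * c2 t - F2 (p s t) * c1 t" for s t
  define Qt where "Qt s t = of_real s * ((- n2 t * A11 (p s t) + n1 t * A12 (p s t)) * c2 t - (- n2 t * A21 (p s t) + n1 t * A22 (p s t)) * c1 t)
     + F1 (p s t) * n1 t + F2 (p s t) * n2 t" for s t
  have jac: "c1 t * n1 t + c2 t * n2 t = of_real ((\<rho> t)\<^sup>2)" for t
  proof -
    have "fst (bdry \<rho> t) * fst (bdry_normal \<rho> t) + snd (bdry \<rho> t) * snd (bdry_normal \<rho> t)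
      = (\<rho> t)\<^sup>2 * ((cos t)\<^sup>2 + (sin t)\<^sup>2)"
      unfolding bdry_def bdry_normal_def
      by (simp add: algebra_simps power2_eq_square del: sin_cos_squared_add sin_cos_squared_add2 sin_cos_squared_add3)
    then show ?thesis unfolding c1_def c2_def n1_def n2_def
      by (simp flip: of_real_mult of_real_add)
  qed
  \<comment> \<open>In the difference the terms with \<open>A12\<close> and \<open>A21\<close>
    cancel, as do the undifferentiated ones; what remains contains the factor given by
    \<open>jac\<close>.\<close>
  have eq: "of_real (s * (\<rho> t)\<^sup>2) * (A11 (s *\<^sub>R bdry \<rho> t) + A22 (s *\<^sub>R bdry \<rho> t)) = Ps s t - Qt s t" for s t
    unfolding of_real_mult[of s] jac[symmetric] Ps_def Qt_def p_def[symmetric] by (simp add: algebra_simps)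
  have Ps: "((\<lambda>s. P s t) has_vector_derivative Ps s t) (at s within S)" for s t S
  proof -
    have "((\<lambda>s. p s t) has_vector_derivative bdry \<rho> t) (at s within S)"
      unfolding p_def by (auto intro!: derivative_eq_intros)
    then have 1: "((\<lambda>s. F1 (p s t)) has_vector_derivative c1 t * A11 (p s t) + c2 t * A12 (p s t)) (at s within S)"
      "((\<lambda>s. F2 (p s t)) has_vector_derivative c1 t * A21 (p s t) + c2 t * A22 (p s t)) (at s within S)"
      unfolding c1_def c2_def by (auto intro: has_grad_compose_curve F1 F2)
    have 2: "((\<lambda>s. complex_of_real s) has_vector_derivative 1) (at s within S)"
      using has_vector_derivative_of_real[OF DERIV_ident] by simp
    show ?thesis
      unfolding P_def Ps_def
      by (rule has_vector_derivative_eq_rhs[OF has_vector_derivative_mult[OF 2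
            has_vector_derivative_add[OF has_vector_derivative_mult_left[OF 1(1)] has_vector_derivative_mult_left[OF 1(2)]]]])
         (simp add: algebra_simps)
  qed
  have Qt: "((\<lambda>t. Q s t) has_vector_derivative Qt s t) (at t within S)" for s t S
  proof -
    note b = bdry_has_vector_derivative[OF \<rho>, of t S]
    have pd: "((\<lambda>t. p s t) has_vector_derivative s *\<^sub>R (- snd (bdry_normal \<rho> t), fst (bdry_normal \<rho> t))) (at t within S)"
      unfolding p_def by (rule bounded_linear.has_vector_derivative[OF bounded_linear_scaleR_right b])
    have 1: "((\<lambda>t. F1 (p s t)) has_vector_derivative of_real s * (- n2 t * A11 (p s t) + n1 t * A12 (p s t))) (at t within S)"
      "((\<lambda>t. F2 (p s t)) has_vector_derivative of_real s * (- n2 t * A21 (p s t) + n1 t * A22 (p s t))) (at t within S)"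
      by (rule has_vector_derivative_eq_rhs[OF has_grad_compose_curve[OF F1 pd]], simp add: n1_def n2_def algebra_simps)
         (rule has_vector_derivative_eq_rhs[OF has_grad_compose_curve[OF F2 pd]], simp add: n1_def n2_def algebra_simps)
    have 2: "(c1 has_vector_derivative - n2 t) (at t within S)"
       "(c2 has_vector_derivative n1 t) (at t within S)"
      unfolding c1_def c2_def n1_def n2_def of_real_minus[symmetric]
      using bounded_linear.has_vector_derivative[OF bounded_linear_compose[OF bounded_linear_of_real bounded_linear_fst] b]
        bounded_linear.has_vector_derivative[OF bounded_linear_compose[OF bounded_linear_of_real bounded_linear_snd] b]
      by simp_all
    show ?thesis
      unfolding Q_def Qt_def
      by (rule has_vector_derivative_eq_rhs[OF has_vector_derivative_diff[OF
            has_vector_derivative_mult[OF 1(1) 2(2)] has_vector_derivative_mult[OF 1(2) 2(1)]]])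
         (simp add: algebra_simps)
  qed
  have pc: "continuous_on U (\<lambda>x. p (f x) (g x))" if "continuous_on U f" "continuous_on U g" for f g and U :: "(real \<times> real) set"
    unfolding p_def using that by (intro continuous_intros continuous_on_compose2[OF bc(1)]) auto
  have cc: "continuous_on U (\<lambda>x. c1 (g x))" "continuous_on U (\<lambda>x. c2 (g x))" "continuous_on U (\<lambda>x. n1 (g x))" "continuous_on U (\<lambda>x. n2 (g x))"
    if "continuous_on U g" for g and U :: "(real \<times> real) set"
    unfolding c1_def c2_def n1_def n2_def
    using that by (intro continuous_intros continuous_on_compose2[OF bc(1)] continuous_on_compose2[OF bc(2)]; auto)+
  have cF: "continuous_on U (\<lambda>x. F (p (fst x) (snd x)))" if "continuous_on UNIV F" for F :: "real \<times> real \<Rightarrow> complex" and U :: "(real \<times> real) set"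
    by (rule continuous_on_compose2[OF that]) (auto intro!: pc continuous_intros)
  have cF': "continuous_on U (\<lambda>x. F (p (snd x) (fst x)))" if "continuous_on UNIV F" for F :: "real \<times> real \<Rightarrow> complex" and U :: "(real \<times> real) set"
    by (rule continuous_on_compose2[OF that]) (auto intro!: pc continuous_intros)
  have Psc: "continuous_on U (\<lambda>x. Ps (snd x) (fst x))" and Qtc: "continuous_on U (\<lambda>x. Qt (snd x) (fst x))" for U
    unfolding Ps_def Qt_def by (intro continuous_intros cF' cc G1 G2)+
  have Ps1: "continuous_on U (\<lambda>s. Ps s t)" and Qt1: "continuous_on U (\<lambda>s. Qt s t)" for t U
  proof -
    have "continuous_on U (\<lambda>s. (t, s))" by (intro continuous_intros)
    from continuous_on_compose2[OF Psc[of UNIV] this] continuous_on_compose2[OF Qtc[of UNIV] this]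
    show "continuous_on U (\<lambda>s. Ps s t)" "continuous_on U (\<lambda>s. Qt s t)" by simp_all
  qed
  have Ps2: "continuous_on U (\<lambda>t. integral {0..1} (\<lambda>s. Ps s t))" and Qt2: "continuous_on U (\<lambda>t. integral {0..1} (\<lambda>s. Qt s t))" for U
    unfolding interval_cbox
    by (intro integral_continuous_on_param; simp add: split_beta Psc Qtc)+
  have "(LINT x:star_domain \<rho>|lborel. A11 x + A22 x) = integral {0..2*pi} (\<lambda>t. integral {0..1} (\<lambda>s. Ps s t - Qt s t))"
    unfolding integral_star_domain[OF \<rho> continuous_on_add[OF G1(3) G2(4)]] eq ..
  also have "\<dots> = integral {0..2*pi} (\<lambda>t. integral {0..1} (\<lambda>s. Ps s t) - integral {0..1} (\<lambda>s. Qt s t))"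
    by (intro Henstock_Kurzweil_Integration.integral_cong integral_diff integrable_continuous_real Ps1 Qt1)
  also have "\<dots> = integral {0..2*pi} (\<lambda>t. integral {0..1} (\<lambda>s. Ps s t)) - integral {0..2*pi} (\<lambda>t. integral {0..1} (\<lambda>s. Qt s t))"
    by (intro integral_diff integrable_continuous_real Ps2 Qt2)
  also have "integral {0..2*pi} (\<lambda>t. integral {0..1} (\<lambda>s. Qt s t)) = integral {0..1} (\<lambda>s. integral {0..2*pi} (\<lambda>t. Qt s t))"
    unfolding interval_cbox by (rule integral_swap_continuous) (simp add: split_beta Qtc)
  also have "\<dots> = integral {0..1::real} (\<lambda>s. 0)"
  proof (rule Henstock_Kurzweil_Integration.integral_cong)
    fix s
    have "((\<lambda>t. Qt s t) has_integral Q s (2 * pi) - Q s 0) {0..2*pi}"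
      by (intro fundamental_theorem_of_calculus Qt) simp
    moreover have "bdry \<rho> (2 * pi) = bdry \<rho> 0" using R(2)[of 0] by (simp add: bdry_def)
    ultimately show "integral {0..2*pi} (\<lambda>t. Qt s t) = 0"
      by (simp add: integral_unique Q_def p_def c1_def c2_def)
  qed
  also have "integral {0..2*pi} (\<lambda>t. integral {0..1} (\<lambda>s. Ps s t)) = integral {0..2*pi} (\<lambda>t. P 1 t - P 0 t)"
    by (intro Henstock_Kurzweil_Integration.integral_cong integral_unique fundamental_theorem_of_calculus Ps) simp
  finally show ?thesis by (simp add: P_def p_def n1_def n2_def)
qed

text \<open>The divergence theorem for the field f * (w1, w2): by \<open>lap\<close> the term f *
  div (w1, w2) becomes - c * f * w.\<close>

lemma green_star_domain:
  assumes \<rho>: "radius_function \<rho>" and f: "has_grad f f1 f2"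
    and w1: "has_grad w1 w11 w12" and w2: "has_grad w2 w21 w22"
    and lap: "\<And>x. w11 x + w22 x = - c * w x"
  shows "(LINT x:star_domain \<rho>|lborel. f1 x * w1 x + f2 x * w2 x - c * f x * w x) =
    integral {0..2*pi} (\<lambda>t. f (bdry \<rho> t) * (of_real (fst (bdry_normal \<rho> t)) * w1 (bdry \<rho> t) + of_real (snd (bdry_normal \<rho> t)) * w2 (bdry \<rho> t)))"
proof -
  have "f1 x * w1 x + f2 x * w2 x - c * f x * w x = (f1 x * w1 x + f x * w11 x) + (f2 x * w2 x + f x * w22 x)" for x
  proof -
    have "f x * w11 x + f x * w22 x = - (c * f x * w x)"
      using arg_cong[OF lap[of x], of "(*) (f x)"] by (simp add: distrib_left mult_ac)
    then have "f1 x * w1 x + f2 x * w2 x - c * f x * w x = f1 x * w1 x + f2 x * w2 x + (f x * w11 x + f x * w22 x)"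
      by simp
    then show ?thesis by (simp only: add_ac)
  qed
  then have "(LINT x:star_domain \<rho>|lborel. f1 x * w1 x + f2 x * w2 x - c * f x * w x) =
     (LINT x:star_domain \<rho>|lborel. (f1 x * w1 x + f x * w11 x) + (f2 x * w2 x + f x * w22 x))"
    by (simp only:)
  also have "\<dots> = integral {0..2*pi} (\<lambda>t. f (bdry \<rho> t) * w1 (bdry \<rho> t) * of_real (fst (bdry_normal \<rho> t)) + f (bdry \<rho> t) * w2 (bdry \<rho> t) * of_real (snd (bdry_normal \<rho> t)))"
    by (rule divergence_theorem_star_domain[OF \<rho> has_grad_mult[OF f w1] has_grad_mult[OF f w2]])
  also have "\<dots> = integral {0..2*pi} (\<lambda>t. f (bdry \<rho> t) * (of_real (fst (bdry_normal \<rho> t)) * w1 (bdry \<rho> t) + of_real (snd (bdry_normal \<rho> t)) * w2 (bdry \<rho> t)))"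
    by (simp only: distrib_left mult_ac)
  finally show ?thesis .
qed

section \<open>Herglotz waves\<close>

lemma herglotz_cis:
  "herglotz k \<phi> x = integral {-pi..pi} (\<lambda>\<theta>. \<phi> \<theta> * cis (k * (cos \<theta> * fst x + sin \<theta> * snd x)))"
  by (simp add: herglotz_def cis_conv_exp)

lemma continuous_on_herglotz:
  assumes "continuous_on UNIV \<phi>"
  shows "continuous_on S (herglotz k \<phi>)"
proof -
  have "continuous_on S (\<lambda>x. integral (cbox (-pi) pi) (\<lambda>\<theta>. \<phi> \<theta> * cis (k * (cos \<theta> * fst x + sin \<theta> * snd x))))"
    by (intro integral_continuous_on_param)
       (auto simp: split_beta intro!: continuous_intros continuous_on_compose2[OF assms])
  then show ?thesis by (simp add: herglotz_cis[abs_def])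
qed

text \<open>Differentiating a plane wave of direction \<theta> in x1 multiplies it by i k cos
  \<theta>, so partial derivatives of Herglotz waves are Herglotz waves with these densities, and
  all orders of derivatives are covered by one gradient lemma.\<close>

abbreviation density_x :: "real \<Rightarrow> (real \<Rightarrow> complex) \<Rightarrow> real \<Rightarrow> complex" where
  "density_x k \<phi> \<equiv> \<lambda>\<theta>. \<i> * of_real (k * cos \<theta>) * \<phi> \<theta>"

abbreviation density_y :: "real \<Rightarrow> (real \<Rightarrow> complex) \<Rightarrow> real \<Rightarrow> complex" where
  "density_y k \<phi> \<equiv> \<lambda>\<theta>. \<i> * of_real (k * sin \<theta>) * \<phi> \<theta>"

lemma has_grad_herglotz:
  assumes \<phi>: "continuous_on UNIV \<phi>"
  shows "has_grad (herglotz k \<phi>) (herglotz k (density_x k \<phi>)) (herglotz k (density_y k \<phi>))"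
  unfolding has_grad_def
proof (intro conjI allI)
  fix x :: "real \<times> real"
  define e where "e y \<theta> = \<phi> \<theta> * cis (k * (cos \<theta> * fst y + sin \<theta> * snd y))" for y :: "real \<times> real" and \<theta>
  define L1 where "L1 = Blinfun (\<lambda>h::real \<times> real. complex_of_real (fst h))"
  define L2 where "L2 = Blinfun (\<lambda>h::real \<times> real. complex_of_real (snd h))"
  have L1: "blinfun_apply L1 = (\<lambda>h. of_real (fst h))"
    unfolding L1_def by (rule bounded_linear_Blinfun_apply) (rule bounded_linear_compose[OF bounded_linear_of_real bounded_linear_fst])
  have L2: "blinfun_apply L2 = (\<lambda>h. of_real (snd h))"
    unfolding L2_def by (rule bounded_linear_Blinfun_apply) (rule bounded_linear_compose[OF bounded_linear_of_real bounded_linear_snd])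
  \<comment> \<open>Differentiation under the integral is used with the derivative as a bounded
    linear operator depending continuously on (y, \<theta>), so the gradient is assembled as a
    \<open>blinfun\<close> before being integrated.\<close>
  define D where "D y \<theta> = (blinfun_mult_right (\<i> * of_real (k * cos \<theta>) * e y \<theta>) o\<^sub>L L1)
     + (blinfun_mult_right (\<i> * of_real (k * sin \<theta>) * e y \<theta>) o\<^sub>L L2)" for y \<theta>
  have D: "blinfun_apply (D y \<theta>) h = \<i> * of_real (k * cos \<theta>) * e y \<theta> * of_real (fst h)
     + \<i> * of_real (k * sin \<theta>) * e y \<theta> * of_real (snd h)" for y \<theta> h
    by (simp add: D_def plus_blinfun.rep_eq L1 L2)
  have ec: "continuous_on U (\<lambda>z. e (f z) (g z))" if "continuous_on U f" "continuous_on U g" for f g and U :: "'z::metric_space set"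
    unfolding e_def using that by (intro continuous_intros continuous_on_compose2[OF \<phi>]) auto
  have Dc: "continuous_on U (\<lambda>z. D (fst z) (snd z))" for U
    unfolding D_def
    by (intro continuous_intros ec bounded_linear.continuous_on[OF bounded_linear_blinfun_mult_right])
  have der: "((\<lambda>y. integral (cbox (-pi) pi) (e y)) has_derivative integral (cbox (-pi) pi) (D x)) (at x within UNIV)"
  proof (rule leibniz_rule)
    fix y :: "real \<times> real" and \<theta> :: real
    have "((\<lambda>y. cis (k * (cos \<theta> * fst y + sin \<theta> * snd y))) has_derivative
        (\<lambda>h. of_real (k * (cos \<theta> * fst h + sin \<theta> * snd h)) * (\<i> * cis (k * (cos \<theta> * fst y + sin \<theta> * snd y))))) (at y)"
    proof -
      have 1: "((\<lambda>y::real\<times>real. k * (cos \<theta> * fst y + sin \<theta> * snd y)) has_derivative (\<lambda>h. k * (cos \<theta> * fst h + sin \<theta> * snd h))) (at y)"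
        by (auto intro!: derivative_eq_intros)
      have "(cis has_vector_derivative \<i> * of_real 1 * cis r) (at r)" for r
        using has_vector_derivative_cis[OF DERIV_ident] .
      then have 2: "(cis has_derivative (\<lambda>s. s *\<^sub>R (\<i> * cis r))) (at r)" for r
        by (simp add: has_vector_derivative_def)
      show ?thesis
        using has_derivative_compose[OF 1 2] by (simp add: scaleR_conv_of_real)
    qed
    from has_derivative_mult_right[OF this, of "\<phi> \<theta>"]
    show "((\<lambda>y. e y \<theta>) has_derivative blinfun_apply (D y \<theta>)) (at y within UNIV)"
      unfolding e_def by (rule has_derivative_eq_rhs) (auto simp: D e_def algebra_simps)
  next
    show "e y integrable_on cbox (-pi) pi" for y
      by (intro integrable_continuous ec continuous_intros)
    show "continuous_on (UNIV \<times> cbox (-pi) pi) (\<lambda>(y, \<theta>). D y \<theta>)"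
      by (simp add: split_beta Dc)
  qed auto
  have int: "blinfun_apply (integral (cbox (-pi) pi) (D x)) h =
      of_real (fst h) * herglotz k (density_x k \<phi>) x + of_real (snd h) * herglotz k (density_y k \<phi>) x" for h
  proof -
    have "continuous_on (cbox (-pi) pi) (\<lambda>\<theta>. D (fst (x, \<theta>)) (snd (x, \<theta>)))"
      by (rule continuous_on_compose2[OF Dc[of UNIV], of _ "\<lambda>\<theta>. (x, \<theta>)"]) (auto intro!: continuous_intros)
    then have "D x integrable_on cbox (-pi) pi" by (intro integrable_continuous) simp
    from blinfun_apply_integral[OF this]
    have "blinfun_apply (integral (cbox (-pi) pi) (D x)) h = integral {-pi..pi} (\<lambda>\<theta>. D x \<theta> h)"
      by simp
    also have "\<dots> = integral {-pi..pi} (\<lambda>\<theta>. of_real (fst h) * (\<i> * of_real (k * cos \<theta>) * e x \<theta>) + of_real (snd h) * (\<i> * of_real (k * sin \<theta>) * e x \<theta>))"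
      by (simp add: D mult_ac)
    also have "\<dots> = integral {-pi..pi} (\<lambda>\<theta>. of_real (fst h) * (\<i> * of_real (k * cos \<theta>) * e x \<theta>)) + integral {-pi..pi} (\<lambda>\<theta>. of_real (snd h) * (\<i> * of_real (k * sin \<theta>) * e x \<theta>))"
      by (intro integral_add integrable_continuous_real continuous_intros ec)
    finally show ?thesis by (simp only: integral_mult_right herglotz_cis e_def mult.assoc)
  qed
  have "herglotz k \<phi> = (\<lambda>y. integral (cbox (-pi) pi) (e y))"
    by (simp add: fun_eq_iff herglotz_cis e_def[abs_def])
  then show "(herglotz k \<phi> has_derivative
      (\<lambda>h. of_real (fst h) * herglotz k (density_x k \<phi>) x + of_real (snd h) * herglotz k (density_y k \<phi>) x)) (at x)"
    using der unfolding int[abs_def] by (simp only:)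
next
  show "continuous_on UNIV (herglotz k (density_x k \<phi>))"
    "continuous_on UNIV (herglotz k (density_y k \<phi>))"
    by (intro continuous_on_herglotz continuous_intros \<phi>)+
qed

lemma herglotz_laplacian:
  assumes \<phi>: "continuous_on UNIV \<phi>"
  shows "herglotz k (density_x k (density_x k \<phi>)) x
     + herglotz k (density_y k (density_y k \<phi>)) x
     = - of_real (k\<^sup>2) * herglotz k \<phi> x"
proof -
  let ?e = "\<lambda>\<theta>. cis (k * (cos \<theta> * fst x + sin \<theta> * snd x))"
  have *: "\<i> * of_real (k * cos \<theta>) * (\<i> * of_real (k * cos \<theta>) * \<phi> \<theta>) * ?e \<theta> +
      \<i> * of_real (k * sin \<theta>) * (\<i> * of_real (k * sin \<theta>) * \<phi> \<theta>) * ?e \<theta> = - of_real (k\<^sup>2) * (\<phi> \<theta> * ?e \<theta>)" for \<theta>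
  proof -
    have "(k * cos \<theta>) * (k * cos \<theta>) + (k * sin \<theta>) * (k * sin \<theta>) = k\<^sup>2 * ((cos \<theta>)\<^sup>2 + (sin \<theta>)\<^sup>2)"
      by (simp add: algebra_simps power2_eq_square del: sin_cos_squared_add sin_cos_squared_add2 sin_cos_squared_add3)
    then have "of_real (k * cos \<theta>) * of_real (k * cos \<theta>) + of_real (k * sin \<theta>) * of_real (k * sin \<theta>) = complex_of_real (k\<^sup>2)"
      by (metis mult.right_neutral of_real_add of_real_mult sin_cos_squared_add2)
    then have "(\<i> * \<i>) * (of_real (k * cos \<theta>) * of_real (k * cos \<theta>) + of_real (k * sin \<theta>) * of_real (k * sin \<theta>)) * (\<phi> \<theta> * ?e \<theta>)
      = - of_real (k\<^sup>2) * (\<phi> \<theta> * ?e \<theta>)" by simp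
    then show ?thesis by (simp only: ring_distribs mult_ac)
  qed
  have "herglotz k (density_x k (density_x k \<phi>)) x
     + herglotz k (density_y k (density_y k \<phi>)) x
     = integral {-pi..pi} (\<lambda>\<theta>. \<i> * of_real (k * cos \<theta>) * (\<i> * of_real (k * cos \<theta>) * \<phi> \<theta>) * ?e \<theta> +
        \<i> * of_real (k * sin \<theta>) * (\<i> * of_real (k * sin \<theta>) * \<phi> \<theta>) * ?e \<theta>)"
    unfolding herglotz_cis
    by (intro integral_add[symmetric] integrable_continuous_real continuous_intros continuous_on_subset[OF \<phi>]) auto
  also have "\<dots> = - of_real (k\<^sup>2) * herglotz k \<phi> x"
    unfolding * integral_mult_right herglotz_cis ..
  finally show ?thesis .
qed

text \<open>The squared positive part is C^1, which is the regularity required of test functions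
  here; it is the building block both of the radial cutoff and of the periodic bump in the final
  proof.\<close>

lemma DERIV_max_0_square:
  fixes y :: real
  shows "((\<lambda>y. (max 0 y)\<^sup>2) has_real_derivative 2 * max 0 y) (at y)"
proof (cases y "0::real" rule: linorder_cases)
  case less
  show ?thesis
    by (rule has_field_derivative_transform_within_open[where f="\<lambda>_. 0" and S="{..<0}"]) (use less in auto)
next
  case greater
  show ?thesis
    by (rule has_field_derivative_transform_within_open[where f="\<lambda>z. z\<^sup>2" and S="{0<..}"])
       (use greater in \<open>auto intro!: derivative_eq_intros\<close>)
next
  case equal
  have "(\<lambda>h. ((max 0 (0 + h))\<^sup>2 - (max 0 0)\<^sup>2) / h) \<midarrow>0\<rightarrow> (0::real)"
  proof (rule Lim_null_comparison)
    show "\<forall>\<^sub>F h in at 0. norm (((max 0 (0 + h))\<^sup>2 - (max 0 0)\<^sup>2) / h) \<le> \<bar>h::real\<bar>"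
      by (rule always_eventually) (auto simp: max_def power2_eq_square)
    show "((\<lambda>h::real. \<bar>h\<bar>) \<longlongrightarrow> 0) (at 0)"
      by (auto intro!: tendsto_eq_intros)
  qed
  then show ?thesis using equal by (simp add: DERIV_def)
qed

lemma C1_cutoff:
  fixes M :: real
  obtains p p' :: "real \<Rightarrow> real" where "\<And>y. (p has_real_derivative p' y) (at y)" "continuous_on UNIV p'"
    "\<And>y. y \<le> M \<Longrightarrow> p y = 1" "\<And>y. y \<le> M \<Longrightarrow> p' y = 0" "\<And>y. y \<ge> M + 1 \<Longrightarrow> p y = 0"
proof -
  define r where "r y = 1 - (max 0 (y - M))\<^sup>2" for y
  define p where "p y = (max 0 (r y))\<^sup>2" for y
  define p' where "p' y = 2 * max 0 (r y) * (- (2 * max 0 (y - M)))" for y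
  have r: "(r has_real_derivative - (2 * max 0 (y - M))) (at y)" for y
  proof -
    have "((\<lambda>y. y - M) has_real_derivative 1) (at y)" by (auto intro!: derivative_eq_intros)
    from DERIV_diff[OF DERIV_const DERIV_chain2[OF DERIV_max_0_square this]] show ?thesis
      unfolding r_def by simp
  qed
  have p: "(p has_real_derivative p' y) (at y)" for y
    unfolding p_def p'_def using DERIV_chain2[OF DERIV_max_0_square r] .
  have rc: "continuous_on UNIV r" unfolding r_def by (intro continuous_intros)
  show ?thesis
  proof (rule that[OF p])
    show "continuous_on UNIV p'" unfolding p'_def by (intro continuous_intros rc)
    show "p y = 1" "p' y = 0" if "y \<le> M" for y using that by (auto simp: p_def p'_def r_def)
    show "p y = 0" if "y \<ge> M + 1" for y
    proof -
      have "(y - M)\<^sup>2 \<ge> 1" using that one_le_power[of "y - M" 2] by simp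
      then show ?thesis using that by (simp add: p_def r_def)
    qed
  qed
qed

text \<open>The weak Neumann condition is tested with compactly supported functions, which Herglotz
  waves are not; multiplying by this cutoff leaves a wave and its gradient unchanged on
  \<open>A\<close>. Composing with the squared norm avoids the kink of the norm at the
  origin.\<close>

lemma cutoff_has_grad:
  assumes "bounded A"
  obtains \<zeta> \<zeta>1 \<zeta>2 where "has_grad \<zeta> \<zeta>1 \<zeta>2" "\<And>x. x \<in> A \<Longrightarrow> \<zeta> x = 1 \<and> \<zeta>1 x = 0 \<and> \<zeta>2 x = 0"
    "bounded {x. \<zeta> x \<noteq> 0}"
proof -
  obtain M where M: "\<And>x. x \<in> A \<Longrightarrow> norm x \<le> M" using assms by (auto simp: bounded_iff)
  obtain p p' :: "real \<Rightarrow> real" where p: "\<And>y. (p has_real_derivative p' y) (at y)" "continuous_on UNIV p'"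
    and M': "\<And>y. y \<le> M\<^sup>2 \<Longrightarrow> p y = 1" "\<And>y. y \<le> M\<^sup>2 \<Longrightarrow> p' y = 0" "\<And>y. y \<ge> M\<^sup>2 + 1 \<Longrightarrow> p y = 0"
    using C1_cutoff[of "M\<^sup>2"] by blast
  define N where "N x = (fst x)\<^sup>2 + (snd x)\<^sup>2" for x :: "real \<times> real"
  have N: "N x = (norm x)\<^sup>2" for x by (simp add: N_def norm_prod_def)
  have Nd: "(N has_derivative (\<lambda>h. 2 * fst x * fst h + 2 * snd x * snd h)) (at x)" for x
    unfolding N_def by (auto intro!: derivative_eq_intros)
  have Nc: "continuous_on UNIV N" unfolding N_def by (intro continuous_intros)
  have "has_grad (\<lambda>x. of_real (p (N x))) (\<lambda>x. of_real (p' (N x) * (2 * fst x))) (\<lambda>x. of_real (p' (N x) * (2 * snd x)))"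
    unfolding has_grad_def
  proof (intro conjI allI)
    fix x
    have "((\<lambda>x. p (N x)) has_derivative (\<lambda>h. p' (N x) * (2 * fst x * fst h + 2 * snd x * snd h))) (at x)"
      using has_derivative_compose[OF Nd p(1)[unfolded has_field_derivative_def]] .
    then have "((\<lambda>x. complex_of_real (p (N x))) has_derivative (\<lambda>h. of_real (p' (N x) * (2 * fst x * fst h + 2 * snd x * snd h)))) (at x)"
      by (rule has_derivative_of_real)
    then show "((\<lambda>x. complex_of_real (p (N x))) has_derivative
       (\<lambda>h. of_real (fst h) * of_real (p' (N x) * (2 * fst x)) + of_real (snd h) * of_real (p' (N x) * (2 * snd x)))) (at x)"
      by (rule has_derivative_eq_rhs) (auto simp: algebra_simps)
  qed (intro continuous_intros continuous_on_compose2[OF p(2) Nc]; simp)+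
  then show ?thesis
  proof (rule that)
    show "complex_of_real (p (N x)) = 1 \<and> complex_of_real (p' (N x) * (2 * fst x)) = 0 \<and> complex_of_real (p' (N x) * (2 * snd x)) = 0"
      if "x \<in> A" for x
    proof -
      have "N x \<le> M\<^sup>2" unfolding N using M[OF that] by (intro power_mono) auto
      then show ?thesis using M' by simp
    qed
    show "bounded {x. complex_of_real (p (N x)) \<noteq> 0}"
    proof (rule boundedI)
      fix x assume "x \<in> {x. complex_of_real (p (N x)) \<noteq> 0}"
      then have "(norm x)\<^sup>2 < M\<^sup>2 + 1" using M'(3)[of "N x"] unfolding N[symmetric] by force
      then show "norm x \<le> sqrt (M\<^sup>2 + 1)" by (intro real_le_rsqrt) simp
    qed
  qed
qed

section \<open>The flux identity for non-scattering waves\<close>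

lemma continuous_bounded_on_bounded:
  fixes h :: "'a::euclidean_space \<Rightarrow> 'b::real_normed_vector"
  assumes "continuous_on UNIV h" "bounded A"
  obtains K where "K > 0" "\<And>x. x \<in> A \<Longrightarrow> norm (h x) \<le> K"
proof -
  have "compact (h ` closure A)"
    using assms by (intro compact_continuous_image continuous_on_subset[OF assms(1)]) (auto simp: compact_closure)
  then obtain K where K: "\<forall>y \<in> h ` closure A. norm y \<le> K"
    using compact_imp_bounded bounded_iff by metis
  show ?thesis
    by (rule that[of "max 1 K"]) (use K closure_subset[of A] in \<open>auto simp: le_max_iff_disj\<close>)
qed

lemma set_integral_norm_bound_integral:
  fixes f :: "'a \<Rightarrow> 'b::{banach, second_countable_topology}"
  assumes "set_integrable M A f" "set_integrable M A g" "\<And>x. x \<in> A \<Longrightarrow> norm (f x) \<le> g x"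
  shows "norm (LINT x:A|M. f x) \<le> (LINT x:A|M. g x)"
proof -
  have "norm (LINT x:A|M. f x) \<le> (\<integral>x. norm (indicator A x *\<^sub>R f x) \<partial>M)"
    unfolding set_lebesgue_integral_def by (rule integral_norm_bound)
  also have "\<dots> \<le> (LINT x:A|M. g x)"
    unfolding set_lebesgue_integral_def
    using assms(1,2) unfolding set_integrable_def
    by (intro integral_mono integrable_norm) (auto simp: indicator_def assms(3))
  finally show ?thesis .
qed

lemma set_borel_measurable_mult_continuous:
  fixes f w :: "real \<times> real \<Rightarrow> complex"
  assumes "set_borel_measurable lborel A f" "continuous_on UNIV w"
  shows "set_borel_measurable lborel A (\<lambda>x. f x * w x)"
proof -
  have "w \<in> borel_measurable lborel"
    using borel_measurable_continuous_onI[OF assms(2)] by simp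
  then have "(\<lambda>x. (indicator A x *\<^sub>R f x) * w x) \<in> borel_measurable lborel"
    using assms(1) unfolding set_borel_measurable_def by (rule borel_measurable_times[rotated])
  then show ?thesis unfolding set_borel_measurable_def by simp
qed

lemma L2_mult_continuous_integrable:
  assumes f: "L2 A f" and w: "continuous_on UNIV w" and A: "A \<in> sets borel" "bounded A"
  shows "set_integrable lborel A (\<lambda>x. f x * w x)"
proof -
  obtain K where K: "K > 0" "\<And>x. x \<in> A \<Longrightarrow> norm (w x) \<le> K"
    using continuous_bounded_on_bounded[OF w A(2)] by blast
  show ?thesis
  proof (rule set_integrable_bound)
    have "set_integrable lborel A (\<lambda>x. 1 + (cmod (f x))\<^sup>2)"
      using f unfolding L2_def
      by (intro set_integral_add(1)[OF set_integrable_bounded_continuous[OF _ A]]) auto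
    then show "set_integrable lborel A (\<lambda>x. (1 + (cmod (f x))\<^sup>2) * K)"
      by (intro set_integrable_mult_left)
    show "set_borel_measurable lborel A (\<lambda>x. f x * w x)"
      using f w by (intro set_borel_measurable_mult_continuous) (auto simp: L2_def)
    show "AE x in lborel. x \<in> A \<longrightarrow> norm (f x * w x) \<le> norm ((1 + (cmod (f x))\<^sup>2) * K)"
    proof (intro AE_I2 impI)
      fix x assume "x \<in> A"
      have "cmod (f x) \<le> 1 + (cmod (f x))\<^sup>2"
        using sum_squares_bound[of 1 "cmod (f x)"] norm_ge_zero[of "f x"]
        by (simp only: power_one mult_1_right one_power2)
      then have "norm (f x * w x) \<le> (1 + (cmod (f x))\<^sup>2) * K"
        unfolding norm_mult using K(2)[OF \<open>x \<in> A\<close>] by (intro mult_mono) auto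
      also have "\<dots> \<le> norm ((1 + (cmod (f x))\<^sup>2) * K)" by simp
      finally show "norm (f x * w x) \<le> norm ((1 + (cmod (f x))\<^sup>2) * K)" .
    qed
  qed
qed

lemma L2_continuous_diff:
  assumes d: "L2 A d" and f: "continuous_on UNIV f" and A: "A \<in> sets borel" "bounded A"
  shows "L2 A (\<lambda>x. f x - d x)"
proof -
  have fm: "f \<in> borel_measurable lborel"
    using borel_measurable_continuous_onI[OF f] by simp
  have m: "set_borel_measurable lborel A (\<lambda>x. f x - d x)"
  proof -
    have "(\<lambda>x. indicator A x *\<^sub>R f x) \<in> borel_measurable lborel"
      using fm A by (intro borel_measurable_scaleR borel_measurable_indicator) auto
    moreover have "(\<lambda>x. indicator A x *\<^sub>R d x) \<in> borel_measurable lborel"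
      using d unfolding L2_def set_borel_measurable_def by blast
    ultimately show ?thesis
      unfolding set_borel_measurable_def scaleR_diff_right by (rule borel_measurable_diff)
  qed
  have "set_integrable lborel A (\<lambda>x. (cmod (f x - d x))\<^sup>2)"
  proof (rule set_integrable_bound)
    show "set_integrable lborel A (\<lambda>x. 2 * (cmod (f x))\<^sup>2 + 2 * (cmod (d x))\<^sup>2)"
      using d unfolding L2_def
      by (intro set_integral_add(1)[OF set_integrable_bounded_continuous[OF _ A]] set_integrable_mult_right
          continuous_intros f) auto
    have "(\<lambda>x. (cmod (indicator A x *\<^sub>R (f x - d x)))\<^sup>2) \<in> borel_measurable lborel"
      using m unfolding set_borel_measurable_def by measurable
    also have "(\<lambda>x. (cmod (indicator A x *\<^sub>R (f x - d x)))\<^sup>2) = (\<lambda>x. indicator A x *\<^sub>R (cmod (f x - d x))\<^sup>2)"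
      by (auto simp: indicator_def fun_eq_iff)
    finally show "set_borel_measurable lborel A (\<lambda>x. (cmod (f x - d x))\<^sup>2)"
      unfolding set_borel_measurable_def .
    show "AE x in lborel. x \<in> A \<longrightarrow> norm ((cmod (f x - d x))\<^sup>2) \<le> norm (2 * (cmod (f x))\<^sup>2 + 2 * (cmod (d x))\<^sup>2)"
    proof (intro AE_I2 impI)
      fix x
      have "(cmod (f x - d x))\<^sup>2 \<le> (cmod (f x) + cmod (d x))\<^sup>2"
        by (intro power_mono norm_triangle_ineq4) auto
      also have "\<dots> \<le> 2 * (cmod (f x))\<^sup>2 + 2 * (cmod (d x))\<^sup>2"
        using sum_squares_bound[of "cmod (f x)" "cmod (d x)"] unfolding power2_sum by linarith
      finally show "norm ((cmod (f x - d x))\<^sup>2) \<le> norm (2 * (cmod (f x))\<^sup>2 + 2 * (cmod (d x))\<^sup>2)"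
        by simp
    qed
  qed
  then show ?thesis using m by (simp add: L2_def)
qed

text \<open>A pointwise substitute for Cauchy-Schwarz: integrated over a set of finite measure it
  bounds an L^1 norm by d times the measure plus the squared L^2 norm over d, so L^2 convergence
  passes to integrals against bounded functions.\<close>

lemma le_add_square_div: "(a::real) \<le> d + a\<^sup>2 / d" if "d > 0" "a \<ge> 0"
proof (cases "a \<le> d")
  case True then show ?thesis using that by (simp add: add_increasing2)
next
  case False
  then have "a * d \<le> a\<^sup>2" using that by (simp add: power2_eq_square mult_left_mono)
  then have "a \<le> a\<^sup>2 / d" using that by (simp add: le_divide_eq)
  then show ?thesis using that by linarith
qed

text \<open>For an approximating test function \<open>f n\<close> Green's formula has no boundary
  term, so the corresponding integral is 0. The integral is linear in function and gradient and its
  weights are bounded on the domain, so the L^2 approximation carries the identity to the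
  limit.\<close>

lemma H1_0_orthogonal:
  assumes \<rho>: "radius_function \<rho>" and d: "H1_0 (star_domain \<rho>) d d1 d2"
    and w: "continuous_on UNIV w" and w1: "has_grad w1 w11 w12" and w2: "has_grad w2 w21 w22"
    and lap: "\<And>x. w11 x + w22 x = - c * w x"
  shows "(LINT x:star_domain \<rho>|lborel. d1 x * w1 x + d2 x * w2 x - c * d x * w x) = 0"
proof -
  define \<Omega> where "\<Omega> = star_domain \<rho>"
  note A = star_domain_measurable[OF \<rho>, folded \<Omega>_def]
  have L2: "L2 \<Omega> d" "L2 \<Omega> d1" "L2 \<Omega> d2"
    using d by (auto simp: H1_0_def H1_def \<Omega>_def)
  obtain f f1 f2 where f: "\<And>n. Cc1 \<Omega> (f n) (f1 n) (f2 n)"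
    and lim: "(\<lambda>n. LINT x:\<Omega>|lborel. (cmod (f n x - d x))\<^sup>2 + (cmod (f1 n x - d1 x))\<^sup>2
                                + (cmod (f2 n x - d2 x))\<^sup>2) \<longlonglongrightarrow> 0"
    using d unfolding H1_0_def \<Omega>_def by blast
  let ?sq = "\<lambda>n x. (cmod (f n x - d x))\<^sup>2 + (cmod (f1 n x - d1 x))\<^sup>2 + (cmod (f2 n x - d2 x))\<^sup>2"
  let ?D = "\<lambda>x. d1 x * w1 x + d2 x * w2 x - c * d x * w x" and ?F = "\<lambda>n x. f1 n x * w1 x + f2 n x * w2 x - c * f n x * w x"
  define e where "e n = (LINT x:\<Omega>|lborel. ?sq n x)" for n
  have fg: "has_grad (f n) (f1 n) (f2 n)" for n
    using f[of n] unfolding Cc1_def has_grad_def by blast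
  note fc = has_gradD(2-4)[OF fg, of UNIV]
  note wc = has_gradD(2)[OF w1, of UNIV] has_gradD(2)[OF w2, of UNIV]
  have cw: "continuous_on UNIV (\<lambda>x. c * w x)" by (intro continuous_intros w)
  obtain K1 where K1: "K1 > 0" "\<And>x. x \<in> \<Omega> \<Longrightarrow> norm (w1 x) \<le> K1"
    using continuous_bounded_on_bounded[OF wc(1) A(2)] by blast
  obtain K2 where K2: "K2 > 0" "\<And>x. x \<in> \<Omega> \<Longrightarrow> norm (w2 x) \<le> K2"
    using continuous_bounded_on_bounded[OF wc(2) A(2)] by blast
  obtain K3 where K3: "K3 > 0" "\<And>x. x \<in> \<Omega> \<Longrightarrow> norm (c * w x) \<le> K3"
    using continuous_bounded_on_bounded[OF cw A(2)] by blast
  define K where "K = K1 + K2 + K3"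
  have K: "K > 0" "\<And>x. x \<in> \<Omega> \<Longrightarrow> norm (w1 x) \<le> K" "\<And>x. x \<in> \<Omega> \<Longrightarrow> norm (w2 x) \<le> K" "\<And>x. x \<in> \<Omega> \<Longrightarrow> norm (c * w x) \<le> K"
    using K1 K2 K3 unfolding K_def by force+
  define Z where "Z = (LINT x:\<Omega>|lborel. ?D x)"
  have i1: "set_integrable lborel \<Omega> (\<lambda>x. ?D x)"
  proof -
    have "set_integrable lborel \<Omega> (\<lambda>x. d1 x * w1 x + d2 x * w2 x - d x * (c * w x))"
      by (intro set_integral_add(1) set_integral_diff(1) L2_mult_continuous_integrable L2 A wc cw)
    then show ?thesis by (simp only: mult_ac)
  qed
  have i2: "set_integrable lborel \<Omega> (\<lambda>x. ?F n x)" for n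
    by (intro set_integrable_bounded_continuous A continuous_intros fc wc w)
  have f0: "(LINT x:\<Omega>|lborel. ?F n x) = 0" for n
  proof -
    have "f n (bdry \<rho> t) = 0" for t
    proof (rule ccontr)
      assume "f n (bdry \<rho> t) \<noteq> 0"
      then have "bdry \<rho> t \<in> closure {x. f n x \<noteq> 0}" by (intro subsetD[OF closure_subset]) simp
      moreover have "closure {x. f n x \<noteq> 0} \<subseteq> \<Omega>" using f[of n] unfolding Cc1_def by (elim conjE)
      ultimately have "bdry \<rho> t \<in> \<Omega>" by (rule subsetD[rotated])
      then show False using bdry_notin_star_domain[OF \<rho>, of t] unfolding \<Omega>_def by contradiction
    qed
    then show ?thesis
      unfolding \<Omega>_def green_star_domain[where c=c and w=w, OF \<rho> fg w1 w2 lap] by (simp only: mult_zero_left integral_0)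
  qed
  have sq: "set_integrable lborel \<Omega> (\<lambda>x. (cmod (f n x - d x))\<^sup>2)" "set_integrable lborel \<Omega> (\<lambda>x. (cmod (f1 n x - d1 x))\<^sup>2)"
     "set_integrable lborel \<Omega> (\<lambda>x. (cmod (f2 n x - d2 x))\<^sup>2)" for n
    using L2_continuous_diff[OF L2(1) fc(1) A] L2_continuous_diff[OF L2(2) fc(2) A] L2_continuous_diff[OF L2(3) fc(3) A]
    unfolding L2_def by blast+
  define m where "m = (LINT x:\<Omega>|lborel. (1::real))"
  have bound: "norm Z \<le> K * (3 * \<delta> * m + e n / \<delta>)" if "\<delta> > 0" for \<delta> n
  proof -
    have "Z = (LINT x:\<Omega>|lborel. ?D x - ?F n x)"
      unfolding Z_def set_integral_diff(2)[OF i1 i2] f0 by simp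
    then have "norm Z \<le> (LINT x:\<Omega>|lborel. K * (3 * \<delta> * 1 + ?sq n x / \<delta>))"
    proof (simp only:, intro set_integral_norm_bound_integral)
      show "set_integrable lborel \<Omega> (\<lambda>x. ?D x - ?F n x)"
        by (intro set_integral_diff(1) i1 i2)
      show "set_integrable lborel \<Omega> (\<lambda>x. K * (3 * \<delta> * 1 + ?sq n x / \<delta>))"
        by (intro set_integrable_mult_right set_integral_add(1) set_integrable_divide impI sq set_integrable_bounded_continuous A) auto
      fix x assume x: "x \<in> \<Omega>"
      have "norm (?D x - ?F n x)
         = norm ((f n x - d x) * (c * w x) + ((d1 x - f1 n x) * w1 x + (d2 x - f2 n x) * w2 x))"
        by (rule arg_cong[where f=norm]) (simp add: algebra_simps)
      also have "\<dots> \<le> norm ((f n x - d x) * (c * w x)) + (norm ((d1 x - f1 n x) * w1 x) + norm ((d2 x - f2 n x) * w2 x))"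
        by (intro norm_triangle_le add_mono order_refl norm_triangle_ineq)
      also have "\<dots> \<le> cmod (f n x - d x) * K + (cmod (f1 n x - d1 x) * K + cmod (f2 n x - d2 x) * K)"
        unfolding norm_mult norm_minus_commute[of "d1 x"] norm_minus_commute[of "d2 x"]
        using K(2-4)[OF x] unfolding norm_mult by (intro add_mono mult_left_mono) auto
      also have "\<dots> = K * (cmod (f n x - d x) + cmod (f1 n x - d1 x) + cmod (f2 n x - d2 x))"
        by (simp add: algebra_simps)
      also have "\<dots> \<le> K * ((\<delta> + (cmod (f n x - d x))\<^sup>2 / \<delta>) + (\<delta> + (cmod (f1 n x - d1 x))\<^sup>2 / \<delta>) + (\<delta> + (cmod (f2 n x - d2 x))\<^sup>2 / \<delta>))"
        using K(1) that by (intro mult_left_mono add_mono le_add_square_div) auto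
      also have "\<dots> = K * (3 * \<delta> * 1 + ?sq n x / \<delta>)"
        by (simp add: add_divide_distrib)
      finally show "norm (?D x - ?F n x)
        \<le> K * (3 * \<delta> * 1 + ?sq n x / \<delta>)" .
    qed
    also have "\<dots> = K * (3 * \<delta> * m + e n / \<delta>)"
    proof -
      have a: "set_integrable lborel \<Omega> (\<lambda>x. 3 * \<delta> * 1)"
        by (intro set_integrable_bounded_continuous A) auto
      have b: "set_integrable lborel \<Omega> (\<lambda>x. ?sq n x / \<delta>)"
        by (intro set_integral_add(1) set_integrable_divide impI sq)
      show ?thesis
        by (simp only: m_def e_def set_integral_mult_right set_integral_add(2)[OF a b] set_integral_divide_zero)
    qed
    finally show ?thesis .
  qed
  \<comment> \<open>Order of limits: n tends to infinity for fixed \<delta>, which removes e n /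
    \<delta>; only afterwards \<delta> tends to 0.\<close>
  have bound2: "norm Z \<le> K * (3 * \<delta> * m)" if "\<delta> > 0" for \<delta>
  proof (rule tendsto_lowerbound)
    have "(\<lambda>n. K * (3 * \<delta> * m + e n / \<delta>)) \<longlonglongrightarrow> K * (3 * \<delta> * m + 0 / \<delta>)"
      using lim that unfolding e_def[symmetric] by (intro tendsto_intros) auto
    then show "(\<lambda>n. K * (3 * \<delta> * m + e n / \<delta>)) \<longlonglongrightarrow> K * (3 * \<delta> * m)" by simp
  qed (use bound that in auto)
  have "norm Z \<le> 0"
  proof (rule tendsto_lowerbound)
    show "((\<lambda>\<delta>. K * (3 * \<delta> * m)) \<longlongrightarrow> 0) (at_right 0)"
      by (auto intro!: tendsto_eq_intros)
    show "\<forall>\<^sub>F \<delta> in at_right 0. norm Z \<le> K * (3 * \<delta> * m)"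
      using bound2 by (auto simp: eventually_at_right_field intro!: exI[of _ 1])
  qed auto
  then show ?thesis unfolding Z_def \<Omega>_def by simp
qed

text \<open>Normal derivative times the speed of the parametrisation, as \<open>bdry_normal\<close>
  is not normalised; integrals over t thus carry no further arc length factor.\<close>

definition flux :: "(real \<Rightarrow> real) \<Rightarrow> (real \<times> real \<Rightarrow> complex) \<Rightarrow> real \<Rightarrow> complex" where
  "flux \<rho> v t = frechet_derivative v (at (bdry \<rho> t)) (bdry_normal \<rho> t)"

lemma has_grad_frechet:
  assumes "has_grad v v1 v2"
  shows "flux \<rho> v t = of_real (fst (bdry_normal \<rho> t)) * v1 (bdry \<rho> t) + of_real (snd (bdry_normal \<rho> t)) * v2 (bdry \<rho> t)"
    "pd1 v = v1" "pd2 v = v2"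
proof -
  have *: "frechet_derivative v (at x) = (\<lambda>h. of_real (fst h) * v1 x + of_real (snd h) * v2 x)" for x
    using frechet_derivative_at[OF has_gradD(1)[OF assms]] by simp
  show "flux \<rho> v t = of_real (fst (bdry_normal \<rho> t)) * v1 (bdry \<rho> t) + of_real (snd (bdry_normal \<rho> t)) * v2 (bdry \<rho> t)"
    by (simp add: flux_def *)
  show "pd1 v = v1" "pd2 v = v2" by (auto simp: pd1_def pd2_def fun_eq_iff *)
qed

text \<open>The weak Neumann condition tested with w turns the left side into a volume integral of u
  against w. By \<open>H1_0_orthogonal\<close> the part u - v contributes nothing, so u may be
  replaced by v there, and Green's formula for the smooth v gives the right side. No trace of u is
  ever taken.\<close>

lemma non_scattering_flux_identity:
  assumes \<rho>: "radius_function \<rho>" and ns: "non_scattering q \<rho> k v"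
    and v: "has_grad v v1 v2" and w: "has_grad w w1 w2"
    and w1: "has_grad w1 w11 w12" and w2: "has_grad w2 w21 w22"
    and lap: "\<And>x. w11 x + w22 x = - of_real (k\<^sup>2 * q) * w x"
  shows "integral {0..2*pi} (\<lambda>t. flux \<rho> v t * w (bdry \<rho> t)) = integral {0..2*pi} (\<lambda>t. v (bdry \<rho> t) * flux \<rho> w t)"
proof -
  define \<Omega> where "\<Omega> = star_domain \<rho>"
  define c where "c = complex_of_real (k\<^sup>2 * q)"
  note A = star_domain_measurable[OF \<rho>, folded \<Omega>_def]
  obtain u g1 g2 where H1: "H1 \<Omega> u g1 g2"
    and H10: "H1_0 \<Omega> (\<lambda>x. u x - v x) (\<lambda>x. g1 x - pd1 v x) (\<lambda>x. g2 x - pd2 v x)"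
    and N: "\<And>\<psi> \<psi>1 \<psi>2. Cc1 UNIV \<psi> \<psi>1 \<psi>2 \<Longrightarrow>
          (LINT x:\<Omega>|lborel. g1 x * \<psi>1 x + g2 x * \<psi>2 x - c * u x * \<psi> x)
          = integral {0..2*pi} (\<lambda>t. flux \<rho> v t * \<psi> (bdry \<rho> t))"
    using ns unfolding non_scattering_def Let_def \<Omega>_def flux_def c_def by blast
  have wc: "continuous_on UNIV w" "continuous_on UNIV w1" "continuous_on UNIV w2"
    using has_gradD[OF w] by auto
  \<comment> \<open>The cutoff has to be 1 on the domain and on the boundary curve, because the two
    sides of the weak condition evaluate the test function on one and on the other.\<close>
  have "bounded (\<Omega> \<union> bdry \<rho> ` {0..2*pi})"
    using A(2) continuous_on_bdry(1)[OF \<rho>] by (auto intro!: compact_imp_bounded compact_continuous_image)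
  then obtain \<zeta> \<zeta>1 \<zeta>2 where \<zeta>: "has_grad \<zeta> \<zeta>1 \<zeta>2"
    and \<zeta>1: "\<And>x. x \<in> \<Omega> \<union> bdry \<rho> ` {0..2*pi} \<Longrightarrow> \<zeta> x = 1 \<and> \<zeta>1 x = 0 \<and> \<zeta>2 x = 0"
    and \<zeta>b: "bounded {x. \<zeta> x \<noteq> 0}"
    by (rule cutoff_has_grad) blast
  have "Cc1 UNIV (\<lambda>x. \<zeta> x * w x) (\<lambda>x. \<zeta>1 x * w x + \<zeta> x * w1 x) (\<lambda>x. \<zeta>2 x * w x + \<zeta> x * w2 x)"
  proof -
    have "bounded {x. \<zeta> x * w x \<noteq> 0}" by (rule bounded_subset[OF \<zeta>b]) auto
    then show ?thesis
      using has_grad_mult[OF \<zeta> w] unfolding Cc1_def has_grad_def by (simp add: compact_closure)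
  qed
  from N[OF this] have "(LINT x:\<Omega>|lborel. g1 x * (\<zeta>1 x * w x + \<zeta> x * w1 x) + g2 x * (\<zeta>2 x * w x + \<zeta> x * w2 x) - c * u x * (\<zeta> x * w x))
     = integral {0..2*pi} (\<lambda>t. flux \<rho> v t * (\<zeta> (bdry \<rho> t) * w (bdry \<rho> t)))" .
  also have "(LINT x:\<Omega>|lborel. g1 x * (\<zeta>1 x * w x + \<zeta> x * w1 x) + g2 x * (\<zeta>2 x * w x + \<zeta> x * w2 x) - c * u x * (\<zeta> x * w x))
     = (LINT x:\<Omega>|lborel. g1 x * w1 x + g2 x * w2 x - c * u x * w x)"
    by (rule set_lebesgue_integral_cong) (use A \<zeta>1 in auto)
  also have "integral {0..2*pi} (\<lambda>t. flux \<rho> v t * (\<zeta> (bdry \<rho> t) * w (bdry \<rho> t))) = integral {0..2*pi} (\<lambda>t. flux \<rho> v t * w (bdry \<rho> t))"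
    by (rule Henstock_Kurzweil_Integration.integral_cong) (use \<zeta>1 in auto)
  finally have 1: "(LINT x:\<Omega>|lborel. g1 x * w1 x + g2 x * w2 x - c * u x * w x) = integral {0..2*pi} (\<lambda>t. flux \<rho> v t * w (bdry \<rho> t))" .
  have 2: "(LINT x:\<Omega>|lborel. (g1 x - v1 x) * w1 x + (g2 x - v2 x) * w2 x - c * (u x - v x) * w x) = 0"
    using H1_0_orthogonal[where c=c, OF \<rho> H10[unfolded \<Omega>_def has_grad_frechet(2,3)[OF v]] wc(1) w1 w2 lap[folded c_def]]
    unfolding \<Omega>_def .
  have 3: "(LINT x:\<Omega>|lborel. v1 x * w1 x + v2 x * w2 x - c * v x * w x) = integral {0..2*pi} (\<lambda>t. v (bdry \<rho> t) * flux \<rho> w t)"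
    unfolding \<Omega>_def green_star_domain[where c=c and w=w, OF \<rho> v w1 w2 lap[folded c_def]] has_grad_frechet(1)[OF w] ..
  have L: "L2 \<Omega> (\<lambda>x. u x - v x)" "L2 \<Omega> (\<lambda>x. g1 x - v1 x)" "L2 \<Omega> (\<lambda>x. g2 x - v2 x)"
    using H10 unfolding H1_0_def H1_def has_grad_frechet(2,3)[OF v] by auto
  have i1: "set_integrable lborel \<Omega> (\<lambda>x. (g1 x - v1 x) * w1 x + (g2 x - v2 x) * w2 x - c * (u x - v x) * w x)"
  proof -
    have "set_integrable lborel \<Omega> (\<lambda>x. (g1 x - v1 x) * w1 x + (g2 x - v2 x) * w2 x - (u x - v x) * (c * w x))"
      by (intro set_integral_add(1) set_integral_diff(1) L2_mult_continuous_integrable L A wc continuous_intros)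
    then show ?thesis by (simp only: mult_ac)
  qed
  have i2: "set_integrable lborel \<Omega> (\<lambda>x. v1 x * w1 x + v2 x * w2 x - c * v x * w x)"
    by (intro set_integrable_bounded_continuous A continuous_intros has_gradD[OF v] wc)
  have "(LINT x:\<Omega>|lborel. ((g1 x - v1 x) * w1 x + (g2 x - v2 x) * w2 x - c * (u x - v x) * w x) + (v1 x * w1 x + v2 x * w2 x - c * v x * w x))
     = integral {0..2*pi} (\<lambda>t. v (bdry \<rho> t) * flux \<rho> w t)"
    unfolding set_integral_add(2)[OF i1 i2] 2 3 by simp
  also have "(\<lambda>x. ((g1 x - v1 x) * w1 x + (g2 x - v2 x) * w2 x - c * (u x - v x) * w x) + (v1 x * w1 x + v2 x * w2 x - c * v x * w x))
     = (\<lambda>x. g1 x * w1 x + g2 x * w2 x - c * u x * w x)"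
    by (simp add: algebra_simps)
  finally show ?thesis using 1 by simp
qed

section \<open>Boundary traces of Herglotz waves\<close>

text \<open>Boundary values of a Herglotz wave and, up to the factor \<open>\<i> k\<close>, its flux; the wave number is
  complex so that both are entire in it.\<close>

definition trace_V :: "(real \<Rightarrow> real) \<Rightarrow> (real \<Rightarrow> complex) \<Rightarrow> complex \<Rightarrow> real \<Rightarrow> complex" where
  "trace_V \<rho> \<phi> z t = integral {-pi/2..3*pi/2} (\<lambda>x. \<phi> (t + x) * exp (\<i> * z * of_real (\<rho> t * cos x)))"

definition trace_U :: "(real \<Rightarrow> real) \<Rightarrow> (real \<Rightarrow> complex) \<Rightarrow> complex \<Rightarrow> real \<Rightarrow> complex" where
  "trace_U \<rho> \<phi> z t = integral {-pi/2..3*pi/2}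
     (\<lambda>x. (\<phi> (t + x) * of_real (\<rho> t * cos x - deriv \<rho> t * sin x)) * exp (\<i> * z * of_real (\<rho> t * cos x)))"

lemma exp_real_phase: "exp (\<i> * of_real k * of_real (r * c)) = cis (k * r * c)"
  by (simp add: cis_conv_exp mult_ac)

text \<open>Measuring the direction from the boundary angle t turns the phase into k * \<rho> t *
  cos x, whose stationary points 0 and pi do not move with t. Periodicity then allows the window
  [-pi/2, 3 pi/2] for every t.\<close>

lemma herglotz_bdry:
  assumes \<psi>: "continuous_on UNIV \<psi>" and per: "\<And>t. \<psi> (t + 2 * pi) = \<psi> t"
  shows "herglotz k \<psi> (bdry \<rho> t) = integral {-pi/2..3*pi/2} (\<lambda>x. \<psi> (t + x) * cis (k * \<rho> t * cos x))"
proof -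
  define f where "f \<theta> = \<psi> \<theta> * cis (k * \<rho> t * cos (\<theta> - t))" for \<theta>
  have fc: "continuous_on S f" for S
    unfolding f_def by (intro continuous_intros continuous_on_subset[OF \<psi>]) auto
  have fper: "f (\<theta> + 2 * pi) = f \<theta>" for \<theta>
  proof -
    have "cos (\<theta> + 2 * pi - t) = cos (\<theta> - t)"
      using cos_periodic[of "\<theta> - t"] by (simp add: algebra_simps)
    then show ?thesis by (simp add: f_def per)
  qed
  have "herglotz k \<psi> (bdry \<rho> t) = integral {-pi..-pi + 2 * pi} f"
    by (simp add: herglotz_cis bdry_def f_def[abs_def] cos_diff algebra_simps)
  also have "\<dots> = integral {t - pi/2..t - pi/2 + 2 * pi} f"
    by (rule integral_periodic_shift[OF fc fper]) simp
  also have "\<dots> = integral {-pi/2 + t..3*pi/2 + t} f"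
    by (simp add: algebra_simps)
  also have "\<dots> = integral {-pi/2..3*pi/2} (\<lambda>x. f (x + t))"
    using integral_shift[OF fc, where a="-pi/2" and b="3*pi/2" and c=t] by (simp add: o_def)
  also have "\<dots> = integral {-pi/2..3*pi/2} (\<lambda>x. \<psi> (t + x) * cis (k * \<rho> t * cos x))"
    by (simp add: f_def add.commute)
  finally show ?thesis .
qed

lemma herglotz_bdry_trace_V:
  assumes "continuous_on UNIV \<phi>" "\<And>t. \<phi> (t + 2 * pi) = \<phi> t"
  shows "herglotz k \<phi> (bdry \<rho> t) = trace_V \<rho> \<phi> (of_real k) t"
  unfolding herglotz_bdry[OF assms] trace_V_def exp_real_phase ..

text \<open>In the rotated angle x, the product of the direction with \<open>bdry_normal\<close> is
  \<rho> t * cos x - deriv \<rho> t * sin x. At the stationary points it equals \<rho> t and -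
  \<rho> t, the source of the relative sign in \<open>wave_odd\<close>.\<close>

lemma flux_herglotz_trace_U:
  assumes \<phi>: "continuous_on UNIV \<phi>" and per: "\<And>t. \<phi> (t + 2 * pi) = \<phi> t"
  shows "flux \<rho> (herglotz k \<phi>) t = \<i> * of_real k * trace_U \<rho> \<phi> (of_real k) t"
proof -
  define a where "a \<theta> = \<phi> \<theta> * complex_of_real (\<rho> t * cos (\<theta> - t) - deriv \<rho> t * sin (\<theta> - t))" for \<theta>
  let ?n1 = "fst (bdry_normal \<rho> t)" and ?n2 = "snd (bdry_normal \<rho> t)"
  let ?e = "\<lambda>\<theta>. cis (k * (cos \<theta> * fst (bdry \<rho> t) + sin \<theta> * snd (bdry \<rho> t)))"
  have ac: "continuous_on UNIV a"
    unfolding a_def by (intro continuous_intros \<phi>)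
  have aper: "a (\<theta> + 2 * pi) = a \<theta>" for \<theta>
  proof -
    have "cos (\<theta> + 2 * pi - t) = cos (\<theta> - t)" "sin (\<theta> + 2 * pi - t) = sin (\<theta> - t)"
      using cos_periodic[of "\<theta> - t"] sin_periodic[of "\<theta> - t"] by (simp_all add: algebra_simps)
    then show ?thesis by (simp add: a_def per)
  qed
  have n: "?n1 * cos \<theta> + ?n2 * sin \<theta> = \<rho> t * cos (\<theta> - t) - deriv \<rho> t * sin (\<theta> - t)" for \<theta>
    by (simp add: bdry_normal_def cos_diff sin_diff algebra_simps)
  have c: "continuous_on S \<phi>" for S by (rule continuous_on_subset[OF \<phi>]) simp
  have "flux \<rho> (herglotz k \<phi>) t =
     of_real ?n1 * herglotz k (density_x k \<phi>) (bdry \<rho> t) + of_real ?n2 * herglotz k (density_y k \<phi>) (bdry \<rho> t)"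
    by (rule has_grad_frechet(1)[OF has_grad_herglotz[OF \<phi>]])
  also have "\<dots> = integral {-pi..pi} (\<lambda>\<theta>. of_real ?n1 * (\<i> * of_real (k * cos \<theta>) * \<phi> \<theta> * ?e \<theta>) + of_real ?n2 * (\<i> * of_real (k * sin \<theta>) * \<phi> \<theta> * ?e \<theta>))"
    unfolding herglotz_cis integral_mult_right[symmetric]
    by (intro integral_add[symmetric] integrable_continuous_real continuous_intros c)
  also have "\<dots> = integral {-pi..pi} (\<lambda>\<theta>. \<i> * of_real k * (a \<theta> * ?e \<theta>))"
    unfolding a_def n[symmetric] by (simp add: algebra_simps)
  also have "\<dots> = \<i> * of_real k * herglotz k a (bdry \<rho> t)"
    unfolding integral_mult_right herglotz_cis ..
  also have "\<dots> = \<i> * of_real k * trace_U \<rho> \<phi> (of_real k) t"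
    unfolding herglotz_bdry[OF ac aper] trace_U_def exp_real_phase by (simp add: a_def)
  finally show ?thesis .
qed

text \<open>A z-derivative only multiplies the amplitude by i c, so derivatives stay in the same
  family of integrals and their joint continuity is again given by the second statement. Both kinds
  of trace are instances.\<close>

lemma parametric_exp_integral:
  fixes A :: "real \<Rightarrow> real \<Rightarrow> complex" and c :: "real \<Rightarrow> real \<Rightarrow> real"
  assumes A: "continuous_on UNIV (\<lambda>x. A (fst x) (snd x))" and c: "continuous_on UNIV (\<lambda>x. c (fst x) (snd x))"
  shows "((\<lambda>z. integral {a..b} (\<lambda>x. A t x * exp (\<i> * z * of_real (c t x)))) has_field_derivative
     integral {a..b} (\<lambda>x. (A t x * (\<i> * of_real (c t x))) * exp (\<i> * z * of_real (c t x)))) (at z)"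
    and "continuous_on UNIV (\<lambda>y. integral {a..b} (\<lambda>x. A (snd y) x * exp (\<i> * fst y * of_real (c (snd y) x))))"
proof -
  have A': "continuous_on S (\<lambda>y. A (f y) (g y))" if "continuous_on S f" "continuous_on S g" for S :: "'s::metric_space set" and f g
    using continuous_on_compose2[OF A, of S "\<lambda>y. (f y, g y)"] that by (simp add: continuous_on_Pair)
  have c': "continuous_on S (\<lambda>y. c (f y) (g y))" if "continuous_on S f" "continuous_on S g" for S :: "'s::metric_space set" and f g
    using continuous_on_compose2[OF c, of S "\<lambda>y. (f y, g y)"] that by (simp add: continuous_on_Pair)
  have "((\<lambda>z. integral (cbox a b) (\<lambda>x. A t x * exp (\<i> * z * of_real (c t x)))) has_field_derivative
     integral (cbox a b) (\<lambda>x. (A t x * (\<i> * of_real (c t x))) * exp (\<i> * z * of_real (c t x)))) (at z within UNIV)"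
  proof (rule leibniz_rule_field_derivative)
    show "((\<lambda>z. A t x * exp (\<i> * z * of_real (c t x))) has_field_derivative (A t x * (\<i> * of_real (c t x))) * exp (\<i> * z * of_real (c t x))) (at z within UNIV)" for z x
      by (auto intro!: derivative_eq_intros)
    show "(\<lambda>x. A t x * exp (\<i> * z * of_real (c t x))) integrable_on cbox a b" for z
      by (intro integrable_continuous continuous_intros A' c')
    show "continuous_on (UNIV \<times> cbox a b) (\<lambda>(z, x). (A t x * (\<i> * of_real (c t x))) * exp (\<i> * z * of_real (c t x)))"
      unfolding split_beta by (intro continuous_intros A' c')
  qed auto
  then show "((\<lambda>z. integral {a..b} (\<lambda>x. A t x * exp (\<i> * z * of_real (c t x)))) has_field_derivative
     integral {a..b} (\<lambda>x. (A t x * (\<i> * of_real (c t x))) * exp (\<i> * z * of_real (c t x)))) (at z)" by simp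
  have "continuous_on UNIV (\<lambda>y. integral (cbox a b) (\<lambda>x. A (snd y) x * exp (\<i> * fst y * of_real (c (snd y) x))))"
    by (rule integral_continuous_on_param) (unfold split_beta, intro continuous_intros A' c')
  then show "continuous_on UNIV (\<lambda>y. integral {a..b} (\<lambda>x. A (snd y) x * exp (\<i> * fst y * of_real (c (snd y) x))))" by simp
qed

lemma trace_continuous:
  assumes \<rho>: "radius_function \<rho>" and f: "continuous_on UNIV f"
  shows "continuous_on S (trace_V \<rho> f z)" "continuous_on S (trace_U \<rho> f z)"
proof -
  have R: "continuous_on S \<rho>" "continuous_on S (deriv \<rho>)" for S using radius_functionD[OF \<rho>] by blast+
  have c1: "continuous_on UNIV (\<lambda>x. \<rho> (fst x) * cos (snd x))"
    by (intro continuous_intros continuous_on_compose2[OF R(1)[of UNIV]]) auto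
  have V: "continuous_on UNIV (\<lambda>x. f (fst x + snd x))"
    by (intro continuous_on_compose2[OF f] continuous_intros) auto
  have U: "continuous_on UNIV (\<lambda>x. f (fst x + snd x) * complex_of_real (\<rho> (fst x) * cos (snd x) - deriv \<rho> (fst x) * sin (snd x)))"
    by (intro V continuous_intros continuous_on_compose2[OF R(1)[of UNIV]] continuous_on_compose2[OF R(2)[of UNIV]]) auto
  have p: "continuous_on S (\<lambda>t. (z, t))" by (intro continuous_intros)
  show "continuous_on S (trace_V \<rho> f z)" "continuous_on S (trace_U \<rho> f z)"
    using continuous_on_compose2[OF parametric_exp_integral(2)[OF V c1] p]
      continuous_on_compose2[OF parametric_exp_integral(2)[OF U c1] p]
    by (simp_all add: trace_V_def[abs_def] trace_U_def[abs_def])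
qed

text \<open>The integral of (flux of v) * w - v * (flux of w), divided by i k. The second wave has
  wave number \<sigma> k with \<sigma> = sqrt q, so its flux leaves the factor \<sigma> behind.
  Dividing out i k loses no zeros at k > 0.\<close>

definition boundary_pairing :: "real \<Rightarrow> (real \<Rightarrow> real) \<Rightarrow> (real \<Rightarrow> complex) \<Rightarrow> (real \<Rightarrow> complex) \<Rightarrow> complex \<Rightarrow> complex" where
  "boundary_pairing \<sigma> \<rho> \<phi> g z = integral {0..2*pi} (\<lambda>t. trace_U \<rho> \<phi> z t * trace_V \<rho> g (of_real \<sigma> * z) t
      - of_real \<sigma> * (trace_V \<rho> \<phi> z t * trace_U \<rho> g (of_real \<sigma> * z) t))"

lemma non_scattering_boundary_pairing:
  assumes \<rho>: "radius_function \<rho>" and q: "q > 0" and k: "k > 0"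
    and \<phi>: "continuous_on UNIV \<phi>" "\<And>t. \<phi> (t + 2 * pi) = \<phi> t"
    and g: "continuous_on UNIV g" "\<And>t. g (t + 2 * pi) = g t"
    and ns: "non_scattering q \<rho> k (herglotz k \<phi>)"
  shows "boundary_pairing (sqrt q) \<rho> \<phi> g (of_real k) = 0"
proof -
  define \<kappa> where "\<kappa> = sqrt q * k"
  have \<kappa>2: "\<kappa>\<^sup>2 = k\<^sup>2 * q" using q by (simp add: \<kappa>_def power_mult_distrib)
  have gc: "continuous_on UNIV (density_x \<kappa> g)" "continuous_on UNIV (density_y \<kappa> g)"
    by (intro continuous_intros g)+
  have "integral {0..2*pi} (\<lambda>t. flux \<rho> (herglotz k \<phi>) t * herglotz \<kappa> g (bdry \<rho> t))
      = integral {0..2*pi} (\<lambda>t. herglotz k \<phi> (bdry \<rho> t) * flux \<rho> (herglotz \<kappa> g) t)"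
    by (rule non_scattering_flux_identity[OF \<rho> ns has_grad_herglotz[OF \<phi>(1)] has_grad_herglotz[OF g(1)]
        has_grad_herglotz[OF gc(1)] has_grad_herglotz[OF gc(2)]])
       (use herglotz_laplacian[OF g(1), of \<kappa>] in \<open>simp only: \<kappa>2\<close>)
  then have eq: "integral {0..2*pi} (\<lambda>t. \<i> * of_real k * (trace_U \<rho> \<phi> (of_real k) t * trace_V \<rho> g (of_real \<kappa>) t))
      = integral {0..2*pi} (\<lambda>t. \<i> * of_real k * (of_real (sqrt q) * (trace_V \<rho> \<phi> (of_real k) t * trace_U \<rho> g (of_real \<kappa>) t)))"
    unfolding flux_herglotz_trace_U[OF \<phi>] flux_herglotz_trace_U[OF g] herglotz_bdry_trace_V[OF \<phi>] herglotz_bdry_trace_V[OF g]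
    by (simp add: \<kappa>_def mult_ac)
  have "\<i> * of_real k * boundary_pairing (sqrt q) \<rho> \<phi> g (of_real k) =
     integral {0..2*pi} (\<lambda>t. \<i> * of_real k * (trace_U \<rho> \<phi> (of_real k) t * trace_V \<rho> g (of_real \<kappa>) t)
       - \<i> * of_real k * (of_real (sqrt q) * (trace_V \<rho> \<phi> (of_real k) t * trace_U \<rho> g (of_real \<kappa>) t)))"
    unfolding boundary_pairing_def integral_mult_right[symmetric] right_diff_distrib by (simp add: \<kappa>_def)
  also have "\<dots> = 0"
    by (subst integral_diff) (auto simp only: eq diff_self intro!: integrable_continuous_real continuous_intros trace_continuous[OF \<rho>] \<phi> g)
  finally show ?thesis using k by simp
qed

lemma boundary_pairing_holomorphic:
  assumes \<rho>: "radius_function \<rho>" and \<phi>: "continuous_on UNIV \<phi>" and g: "continuous_on UNIV g"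
  shows "boundary_pairing \<sigma> \<rho> \<phi> g holomorphic_on UNIV"
proof -
  have R: "continuous_on S \<rho>" "continuous_on S (deriv \<rho>)" for S using radius_functionD[OF \<rho>] by blast+
  have Rf: "continuous_on S (\<lambda>x. \<rho> (f x))" "continuous_on S (\<lambda>x. deriv \<rho> (f x))" if "continuous_on S f" for S :: "(real \<times> real) set" and f
    using continuous_on_compose2[OF R(1) that] continuous_on_compose2[OF R(2) that] by auto
  define c where "c t x = \<rho> t * cos x" for t x
  define AV where "AV f t x = f (t + x)" for f :: "real \<Rightarrow> complex" and t x
  define AU where "AU f t x = f (t + x) * complex_of_real (\<rho> t * cos x - deriv \<rho> t * sin x)" for f t x
  define I where "I A z t = integral {-pi/2..3*pi/2} (\<lambda>x. A t x * exp (\<i> * z * complex_of_real (c t x)))" for A z and t :: real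
  define d where "d A t x = A t x * (\<i> * complex_of_real (c t x))" for A :: "real \<Rightarrow> real \<Rightarrow> complex" and t x
  define C where "C A \<longleftrightarrow> continuous_on UNIV (\<lambda>x. A (fst x) (snd x))" for A :: "real \<Rightarrow> real \<Rightarrow> complex"
  have c: "continuous_on UNIV (\<lambda>x. c (fst x) (snd x))"
    unfolding c_def by (intro continuous_intros Rf)
  have CV: "C (AV f)" if "continuous_on UNIV f" for f
    unfolding C_def AV_def by (intro continuous_on_compose2[OF that] continuous_intros) auto
  have CU: "C (AU f)" if "continuous_on UNIV f" for f
    unfolding C_def AU_def by (intro continuous_on_compose2[OF that] continuous_intros Rf) auto
  have Cd: "C (d A)" if "C A" for A
    using that unfolding C_def d_def by (intro continuous_intros c)
  have der: "((\<lambda>z. I A z t) has_field_derivative I (d A) z t) (at z)" if "C A" for A z t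
    using parametric_exp_integral(1)[OF that[unfolded C_def] c] unfolding I_def d_def .
  have der\<sigma>: "((\<lambda>z. I A (of_real \<sigma> * z) t) has_field_derivative I (d A) (of_real \<sigma> * z) t * of_real \<sigma>) (at z)" if "C A" for A z t
    by (rule DERIV_chain2[OF der[OF that]]) (auto intro!: derivative_eq_intros)
  have Ic: "continuous_on S (\<lambda>y. I A (f y) (h y))" if "C A" "continuous_on S f" "continuous_on S h" for A S f and h :: "'b::metric_space \<Rightarrow> real"
    using continuous_on_compose2[OF parametric_exp_integral(2)[OF that(1)[unfolded C_def] c], of S "\<lambda>y. (f y, h y)"] that(2,3)
    by (simp add: I_def continuous_on_Pair)
  note CC = CV[OF \<phi>] CV[OF g] CU[OF \<phi>] CU[OF g]
  let ?f = "\<lambda>z t. I (AU \<phi>) z t * I (AV g) (of_real \<sigma> * z) t - of_real \<sigma> * (I (AV \<phi>) z t * I (AU g) (of_real \<sigma> * z) t)"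
  let ?f' = "\<lambda>z t. (I (d (AU \<phi>)) z t * I (AV g) (of_real \<sigma> * z) t + I (d (AV g)) (of_real \<sigma> * z) t * of_real \<sigma> * I (AU \<phi>) z t)
       - of_real \<sigma> * (I (d (AV \<phi>)) z t * I (AU g) (of_real \<sigma> * z) t + I (d (AU g)) (of_real \<sigma> * z) t * of_real \<sigma> * I (AV \<phi>) z t)"
  have "(\<lambda>z. integral (cbox 0 (2*pi)) (\<lambda>t. ?f z t)) holomorphic_on UNIV"
  proof (rule leibniz_rule_holomorphic)
    fix z t
    show "((\<lambda>z. ?f z t) has_field_derivative
       ?f' z t) (at z within UNIV)"
      by (intro DERIV_diff DERIV_mult DERIV_cmult der der\<sigma> CC)
  next
    show "(\<lambda>t. ?f z t) integrable_on cbox 0 (2*pi)" for z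
      by (intro integrable_continuous continuous_intros Ic CC)
    show "continuous_on (UNIV \<times> cbox 0 (2*pi)) (\<lambda>(z, t). ?f' z t)"
      unfolding split_beta by (intro continuous_intros Ic CC Cd)
  qed simp
  moreover have "boundary_pairing \<sigma> \<rho> \<phi> g = (\<lambda>z. integral (cbox 0 (2*pi)) (\<lambda>t. ?f z t))"
    unfolding boundary_pairing_def trace_U_def trace_V_def I_def AU_def AV_def c_def interval_cbox ..
  ultimately show ?thesis by simp
qed

section \<open>High-frequency asymptotics\<close>

lemma has_vector_derivative_shift:
  assumes "\<And>x. (f has_vector_derivative f' x) (at x)"
  shows "((\<lambda>x. f (x + c)) has_vector_derivative f' (x + c)) (at x)"
proof -
  have "((\<lambda>x. x + c) has_vector_derivative 1) (at x)"
    by (auto intro!: derivative_eq_intros)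
  from vector_diff_chain_at[OF this assms] show ?thesis by (simp add: o_def)
qed

text \<open>Leading terms of the traces without their common decay: the contributions of the
  stationary points 0 and pi are added for boundary values and, in \<open>wave_odd\<close>,
  subtracted for fluxes.\<close>

definition wave_even :: "(real \<Rightarrow> real) \<Rightarrow> (real \<Rightarrow> complex) \<Rightarrow> real \<Rightarrow> real \<Rightarrow> complex" where
  "wave_even \<rho> \<phi> k t =
     \<phi> t * phase_const * cis (k * \<rho> t) + \<phi> (t + pi) * cnj phase_const * cis (- (k * \<rho> t))"

definition wave_odd :: "(real \<Rightarrow> real) \<Rightarrow> (real \<Rightarrow> complex) \<Rightarrow> real \<Rightarrow> real \<Rightarrow> complex" where
  "wave_odd \<rho> \<phi> k t =
     \<phi> t * phase_const * cis (k * \<rho> t) - \<phi> (t + pi) * cnj phase_const * cis (- (k * \<rho> t))"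

text \<open>Uniform in t for two reasons: the large parameter k * \<rho> t is at least k times the
  minimum of \<rho>, and all amplitudes share one C^1 bound.\<close>

lemma trace_asymptotics:
  assumes \<rho>: "radius_function \<rho>" and "\<delta> > 0"
    and \<phi>: "\<And>x. (\<phi> has_vector_derivative \<phi>' x) (at x)" and \<phi>': "continuous_on UNIV \<phi>'"
  shows "\<forall>\<^sub>F k in at_top. \<forall>t\<in>{0..2*pi}.
    norm (of_real (sqrt (k * \<rho> t)) * trace_V \<rho> \<phi> (of_real k) t - wave_even \<rho> \<phi> k t) \<le> \<delta> \<and>
    norm (of_real (sqrt (k * \<rho> t)) * trace_U \<rho> \<phi> (of_real k) t - of_real (\<rho> t) * wave_odd \<rho> \<phi> k t) \<le> \<delta>"
proof -
  note R = radius_functionD[OF \<rho>]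
  obtain \<epsilon> :: "real \<Rightarrow> real" where \<epsilon>: "(\<epsilon> \<longlongrightarrow> 0) at_top" and
    sp: "\<And>(a :: real \<Rightarrow> complex) a' M s. s \<ge> 1 \<Longrightarrow> (\<And>x. (a has_vector_derivative a' x) (at x)) \<Longrightarrow> continuous_on UNIV a' \<Longrightarrow>
      (\<And>x. x \<in> {-pi/2..3*pi/2} \<Longrightarrow> norm (a x) \<le> M) \<Longrightarrow> (\<And>x. x \<in> {-pi/2..3*pi/2} \<Longrightarrow> norm (a' x) \<le> M) \<Longrightarrow>
      norm (of_real (sqrt s) * integral {-pi/2..3*pi/2} (\<lambda>x. a x * cis (s * cos x))
        - (a 0 * phase_const * cis s + a pi * cnj phase_const * cis (- s))) \<le> M * \<epsilon> s"
    using stationary_phase_circle by blast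
  obtain m where m: "m > 0" "\<And>t. t \<in> {0..2*pi} \<Longrightarrow> m \<le> \<rho> t"
    using radius_function_lower_bound[OF \<rho>] by blast
  obtain r0 where r0: "r0 \<ge> 0" "\<And>t. t \<in> {0..2*pi} \<Longrightarrow> norm (\<rho> t) \<le> r0"
    using continuous_on_Icc_bounded[OF R(4)] by metis
  obtain r1 where r1: "r1 \<ge> 0" "\<And>t. t \<in> {0..2*pi} \<Longrightarrow> norm (deriv \<rho> t) \<le> r1"
    using continuous_on_Icc_bounded[OF R(5)] by metis
  have \<phi>c: "continuous_on S \<phi>" for S
    by (rule continuous_on_vector_derivative[OF has_vector_derivative_at_within[OF \<phi>]])
  have \<phi>c': "continuous_on S \<phi>'" for S
    by (rule continuous_on_subset[OF \<phi>']) simp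
  \<comment> \<open>This interval contains t + x for all t in [0, 2 pi] and x in
    [-pi/2, 3 pi/2].\<close>
  obtain M0 where M0: "M0 \<ge> 0" "\<And>x. x \<in> {-pi/2..7*pi/2} \<Longrightarrow> norm (\<phi> x) \<le> M0"
    using continuous_on_Icc_bounded[OF \<phi>c] by metis
  obtain M1 where M1: "M1 \<ge> 0" "\<And>x. x \<in> {-pi/2..7*pi/2} \<Longrightarrow> norm (\<phi>' x) \<le> M1"
    using continuous_on_Icc_bounded[OF \<phi>c'] by metis
  \<comment> \<open>Large enough for the amplitudes of both traces and, by the product rule, for
    their derivatives; r0 + r1 bounds the flux factor and its derivative.\<close>
  define M where "M = (M0 + M1) * (1 + r0 + r1)"
  have "M \<ge> 0" unfolding M_def using M0 M1 r0 r1 by simp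
  have "\<forall>\<^sub>F s in at_top. dist (\<epsilon> s) 0 < \<delta> / (M + 1)"
    using \<epsilon> \<open>\<delta> > 0\<close> \<open>M \<ge> 0\<close> by (intro tendstoD) auto
  then obtain S where S: "\<And>s. s \<ge> S \<Longrightarrow> \<bar>\<epsilon> s\<bar> < \<delta> / (M + 1)"
    by (auto simp: eventually_at_top_linorder dist_real_def)
  have fin: "M * \<epsilon> s \<le> \<delta>" if "s \<ge> S" for s
  proof -
    have "M * \<epsilon> s \<le> M * \<bar>\<epsilon> s\<bar>" using \<open>M \<ge> 0\<close> by (intro mult_left_mono) auto
    also have "\<dots> \<le> (M + 1) * \<bar>\<epsilon> s\<bar>" by (intro mult_right_mono) auto
    also have "\<dots> \<le> (M + 1) * (\<delta> / (M + 1))" using S[OF that] \<open>M \<ge> 0\<close> by (intro mult_left_mono) auto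
    also have "\<dots> = \<delta>" using \<open>M \<ge> 0\<close> by simp
    finally show ?thesis .
  qed
  have sh: "((\<lambda>x. \<phi> (t + x)) has_vector_derivative \<phi>' (t + x)) (at x)" for t x
    using has_vector_derivative_shift[OF \<phi>, of t x] by (simp add: add.commute)
  have shc: "continuous_on UNIV (\<lambda>x. \<phi> (t + x))" "continuous_on UNIV (\<lambda>x. \<phi>' (t + x))" for t
    by (intro continuous_on_compose2[OF \<phi>c[of UNIV]] continuous_on_compose2[OF \<phi>'] continuous_intros; simp)+
  show ?thesis
    using eventually_ge_at_top[of "max 1 S / m"]
  proof (eventually_elim, intro ballI)
    fix k t assume k: "max 1 S / m \<le> k" and t: "t \<in> {0..2*pi}"
    define s where "s = k * \<rho> t"
    have k0: "k \<ge> 0"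
    proof -
      have "0 \<le> max 1 S / m" using m(1) by (intro divide_nonneg_pos) auto
      then show ?thesis using k by linarith
    qed
    have "max 1 S \<le> k * m" using k m by (simp add: divide_le_eq)
    also have "\<dots> \<le> s" unfolding s_def using m(2)[OF t] k0 by (intro mult_left_mono)
    finally have s: "s \<ge> 1" "s \<ge> S" by auto
    have tx: "t + x \<in> {-pi/2..7*pi/2}" if "x \<in> {-pi/2..3*pi/2}" for x
      using that t by auto
    have MM: "M0 \<le> M" "M1 \<le> M"
    proof -
      have "M0 * 1 \<le> M" "M1 * 1 \<le> M" unfolding M_def using M0 M1 r0 r1 by (intro mult_mono; simp)+
      then show "M0 \<le> M" "M1 \<le> M" by auto
    qed
    have "norm (of_real (sqrt s) * integral {-pi/2..3*pi/2} (\<lambda>x. \<phi> (t + x) * cis (s * cos x))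
      - (\<phi> (t + 0) * phase_const * cis s + \<phi> (t + pi) * cnj phase_const * cis (- s))) \<le> M * \<epsilon> s"
      by (rule sp[OF s(1) sh shc(2)]) (use M0 M1 MM tx in \<open>meson order_trans\<close>)+
    then have 1: "norm (of_real (sqrt (k * \<rho> t)) * trace_V \<rho> \<phi> (of_real k) t - wave_even \<rho> \<phi> k t) \<le> \<delta>"
      using fin[OF s(2)] unfolding trace_V_def exp_real_phase s_def wave_even_def by simp
    define c where "c x = complex_of_real (\<rho> t * cos x - deriv \<rho> t * sin x)" for x
    define c' where "c' x = complex_of_real (- \<rho> t * sin x - deriv \<rho> t * cos x)" for x
    have c: "(c has_vector_derivative c' x) (at x)" for x
      unfolding c_def c'_def by (rule has_vector_derivative_of_real) (auto intro!: derivative_eq_intros)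
    have lin: "\<bar>u * x + v * y\<bar> \<le> \<bar>u\<bar> + \<bar>v\<bar>" if "\<bar>x\<bar> \<le> 1" "\<bar>y\<bar> \<le> 1" for u v x y :: real
    proof -
      have "\<bar>u * x + v * y\<bar> \<le> \<bar>u\<bar> * \<bar>x\<bar> + \<bar>v\<bar> * \<bar>y\<bar>"
        using abs_triangle_ineq[of "u * x" "v * y"] by (simp add: abs_mult)
      also have "\<dots> \<le> \<bar>u\<bar> * 1 + \<bar>v\<bar> * 1" using that by (intro add_mono mult_left_mono) auto
      finally show ?thesis by simp
    qed
    have cb: "norm (c x) \<le> r0 + r1" "norm (c' x) \<le> r0 + r1" for x
      using lin[of "cos x" "- sin x" "\<rho> t" "deriv \<rho> t"] lin[of "- sin x" "- cos x" "\<rho> t" "deriv \<rho> t"] r0(2)[OF t] r1(2)[OF t]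
      unfolding c_def c'_def norm_of_real by auto
    have "norm (of_real (sqrt s) * integral {-pi/2..3*pi/2} (\<lambda>x. (\<phi> (t + x) * c x) * cis (s * cos x))
      - ((\<phi> (t + 0) * c 0) * phase_const * cis s + (\<phi> (t + pi) * c pi) * cnj phase_const * cis (- s))) \<le> M * \<epsilon> s"
    proof (rule sp[OF s(1)])
      show "((\<lambda>x. \<phi> (t + x) * c x) has_vector_derivative \<phi> (t + x) * c' x + \<phi>' (t + x) * c x) (at x)" for x
        by (intro has_vector_derivative_mult sh c)
      show "continuous_on UNIV (\<lambda>x. \<phi> (t + x) * c' x + \<phi>' (t + x) * c x)"
        unfolding c_def c'_def by (intro continuous_intros shc)
      fix x :: real assume x: "x \<in> {-pi/2..3*pi/2}"
      note b0 = M0(2)[OF tx[OF x]] and b1 = M1(2)[OF tx[OF x]]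
      have "norm (\<phi> (t + x) * c x) \<le> M0 * (r0 + r1)"
        unfolding norm_mult using b0 cb M0 r0 r1 by (intro mult_mono) auto
      also have "\<dots> \<le> M" unfolding M_def using M0 M1 r0 r1 by (intro mult_mono) auto
      finally show "norm (\<phi> (t + x) * c x) \<le> M" .
      have "norm (\<phi> (t + x) * c' x + \<phi>' (t + x) * c x) \<le> norm (\<phi> (t + x)) * norm (c' x) + norm (\<phi>' (t + x)) * norm (c x)"
        using norm_triangle_ineq[of "\<phi> (t + x) * c' x" "\<phi>' (t + x) * c x"] by (simp only: norm_mult)
      also have "\<dots> \<le> M0 * (r0 + r1) + M1 * (r0 + r1)"
        using b0 b1 cb M0 M1 r0 r1 by (intro add_mono mult_mono) auto
      also have "\<dots> = (M0 + M1) * (r0 + r1)" by (simp add: algebra_simps)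
      also have "\<dots> \<le> M" unfolding M_def using M0 M1 r0 r1 by (intro mult_left_mono) auto
      finally show "norm (\<phi> (t + x) * c' x + \<phi>' (t + x) * c x) \<le> M" .
    qed
    then have 2: "norm (of_real (sqrt (k * \<rho> t)) * trace_U \<rho> \<phi> (of_real k) t - of_real (\<rho> t) * wave_odd \<rho> \<phi> k t) \<le> \<delta>"
      using fin[OF s(2)] unfolding trace_U_def exp_real_phase s_def c_def wave_odd_def by (simp add: algebra_simps)
    show "norm (of_real (sqrt (k * \<rho> t)) * trace_V \<rho> \<phi> (of_real k) t - wave_even \<rho> \<phi> k t) \<le> \<delta> \<and>
      norm (of_real (sqrt (k * \<rho> t)) * trace_U \<rho> \<phi> (of_real k) t - of_real (\<rho> t) * wave_odd \<rho> \<phi> k t) \<le> \<delta>"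
      using 1 2 by (rule conjI)
  qed
qed

text \<open>The integrand of \<open>boundary_pairing\<close> with traces replaced by their leading
  terms and with every power of \<rho> gone: the weight \<rho> in front of \<open>wave_odd\<close>
  is absorbed by the normalisation in the next limit.\<close>

definition leading_density :: "real \<Rightarrow> (real \<Rightarrow> real) \<Rightarrow> (real \<Rightarrow> complex) \<Rightarrow> (real \<Rightarrow> complex) \<Rightarrow> real \<Rightarrow> real \<Rightarrow> complex" where
  "leading_density \<sigma> \<rho> \<phi> g k t = wave_odd \<rho> \<phi> k t * wave_even \<rho> g (\<sigma> * k) t
     - of_real \<sigma> * (wave_even \<rho> \<phi> k t * wave_odd \<rho> g (\<sigma> * k) t)"

lemma norm_mult_diff_le:
  fixes a b A B :: complex
  assumes "norm (a - A) \<le> \<delta>" "norm (b - B) \<le> \<delta>" "norm A \<le> H" "norm B \<le> H" "\<delta> \<le> 1"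
  shows "norm (a * b - A * B) \<le> \<delta> * (2 * H + 1)"
proof -
  have d0: "\<delta> \<ge> 0" using assms(1) norm_ge_zero[of "a - A"] by linarith
  have b: "norm b \<le> H + 1"
    using norm_triangle_ineq[of "b - B" B] assms(2,4,5) by simp
  have "norm (a * b - A * B) = norm ((a - A) * b + A * (b - B))"
    by (rule arg_cong[where f=norm]) (simp add: algebra_simps)
  also have "\<dots> \<le> norm (a - A) * norm b + norm A * norm (b - B)"
    using norm_triangle_ineq[of "(a - A) * b" "A * (b - B)"] by (simp only: norm_mult)
  also have "\<dots> \<le> \<delta> * (H + 1) + H * \<delta>"
    using assms b d0 order_trans[OF norm_ge_zero assms(3)] by (intro add_mono mult_mono) auto
  finally show ?thesis by (simp add: algebra_simps)
qed

text \<open>Normalising the two traces in a product costs sqrt (k * \<rho> t) * sqrt (\<sigma> * k *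
  \<rho> t) = sqrt \<sigma> * k * \<rho> t. The factor \<rho> t cancels the one in the asymptotics
  of the flux, and dividing the error by it is harmless since \<rho> is bounded below.\<close>

lemma boundary_pairing_asymptotics:
  assumes \<rho>: "radius_function \<rho>" and "\<sigma> > 0"
    and \<phi>: "\<And>x. (\<phi> has_vector_derivative \<phi>' x) (at x)" and \<phi>': "continuous_on UNIV \<phi>'"
    and g: "\<And>x. (g has_vector_derivative g' x) (at x)" and g': "continuous_on UNIV g'"
  shows "((\<lambda>k. of_real (sqrt \<sigma> * k) * boundary_pairing \<sigma> \<rho> \<phi> g (of_real k)
    - integral {0..2*pi} (leading_density \<sigma> \<rho> \<phi> g k)) \<longlongrightarrow> 0) at_top"
proof -
  note R = radius_functionD[OF \<rho>]
  obtain m where m: "m > 0" "\<And>t. t \<in> {0..2*pi} \<Longrightarrow> m \<le> \<rho> t"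
    using radius_function_lower_bound[OF \<rho>] by blast
  obtain r0 where r0: "r0 \<ge> 0" "\<And>t. t \<in> {0..2*pi} \<Longrightarrow> norm (\<rho> t) \<le> r0"
    using continuous_on_Icc_bounded[OF R(4)] by metis
  have \<phi>c: "continuous_on S \<phi>" and gc: "continuous_on S g" for S
    by (rule continuous_on_vector_derivative[OF has_vector_derivative_at_within[OF \<phi>]]
             continuous_on_vector_derivative[OF has_vector_derivative_at_within[OF g]])+
  obtain H1 where H1: "H1 \<ge> 0" "\<And>x. x \<in> {0..3*pi} \<Longrightarrow> norm (\<phi> x) \<le> H1"
    using continuous_on_Icc_bounded[OF \<phi>c] by metis
  obtain H2 where H2: "H2 \<ge> 0" "\<And>x. x \<in> {0..3*pi} \<Longrightarrow> norm (g x) \<le> H2"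
    using continuous_on_Icc_bounded[OF gc] by metis
  let ?h = "2 * (H1 + H2) * norm phase_const"
  define H where "H = (1 + r0) * ?h"
  have h0: "?h \<ge> 0" using H1 H2 by simp
  have H: "norm (wave_even \<rho> f k t) \<le> H" "norm (of_real (\<rho> t) * wave_odd \<rho> f k t) \<le> H"
    if t: "t \<in> {0..2*pi}" and f: "f = \<phi> \<or> f = g" for f :: "real \<Rightarrow> complex" and t k
  proof -
    let ?P = "f t * phase_const * cis (k * \<rho> t)" and ?M = "f (t + pi) * cnj phase_const * cis (- (k * \<rho> t))"
    have tt: "t \<in> {0..3*pi}" "t + pi \<in> {0..3*pi}"
      using t pi_gt_zero unfolding atLeastAtMost_iff by linarith+
    have "norm (f t) \<le> H1 + H2" "norm (f (t + pi)) \<le> H1 + H2"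
      using f H1(1) H2(1) H1(2)[OF tt(1)] H1(2)[OF tt(2)] H2(2)[OF tt(1)] H2(2)[OF tt(2)] by auto
    then have "norm (f t) * norm phase_const + norm (f (t + pi)) * norm phase_const \<le>
        (H1 + H2) * norm phase_const + (H1 + H2) * norm phase_const"
      by (intro add_mono mult_right_mono) auto
    then have b: "norm ?P + norm ?M \<le> ?h" by (simp add: norm_mult algebra_simps)
    have "norm (wave_even \<rho> f k t) \<le> 1 * ?h"
      using order_trans[OF norm_triangle_ineq b] by (simp add: wave_even_def)
    also have "\<dots> \<le> H" unfolding H_def using h0 r0 by (intro mult_right_mono) auto
    finally show "norm (wave_even \<rho> f k t) \<le> H" .
    have "norm (of_real (\<rho> t) * wave_odd \<rho> f k t) \<le> r0 * ?h"
      unfolding norm_mult[of "of_real (\<rho> t)"] norm_of_real wave_odd_def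
      using r0(1) r0(2)[OF t] order_trans[OF norm_triangle_ineq4 b]
      by (intro mult_mono) auto
    also have "\<dots> \<le> H" unfolding H_def using h0 by (intro mult_right_mono) auto
    finally show "norm (of_real (\<rho> t) * wave_odd \<rho> f k t) \<le> H" .
  qed
  have "H \<ge> 0" unfolding H_def using r0 H1 H2 by simp
  define G where "G k t = trace_U \<rho> \<phi> (of_real k) t * trace_V \<rho> g (of_real \<sigma> * of_real k) t
    - of_real \<sigma> * (trace_V \<rho> \<phi> (of_real k) t * trace_U \<rho> g (of_real \<sigma> * of_real k) t)" for k t
  have Gc: "continuous_on S (G k)" for S k
    unfolding G_def by (intro continuous_intros trace_continuous[OF \<rho>] \<phi>c gc)
  have shift: "continuous_on S (\<lambda>t. f (t + pi))" if "continuous_on UNIV f" for f :: "real \<Rightarrow> complex" and S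
    by (intro continuous_on_compose2[OF that] continuous_intros) auto
  have Lc: "continuous_on S (leading_density \<sigma> \<rho> \<phi> g k)" for S k
    unfolding leading_density_def wave_even_def wave_odd_def by (intro continuous_intros \<phi>c gc shift R)
  show ?thesis
  proof (rule tendstoI)
    fix e :: real assume "e > 0"
    define C where "C = (1 + \<sigma>) * (2 * H + 1) / m * (2 * pi)"
    have "C > 0" unfolding C_def using \<open>\<sigma> > 0\<close> \<open>H \<ge> 0\<close> m(1) by (intro mult_pos_pos divide_pos_pos) auto
    define \<delta> where "\<delta> = min 1 (e / (2 * C))"
    have \<delta>: "\<delta> > 0" "\<delta> \<le> 1" "\<delta> * C < e"
    proof -
      show "\<delta> > 0" "\<delta> \<le> 1" unfolding \<delta>_def using \<open>e > 0\<close> \<open>C > 0\<close> by auto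
      have "\<delta> * C \<le> e / (2 * C) * C" unfolding \<delta>_def using \<open>C > 0\<close> by (intro mult_right_mono) auto
      also have "\<dots> = e / 2" using \<open>C > 0\<close> by simp
      finally show "\<delta> * C < e" using \<open>e > 0\<close> by simp
    qed
    have "filterlim (\<lambda>k. \<sigma> * k) at_top at_top"
      by (rule filterlim_tendsto_pos_mult_at_top[OF tendsto_const \<open>\<sigma> > 0\<close> filterlim_ident])
    from eventually_compose_filterlim[OF trace_asymptotics[OF \<rho> \<delta>(1) g g'] this] trace_asymptotics[OF \<rho> \<delta>(1) \<phi> \<phi>'] eventually_gt_at_top[of 0]
    show "\<forall>\<^sub>F k in at_top. dist (of_real (sqrt \<sigma> * k) * boundary_pairing \<sigma> \<rho> \<phi> g (of_real k) - integral {0..2*pi} (leading_density \<sigma> \<rho> \<phi> g k)) 0 < e"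
    proof eventually_elim
      case (elim k)
      let ?X = "\<lambda>t. complex_of_real (sqrt \<sigma> * k) * G k t - leading_density \<sigma> \<rho> \<phi> g k t"
      have bnd: "norm (?X t) \<le> (1 + \<sigma>) * (2 * H + 1) / m * \<delta>"
        if t: "t \<in> {0..2*pi}" for t
      proof -
        define E where "E = wave_even \<rho> \<phi> k t"
        define D where "D = complex_of_real (\<rho> t) * wave_odd \<rho> \<phi> k t"
        define E' where "E' = wave_even \<rho> g (\<sigma> * k) t"
        define D' where "D' = complex_of_real (\<rho> t) * wave_odd \<rho> g (\<sigma> * k) t"
        define a where "a = of_real (sqrt (k * \<rho> t)) * trace_U \<rho> \<phi> (of_real k) t"
        define b where "b = of_real (sqrt (\<sigma> * k * \<rho> t)) * trace_V \<rho> g (of_real \<sigma> * of_real k) t"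
        define a' where "a' = of_real (sqrt (k * \<rho> t)) * trace_V \<rho> \<phi> (of_real k) t"
        define b' where "b' = of_real (sqrt (\<sigma> * k * \<rho> t)) * trace_U \<rho> g (of_real \<sigma> * of_real k) t"
        let ?r = "complex_of_real (\<rho> t)"
        have bd: "norm (a - D) \<le> \<delta>" "norm (a' - E) \<le> \<delta>" "norm (b - E') \<le> \<delta>" "norm (b' - D') \<le> \<delta>"
          using elim(1)[rule_format, OF t] elim(2)[rule_format, OF t]
          unfolding a_def b_def a'_def b'_def D_def E_def D'_def E'_def of_real_mult by blast+
        have hb: "norm D \<le> H" "norm E \<le> H" "norm E' \<le> H" "norm D' \<le> H"
          unfolding D_def E_def D'_def E'_def using H[OF t] by blast+
        have 1: "norm (a * b - D * E') \<le> \<delta> * (2 * H + 1)"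
          by (rule norm_mult_diff_le[OF bd(1,3) hb(1,3) \<delta>(2)])
        have 2: "norm (a' * b' - E * D') \<le> \<delta> * (2 * H + 1)"
          by (rule norm_mult_diff_le[OF bd(2,4) hb(2,4) \<delta>(2)])
        have sq: "sqrt (k * \<rho> t) * sqrt (\<sigma> * k * \<rho> t) = sqrt \<sigma> * k * \<rho> t"
        proof -
          have "sqrt (k * \<rho> t) * sqrt (\<sigma> * k * \<rho> t) = sqrt (\<sigma> * (k * \<rho> t)\<^sup>2)"
            by (simp add: real_sqrt_mult[symmetric] power2_eq_square mult_ac)
          also have "\<dots> = sqrt \<sigma> * (k * \<rho> t)"
            using elim(3) R(1)[of t] unfolding real_sqrt_mult by simp
          finally show ?thesis by simp
        qed
        have e1: "a * b - of_real \<sigma> * (a' * b') = ?r * (of_real (sqrt \<sigma> * k) * G k t)"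
        proof -
          have "a * b - of_real \<sigma> * (a' * b') = of_real (sqrt (k * \<rho> t) * sqrt (\<sigma> * k * \<rho> t)) * G k t"
            unfolding a_def b_def a'_def b'_def G_def of_real_mult[of "sqrt (k * \<rho> t)"] by (simp add: algebra_simps del: of_real_mult)
          then show ?thesis unfolding sq by (simp add: mult_ac)
        qed
        have e2: "?r * leading_density \<sigma> \<rho> \<phi> g k t = D * E' - of_real \<sigma> * (E * D')"
          unfolding leading_density_def D_def E_def D'_def E'_def by (simp add: algebra_simps)
        have e3: "?r * ?X t = (a * b - D * E') - of_real \<sigma> * (a' * b' - E * D')"
          unfolding right_diff_distrib e1[symmetric] e2 by simp
        have "\<rho> t * norm (?X t)
           = norm (?r * ?X t)"
          using R(1)[of t] unfolding norm_mult[of ?r] norm_of_real by simp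
        also have "\<dots> \<le> norm (a * b - D * E') + norm (of_real \<sigma> * (a' * b' - E * D'))"
          unfolding e3 by (rule norm_triangle_ineq4)
        also have "\<dots> \<le> \<delta> * (2 * H + 1) + \<sigma> * (\<delta> * (2 * H + 1))"
          using 1 2 \<open>\<sigma> > 0\<close> unfolding norm_mult[of "of_real \<sigma>"] norm_of_real by (intro add_mono mult_mono) auto
        finally have *: "\<rho> t * norm (?X t) \<le> (1 + \<sigma>) * (2 * H + 1) * \<delta>"
          by (simp add: algebra_simps)
        have "m * norm (?X t) \<le> (1 + \<sigma>) * (2 * H + 1) * \<delta>"
          using mult_right_mono[OF m(2)[OF t] norm_ge_zero] * order_trans by blast
        then show ?thesis using m(1) by (simp add: field_simps)
      qed
      have "of_real (sqrt \<sigma> * k) * boundary_pairing \<sigma> \<rho> \<phi> g (of_real k) - integral {0..2*pi} (leading_density \<sigma> \<rho> \<phi> g k)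
        = integral {0..2*pi} (\<lambda>t. of_real (sqrt \<sigma> * k) * G k t) - integral {0..2*pi} (\<lambda>t. leading_density \<sigma> \<rho> \<phi> g k t)"
        unfolding boundary_pairing_def G_def integral_mult_right ..
      also have "\<dots> = integral {0..2*pi} ?X"
        by (intro integral_diff[symmetric] integrable_continuous_real continuous_intros Gc Lc)
      finally have eq: "of_real (sqrt \<sigma> * k) * boundary_pairing \<sigma> \<rho> \<phi> g (of_real k) - integral {0..2*pi} (leading_density \<sigma> \<rho> \<phi> g k) = \<dots>" .
      have "norm (integral {0..2*pi} ?X)
          \<le> (1 + \<sigma>) * (2 * H + 1) / m * \<delta> * (2 * pi - 0)"
        using bnd by (intro integral_bound continuous_intros Gc Lc) auto
      also have "\<dots> = \<delta> * C" by (simp add: C_def)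
      finally show ?case unfolding eq using \<delta>(3) by simp
    qed
  qed
qed

section \<open>Localisation on the arcs of constant radius\<close>

text \<open>Reverse triangle inequality: the norms of the two terms do not depend on n, whatever the
  phases do.\<close>

lemma norm_eq_if_phase_difference_tendsto_0:
  fixes A B :: complex
  assumes "(\<lambda>n. A * cis (f n) - B * cis (g n)) \<longlonglongrightarrow> 0"
  shows "norm A = norm B"
proof -
  have "(\<lambda>n::nat. \<bar>norm A - norm B\<bar>) \<longlonglongrightarrow> 0"
  proof (rule Lim_null_comparison[OF _ tendsto_norm_zero[OF assms]])
    show "\<forall>\<^sub>F n in sequentially. norm \<bar>norm A - norm B\<bar> \<le> norm (A * cis (f n) - B * cis (g n))"
      using norm_triangle_ineq3[of "A * cis (f n)" "B * cis (g n)" for n] by (simp add: norm_mult)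
  qed
  then show ?thesis by (simp add: LIMSEQ_const_iff)
qed

text \<open>Multiplying out gives four phases. Products of equal orientation carry 1 - \<sigma>,
  because both halves of \<open>leading_density\<close> have the same sign there; mixed products
  carry 1 + \<sigma>, the odd wave changing sides between the halves.\<close>

lemma integral_leading_density:
  assumes \<rho>: "radius_function \<rho>" and \<phi>: "continuous_on UNIV \<phi>" and g: "continuous_on UNIV g"
  shows "integral {0..2*pi} (leading_density \<sigma> \<rho> \<phi> g k) =
      (1 - of_real \<sigma>) * phase_const\<^sup>2 * integral {0..2*pi} (\<lambda>t. (\<phi> t * g t) * cis (k * ((1 + \<sigma>) * \<rho> t)))
    + (1 + of_real \<sigma>) * (phase_const * cnj phase_const) * integral {0..2*pi} (\<lambda>t. (\<phi> t * g (t + pi)) * cis (k * ((1 - \<sigma>) * \<rho> t)))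
    - (1 + of_real \<sigma>) * (phase_const * cnj phase_const) * integral {0..2*pi} (\<lambda>t. (\<phi> (t + pi) * g t) * cis (k * ((\<sigma> - 1) * \<rho> t)))
    - (1 - of_real \<sigma>) * (cnj phase_const)\<^sup>2 * integral {0..2*pi} (\<lambda>t. (\<phi> (t + pi) * g (t + pi)) * cis (k * (- (1 + \<sigma>) * \<rho> t)))"
    (is "_ = ?A * integral _ ?a + ?B * integral _ ?b - ?B * integral _ ?c - ?D * integral _ ?d")
proof -
  have R: "continuous_on S \<rho>" for S using radius_functionD[OF \<rho>] by blast
  have c: "continuous_on S \<phi>" "continuous_on S g" "continuous_on S (\<lambda>t. \<phi> (t + pi))" "continuous_on S (\<lambda>t. g (t + pi))" for S
    by (intro continuous_on_compose2[OF \<phi>] continuous_on_compose2[OF g] continuous_intros; simp)+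
  have i: "?a integrable_on {0..2*pi}" "?b integrable_on {0..2*pi}" "?c integrable_on {0..2*pi}" "?d integrable_on {0..2*pi}"
    by (intro integrable_continuous_real continuous_intros c R)+
  note m = integrable_on_mult_right[OF i(1), of ?A] integrable_on_mult_right[OF i(2), of ?B]
    integrable_on_mult_right[OF i(3), of ?B] integrable_on_mult_right[OF i(4), of ?D]
  have "leading_density \<sigma> \<rho> \<phi> g k t = ?A * ?a t + ?B * ?b t - ?B * ?c t - ?D * ?d t" for t
  proof -
    have 1: "cis (k * \<rho> t) * cis (\<sigma> * k * \<rho> t) = cis (k * ((1 + \<sigma>) * \<rho> t))"
      "cis (k * \<rho> t) * cis (- (\<sigma> * k * \<rho> t)) = cis (k * ((1 - \<sigma>) * \<rho> t))"
      "cis (- (k * \<rho> t)) * cis (\<sigma> * k * \<rho> t) = cis (k * ((\<sigma> - 1) * \<rho> t))"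
      "cis (- (k * \<rho> t)) * cis (- (\<sigma> * k * \<rho> t)) = cis (k * (- (1 + \<sigma>) * \<rho> t))"
      unfolding cis_mult by (rule arg_cong[where f=cis]; simp add: algebra_simps)+
    show ?thesis
      unfolding 1[symmetric] leading_density_def wave_even_def wave_odd_def by (simp add: algebra_simps power2_eq_square)
  qed
  then have "leading_density \<sigma> \<rho> \<phi> g k = (\<lambda>t. ?A * ?a t + ?B * ?b t - ?B * ?c t - ?D * ?d t)"
    by (rule ext)
  then have "integral {0..2*pi} (leading_density \<sigma> \<rho> \<phi> g k) = integral {0..2*pi} (\<lambda>t. ?A * ?a t + ?B * ?b t - ?B * ?c t - ?D * ?d t)"
    by (rule arg_cong)
  also have "\<dots> = integral {0..2*pi} (\<lambda>t. ?A * ?a t) + integral {0..2*pi} (\<lambda>t. ?B * ?b t) - integral {0..2*pi} (\<lambda>t. ?B * ?c t) - integral {0..2*pi} (\<lambda>t. ?D * ?d t)"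
    by (simp only: integral_diff[OF integrable_diff[OF integrable_add[OF m(1,2)] m(3)] m(4)]
        integral_diff[OF integrable_add[OF m(1,2)] m(3)] integral_add[OF m(1,2)])
  finally show ?thesis by (simp only: integral_mult_right)
qed

text \<open>Where \<eta> is nonzero the radius is frozen at \<open>R\<close>, so the surviving terms
  are the two moments times pure phases. \<open>zero\<close> is assumed for every periodic g because
  two densities are tested, \<eta> and its translate by pi.\<close>

lemma localized_moments_vanish:
  assumes \<rho>: "radius_function \<rho>" and \<sigma>: "\<sigma> > 1" and ks: "filterlim ks at_top sequentially"
    and \<phi>: "\<And>x. (\<phi> has_vector_derivative \<phi>' x) (at x)" "continuous_on UNIV \<phi>'"
    and zero: "\<And>g n. continuous_on UNIV g \<Longrightarrow> (\<And>t. g (t + 2 * pi) = g t) \<Longrightarrow> boundary_pairing \<sigma> \<rho> \<phi> g (of_real (ks n)) = 0"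
    and \<eta>: "\<And>x. (\<eta> has_vector_derivative \<eta>' x) (at x)" "continuous_on UNIV \<eta>'" "\<And>t. \<eta> (t + 2 * pi) = \<eta> t"
    and supp: "\<And>t. \<eta> t \<noteq> 0 \<Longrightarrow> \<rho> t = R"
    and ae: "AE t in lborel. t \<in> {0..2*pi} \<longrightarrow> \<eta> (t + pi) = 0 \<or> deriv \<rho> t \<noteq> 0"
  shows "integral {0..2*pi} (\<lambda>t. \<phi> t * \<eta> t) = 0" "integral {0..2*pi} (\<lambda>t. \<phi> (t + pi) * \<eta> t) = 0"
proof -
  obtain \<rho>2 where \<rho>2: "\<And>t. (deriv \<rho> has_real_derivative \<rho>2 t) (at t)" "continuous_on UNIV \<rho>2"
    using radius_function_second_derivE[OF \<rho>] by blast
  note R = radius_functionD[OF \<rho>]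
  have cont: "continuous_on UNIV f" if "\<And>x. (f has_vector_derivative f' x) (at x)" for f f' :: "real \<Rightarrow> complex"
    by (rule continuous_on_vector_derivative[OF has_vector_derivative_at_within[OF that]])
  note \<phi>c = cont[OF \<phi>(1)] and \<eta>c = cont[OF \<eta>(1)]
  have shc: "continuous_on UNIV (\<lambda>t. f (t + pi))" if "continuous_on UNIV f" for f :: "real \<Rightarrow> complex"
    by (intro continuous_on_compose2[OF that] continuous_intros) simp
  note \<phi>s = has_vector_derivative_shift[OF \<phi>(1), of pi] and \<eta>s = has_vector_derivative_shift[OF \<eta>(1), of pi]
  have lead: "(\<lambda>n. integral {0..2*pi} (leading_density \<sigma> \<rho> \<phi> g (ks n))) \<longlonglongrightarrow> 0"
    if "\<And>x. (g has_vector_derivative g' x) (at x)" "continuous_on UNIV g'" "\<And>t. g (t + 2 * pi) = g t" for g g'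
  proof -
    have "(\<lambda>n. of_real (sqrt \<sigma> * ks n) * boundary_pairing \<sigma> \<rho> \<phi> g (of_real (ks n)) - integral {0..2*pi} (leading_density \<sigma> \<rho> \<phi> g (ks n))) \<longlonglongrightarrow> 0"
      by (rule filterlim_compose[OF boundary_pairing_asymptotics[OF \<rho> _ \<phi> that(1,2)] ks]) (use \<sigma> in simp)
    then have "(\<lambda>n. - integral {0..2*pi} (leading_density \<sigma> \<rho> \<phi> g (ks n))) \<longlonglongrightarrow> 0"
      unfolding zero[OF cont[OF that(1)] that(3)] by simp
    from tendsto_minus[OF this] show ?thesis by simp
  qed
  \<comment> \<open>This disposes of all terms with \<open>\<eta> (t + pi)\<close>. The values of
    \<tau> in use are 1 + \<sigma>, 1 - \<sigma> and their negatives, nonzero because \<sigma> >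
    1.\<close>
  have RL: "(\<lambda>n. integral {0..2*pi} (\<lambda>t. (f t * \<eta> (t + pi)) * cis (ks n * (\<tau> * \<rho> t)))) \<longlonglongrightarrow> 0"
    if f: "\<And>x. (f has_vector_derivative f' x) (at x)" "continuous_on UNIV f'" and "\<tau> \<noteq> 0" for f f' \<tau>
  proof (rule filterlim_compose[OF _ ks], rule oscillatory_integral_tendsto_0)
    show "((\<lambda>t. f t * \<eta> (t + pi)) has_vector_derivative f x * \<eta>' (x + pi) + f' x * \<eta> (x + pi)) (at x)" for x
      by (intro has_vector_derivative_mult f \<eta>s)
    show "continuous_on UNIV (\<lambda>x. f x * \<eta>' (x + pi) + f' x * \<eta> (x + pi))"
      by (intro continuous_intros f shc \<eta>c \<eta>(2) cont[OF f(1)])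
    show "((\<lambda>t. \<tau> * \<rho> t) has_real_derivative \<tau> * deriv \<rho> x) (at x)" for x
      by (rule DERIV_cmult[OF R(3)])
    show "((\<lambda>t. \<tau> * deriv \<rho> t) has_real_derivative \<tau> * \<rho>2 x) (at x)" for x
      by (rule DERIV_cmult[OF \<rho>2(1)])
    show "continuous_on UNIV (\<lambda>x. \<tau> * \<rho>2 x)" by (intro continuous_intros \<rho>2)
    show "AE x in lborel. x \<in> {0..2*pi} \<longrightarrow> f x * \<eta> (x + pi) = 0 \<or> \<tau> * deriv \<rho> x \<noteq> 0"
      using ae by eventually_elim (use \<open>\<tau> \<noteq> 0\<close> in auto)
  qed simp
  define a where "a = integral {0..2*pi} (\<lambda>t. \<phi> t * \<eta> t)"
  define b where "b = integral {0..2*pi} (\<lambda>t. \<phi> (t + pi) * \<eta> t)"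
  have const: "integral {0..2*pi} (\<lambda>t. (f t * \<eta> t) * cis (k * (\<tau> * \<rho> t))) = integral {0..2*pi} (\<lambda>t. f t * \<eta> t) * cis (k * (\<tau> * R))" for f k \<tau>
  proof -
    have "(f t * \<eta> t) * cis (k * (\<tau> * \<rho> t)) = (f t * \<eta> t) * cis (k * (\<tau> * R))" for t
      using supp[of t] by (cases "\<eta> t = 0") auto
    then show ?thesis by (simp only: integral_mult_left)
  qed
  define B where "B = phase_const * cnj phase_const"
  have normB: "norm B = (norm phase_const)\<^sup>2" by (simp add: B_def norm_mult power2_eq_square)
  have norms: "norm (1 - complex_of_real \<sigma>) = \<sigma> - 1" "norm (1 + complex_of_real \<sigma>) = 1 + \<sigma>"
  proof -
    have "1 - complex_of_real \<sigma> = of_real (1 - \<sigma>)" "1 + complex_of_real \<sigma> = of_real (1 + \<sigma>)" by simp_all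
    then show "norm (1 - complex_of_real \<sigma>) = \<sigma> - 1" "norm (1 + complex_of_real \<sigma>) = 1 + \<sigma>"
      using \<sigma> by (simp_all only: norm_of_real)
  qed
  have n0: "(norm phase_const)\<^sup>2 > 0" using phase_const_nonzero by simp

  have "norm ((1 - of_real \<sigma>) * phase_const\<^sup>2 * a) = norm ((1 + of_real \<sigma>) * B * b)"
  proof (rule norm_eq_if_phase_difference_tendsto_0)
    let ?b = "\<lambda>n. integral {0..2*pi} (\<lambda>t. (\<phi> t * \<eta> (t + pi)) * cis (ks n * ((1 - \<sigma>) * \<rho> t)))"
    let ?d = "\<lambda>n. integral {0..2*pi} (\<lambda>t. (\<phi> (t + pi) * \<eta> (t + pi)) * cis (ks n * (- (1 + \<sigma>) * \<rho> t)))"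
    have "(\<lambda>n. integral {0..2*pi} (leading_density \<sigma> \<rho> \<phi> \<eta> (ks n)) - (1 + of_real \<sigma>) * B * ?b n + (1 - of_real \<sigma>) * (cnj phase_const)\<^sup>2 * ?d n)
       \<longlonglongrightarrow> 0 - (1 + of_real \<sigma>) * B * 0 + (1 - of_real \<sigma>) * (cnj phase_const)\<^sup>2 * 0"
      by (intro tendsto_add tendsto_diff tendsto_mult_left lead[OF \<eta>] RL[OF \<phi>] RL[OF \<phi>s shc[OF \<phi>(2)]]) (use \<sigma> in auto)
    then show "(\<lambda>n. (1 - of_real \<sigma>) * phase_const\<^sup>2 * a * cis (ks n * ((1 + \<sigma>) * R)) - (1 + of_real \<sigma>) * B * b * cis (ks n * ((\<sigma> - 1) * R))) \<longlonglongrightarrow> 0"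
      unfolding integral_leading_density[OF \<rho> \<phi>c \<eta>c] const a_def[symmetric] b_def[symmetric] B_def[symmetric]
      by (simp add: algebra_simps)
  qed
  then have 1: "(\<sigma> - 1) * norm a = (1 + \<sigma>) * norm b"
    using n0 unfolding norm_mult norms normB norm_power by simp
  \<comment> \<open>Now \<open>g (t + pi) = \<eta> t\<close> by periodicity, so the two groups of
    terms change roles: those with \<open>g t\<close> oscillate away, and the moments return with
    interchanged coefficients.\<close>
  define g where "g t = \<eta> (t + pi)" for t
  have g: "(g has_vector_derivative \<eta>' (x + pi)) (at x)" "g (x + 2 * pi) = g x" "g (x + pi) = \<eta> x" for x
  proof -
    show "(g has_vector_derivative \<eta>' (x + pi)) (at x)" unfolding g_def by (rule \<eta>s)
    show "g (x + 2 * pi) = g x" using \<eta>(3)[of "x + pi"] by (simp add: g_def algebra_simps)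
    show "g (x + pi) = \<eta> x" using \<eta>(3)[of x] by (simp add: g_def algebra_simps)
  qed
  have "norm ((1 + of_real \<sigma>) * B * a) = norm ((1 - of_real \<sigma>) * (cnj phase_const)\<^sup>2 * b)"
  proof (rule norm_eq_if_phase_difference_tendsto_0)
    let ?a = "\<lambda>n. integral {0..2*pi} (\<lambda>t. (\<phi> t * \<eta> (t + pi)) * cis (ks n * ((1 + \<sigma>) * \<rho> t)))"
    let ?c = "\<lambda>n. integral {0..2*pi} (\<lambda>t. (\<phi> (t + pi) * \<eta> (t + pi)) * cis (ks n * ((\<sigma> - 1) * \<rho> t)))"
    have "(\<lambda>n. integral {0..2*pi} (leading_density \<sigma> \<rho> \<phi> g (ks n)) - (1 - of_real \<sigma>) * phase_const\<^sup>2 * ?a n + (1 + of_real \<sigma>) * B * ?c n)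
       \<longlonglongrightarrow> 0 - (1 - of_real \<sigma>) * phase_const\<^sup>2 * 0 + (1 + of_real \<sigma>) * B * 0"
      by (intro tendsto_add tendsto_diff tendsto_mult_left lead[OF g(1) shc[OF \<eta>(2)] g(2)] RL[OF \<phi>] RL[OF \<phi>s shc[OF \<phi>(2)]]) (use \<sigma> in auto)
    then show "(\<lambda>n. (1 + of_real \<sigma>) * B * a * cis (ks n * ((1 - \<sigma>) * R)) - (1 - of_real \<sigma>) * (cnj phase_const)\<^sup>2 * b * cis (ks n * (- (1 + \<sigma>) * R))) \<longlonglongrightarrow> 0"
      unfolding integral_leading_density[OF \<rho> \<phi>c cont[OF g(1)]] g(3) const a_def[symmetric] b_def[symmetric] B_def[symmetric]
      unfolding g_def by (simp add: algebra_simps)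
  qed
  then have 2: "(1 + \<sigma>) * norm a = (\<sigma> - 1) * norm b"
    using n0 unfolding norm_mult norms normB norm_power complex_mod_cnj by simp
  \<comment> \<open>Combining the relations gives ((1 + \<sigma>)^2 - (\<sigma> - 1)^2) * norm a =
    0, and the bracket is 4 \<sigma>.\<close>
  have "(1 + \<sigma>) * ((1 + \<sigma>) * norm a) = (\<sigma> - 1) * ((\<sigma> - 1) * norm a)"
    unfolding 1 2 by simp
  then have "4 * \<sigma> * norm a = 0" by (simp add: algebra_simps)
  then have "norm a = 0" using \<sigma> by simp
  moreover have "norm b = 0" using 1 \<open>norm a = 0\<close> \<sigma> by simp
  ultimately show "integral {0..2*pi} (\<lambda>t. \<phi> t * \<eta> t) = 0" "integral {0..2*pi} (\<lambda>t. \<phi> (t + pi) * \<eta> t) = 0"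
    by (simp_all add: a_def b_def)
qed

text \<open>A bounded infinite \<open>K\<close> has an accumulation point, possibly 0 or outside
  \<open>K\<close>; the functions are entire, so the identity theorem makes them all vanish and ks n
  = n serves. An unbounded \<open>K\<close> contains arbitrarily large elements because it is
  positive. In both cases the sequence is independent of f.\<close>

lemma infinite_zeros_imp_unbounded_zeros:
  fixes K :: "real set"
  assumes "infinite K" and pos: "\<And>k. k \<in> K \<Longrightarrow> k > 0"
    and zero: "\<And>f k. f \<in> F \<Longrightarrow> k \<in> K \<Longrightarrow> f (complex_of_real k) = 0"
    and hol: "\<And>f. f \<in> F \<Longrightarrow> f holomorphic_on UNIV"
  obtains ks :: "nat \<Rightarrow> real" where "filterlim ks at_top sequentially" "\<And>f n. f \<in> F \<Longrightarrow> f (complex_of_real (ks n)) = 0"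
proof (cases "bounded K")
  case True
  define U where "U = complex_of_real ` K"
  have "infinite U" using assms(1) unfolding U_def by (subst finite_image_iff) (auto simp: inj_on_def)
  moreover have "compact (closure U)"
    using True unfolding U_def compact_closure by (intro bounded_linear_image bounded_linear_of_real)
  ultimately obtain \<xi> where \<xi>: "\<xi> islimpt U"
    using closure_subset[of U] unfolding compact_eq_Bolzano_Weierstrass by blast
  have "f w = 0" if "f \<in> F" for f w
    by (rule analytic_continuation[OF hol[OF that] open_UNIV connected_UNIV subset_UNIV UNIV_I \<xi> _ UNIV_I])
       (use zero[OF that] in \<open>auto simp: U_def\<close>)
  then show ?thesis by (intro that[OF filterlim_real_sequentially]) auto
next
  case False
  have "\<exists>k\<in>K. real n \<le> k" for n
  proof (rule ccontr)
    assume "\<not> (\<exists>k\<in>K. real n \<le> k)"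
    then have "K \<subseteq> {0..real n}" using pos by (force simp: not_le)
    then show False using False bounded_closed_interval bounded_subset by blast
  qed
  then obtain ks where ks: "\<And>n. ks n \<in> K" "\<And>n. real n \<le> ks n" by metis
  show ?thesis
  proof (rule that)
    show "filterlim ks at_top sequentially"
      by (rule filterlim_at_top_mono[OF filterlim_real_sequentially]) (auto simp: ks)
  qed (use zero ks in auto)
qed

text \<open>The bump of the final proof is a function of cos (t - t0), hence periodic by
  construction; this translates its non-vanishing back into distance from t0 modulo 2 pi.\<close>

lemma cos_gt_imp_near_period:
  assumes "cos (t - t0) > cos e" "0 < e" "e < pi"
  obtains n :: int where "\<bar>t - 2 * pi * of_int n - t0\<bar> < e"
proof -
  define n where "n = round ((t - t0) / (2 * pi))"
  define y where "y = t - 2 * pi * of_int n - t0"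
  have "\<bar>(t - t0) / (2 * pi) - of_int n\<bar> \<le> 1 / 2"
    unfolding n_def by (metis abs_minus_commute of_int_round_abs_le)
  moreover have "(t - t0) / (2 * pi) - of_int n = y / (2 * pi)"
    unfolding y_def by (simp add: field_simps)
  ultimately have y: "\<bar>y\<bar> \<le> pi" by (simp add: abs_divide divide_le_eq)
  have "t - t0 = y + 2 * pi * of_int n" by (simp add: y_def)
  moreover have "sin (y + 2 * pi * of_int n) = sin y \<and> cos (y + 2 * pi * of_int n) = cos y"
    unfolding sin_cos_eq_iff by (intro exI[of _ n]) simp
  ultimately have "cos (t - t0) = cos \<bar>y\<bar>" by (simp add: cos_abs_real)
  then have "\<bar>y\<bar> < e" using assms y cos_mono_less_eq[of "\<bar>y\<bar>" e] cos_mono_less_eq[of e "\<bar>y\<bar>"] by auto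
  then show ?thesis using that[of n] by (simp add: y_def)
qed

text \<open>The integrand is b times the squared modulus of f, continuous and nonnegative, so a zero
  integral forces it to vanish at every point.\<close>

lemma integral_norm_square_eq_0D:
  fixes f :: "real \<Rightarrow> complex" and b :: "real \<Rightarrow> real"
  assumes "integral {c..d} (\<lambda>t. f t * (of_real (b t) * cnj (f t))) = 0"
    and f: "continuous_on UNIV f" and b: "continuous_on UNIV b" "\<And>t. b t \<ge> 0"
    and x: "x \<in> {c..d}" "c < d" "b x > 0"
  shows "f x = 0"
proof -
  have cont: "continuous_on {c..d} (\<lambda>t. b t * (norm (f t))\<^sup>2)"
    by (intro continuous_intros continuous_on_subset[OF f] continuous_on_subset[OF b(1)]) auto
  then have hi: "((\<lambda>t. b t * (norm (f t))\<^sup>2) has_integral integral {c..d} (\<lambda>t. b t * (norm (f t))\<^sup>2)) {c..d}"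
    by (intro integrable_integral integrable_continuous_real)
  have hi': "((\<lambda>t. complex_of_real (b t * (norm (f t))\<^sup>2)) has_integral of_real (integral {c..d} (\<lambda>t. b t * (norm (f t))\<^sup>2))) {c..d}"
    using hi by (rule has_integral_of_real)
  have pt: "f t * (of_real (b t) * cnj (f t)) = of_real (b t * (norm (f t))\<^sup>2)" for t
    using complex_norm_square[of "f t"] by (simp add: mult_ac)
  have "complex_of_real (integral {c..d} (\<lambda>t. b t * (norm (f t))\<^sup>2)) = 0"
    using assms(1) unfolding pt integral_unique[OF hi'] .
  then have "((\<lambda>t. b t * (norm (f t))\<^sup>2) has_integral 0) (cbox c d)"
    using hi by simp
  from has_integral_0_cbox_imp_0[OF _ _ this, of x]
  have "b x * (norm (f x))\<^sup>2 = 0"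
    using cont b(2) x by (auto simp: box_real)
  then show ?thesis using x(3) by simp
qed

theorem theorem4:
  fixes q :: real and \<rho> :: "real \<Rightarrow> real" and N :: "real set" and \<phi> :: "real \<Rightarrow> complex"
  assumes "q > 1"
    and "radius_function \<rho>"
    and "admissible q \<rho>"
    and "N \<subseteq> {0..<2*pi}"
    and "open (circ_lift N)"
    and "measure lborel N = pi"
    and "closure (circ_lift N \<union> (\<lambda>t. t + pi) ` circ_lift N) = UNIV"
    and "\<forall>t\<in>N. deriv \<rho> t = 0"
    and "AE t in lborel. t \<in> circ_shift_pi N \<longrightarrow> deriv \<rho> t \<noteq> 0"
    and "periodic2pi \<phi>"
    and "\<phi> C1_differentiable_on UNIV"
    and "\<exists>t. \<phi> t \<noteq> 0"
  shows "finite {k::real. k > 0 \<and> non_scattering q \<rho> k (herglotz k \<phi>)}"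
proof (rule ccontr)
  assume inf: "infinite {k::real. k > 0 \<and> non_scattering q \<rho> k (herglotz k \<phi>)}"
  define \<sigma> where "\<sigma> = sqrt q"
  have \<sigma>: "\<sigma> > 1" using \<open>q > 1\<close> by (simp add: \<sigma>_def)
  note \<rho> = \<open>radius_function \<rho>\<close>
  note R = radius_functionD[OF \<rho>]
  obtain \<phi>' where \<phi>: "\<And>x. (\<phi> has_vector_derivative \<phi>' x) (at x)" "continuous_on UNIV \<phi>'"
    using \<open>\<phi> C1_differentiable_on UNIV\<close> unfolding C1_differentiable_on_def by auto
  have per: "\<phi> (t + 2 * pi) = \<phi> t" for t
    using \<open>periodic2pi \<phi>\<close> by (simp add: periodic2pi_def)
  have \<phi>c: "continuous_on UNIV \<phi>"
    by (rule continuous_on_vector_derivative[OF has_vector_derivative_at_within[OF \<phi>(1)]])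
  \<comment> \<open>Taking all periodic test densities at once fixes \<open>ks\<close> before the
    bump, which depends on the point t0.\<close>
  define F where "F = {boundary_pairing \<sigma> \<rho> \<phi> g |g. continuous_on UNIV g \<and> (\<forall>t. g (t + 2 * pi) = g t)}"
  obtain ks where ks: "filterlim ks at_top sequentially" "\<And>f n. f \<in> F \<Longrightarrow> f (complex_of_real (ks n)) = 0"
  proof (rule infinite_zeros_imp_unbounded_zeros[OF inf, of F])
    show "f (complex_of_real k) = 0" if "f \<in> F" "k \<in> {k. k > 0 \<and> non_scattering q \<rho> k (herglotz k \<phi>)}" for f k
      using that \<open>q > 1\<close> non_scattering_boundary_pairing[OF \<rho> _ _ \<phi>c per, of q k] unfolding F_def \<sigma>_def by auto
    show "f holomorphic_on UNIV" if "f \<in> F" for f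
      using that boundary_pairing_holomorphic[OF \<rho> \<phi>c] unfolding F_def by auto
  qed auto
  have zero: "boundary_pairing \<sigma> \<rho> \<phi> g (of_real (ks n)) = 0" if "continuous_on UNIV g" "\<And>t. g (t + 2 * pi) = g t" for g n
    using ks(2) that unfolding F_def by blast
  have main: "\<phi> t0 = 0 \<and> \<phi> (t0 + pi) = 0" if "t0 \<in> N" for t0
  proof -
    have t0: "t0 \<in> {0..2*pi}" "t0 \<in> circ_lift N"
      using that \<open>N \<subseteq> {0..<2*pi}\<close> by (auto simp: circ_lift_def intro!: exI[of _ 0])
    obtain e0 where e0: "e0 > 0" "ball t0 e0 \<subseteq> circ_lift N"
      using \<open>open (circ_lift N)\<close> t0(2) open_contains_ball by blast
    \<comment> \<open>The cap 1 < pi keeps e in the range where the cosine decreases.\<close>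
    define e where "e = min e0 1"
    have e: "e > 0" "e < pi" "ball t0 e \<subseteq> circ_lift N"
      using e0 pi_gt3 by (auto simp: e_def)
    have d0: "deriv \<rho> t = 0" if tN: "t \<in> circ_lift N" for t
    proof -
      obtain n :: int where n: "t - 2 * pi * of_int n \<in> N" using tN unfolding circ_lift_def by blast
      have "((\<lambda>s. \<rho> (s + - (2 * pi * of_int n))) has_real_derivative 0) (at t)"
        using R(3)[of "t - 2 * pi * of_int n"] \<open>\<forall>t\<in>N. deriv \<rho> t = 0\<close> n
        by (subst DERIV_shift[symmetric]) simp
      moreover have "\<rho> (s + - (2 * pi * of_int n)) = \<rho> s" for s
        using R(6)[of s "- n"] by simp
      ultimately show ?thesis by (simp add: DERIV_imp_deriv)
    qed
    have const: "\<rho> t = \<rho> t0" if "t \<in> ball t0 e" for t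
    proof (rule DERIV_zero_connected_constant[where S="ball t0 e" and K="{}" and f=\<rho>])
      show "continuous_on (ball t0 e) \<rho>" by (rule R)
      show "\<forall>x\<in>ball t0 e - {}. (\<rho> has_real_derivative 0) (at x)"
        using d0 e(3) R(3) by (metis DiffD1 subsetD)
    qed (use that e in auto)
    \<comment> \<open>The squared positive part of cos (t - t0) - cos e is C^1, 2 pi-periodic,
      positive at t0, and nonzero only within e of t0 modulo 2 pi.\<close>
    define B where "B t = (max 0 (cos (t - t0) - cos e))\<^sup>2" for t
    define B' where "B' t = 2 * max 0 (cos (t - t0) - cos e) * - sin (t - t0)" for t
    have B: "(B has_real_derivative B' t) (at t)" for t
      unfolding B_def B'_def
      by (rule DERIV_chain2[OF DERIV_max_0_square]) (auto intro!: derivative_eq_intros)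
    have Bc: "continuous_on UNIV B" "continuous_on UNIV B'"
      unfolding B_def B'_def by (intro continuous_intros)+
    have Bper: "B (t + 2 * pi) = B t" for t
      using cos_periodic[of "t - t0"] by (simp add: B_def algebra_simps)
    have Bpos: "B t \<ge> 0" "B t0 > 0" for t
      using cos_monotone_0_pi[of 0 e] e by (auto simp: B_def)
    have near: "t \<in> circ_lift N \<and> \<rho> t = \<rho> t0" if "B t \<noteq> 0" for t
    proof -
      have "cos (t - t0) > cos e" using that by (auto simp: B_def max_def split: if_splits)
      then obtain n :: int where "\<bar>t - 2 * pi * of_int n - t0\<bar> < e"
        using cos_gt_imp_near_period e by metis
      then have n: "t - 2 * pi * of_int n \<in> ball t0 e" by (simp add: dist_real_def abs_minus_commute)
      then obtain m :: int where "t - 2 * pi * of_int n - 2 * pi * of_int m \<in> N"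
        using e(3) by (auto simp: circ_lift_def)
      then have "t - 2 * pi * of_int (n + m) \<in> N" by (simp add: algebra_simps)
      then have "t \<in> circ_lift N" unfolding circ_lift_def by blast
      moreover have "\<rho> t = \<rho> t0" using const[OF n] R(6)[of "t - 2 * pi * of_int n" n] by simp
      ultimately show ?thesis by blast
    qed
    \<comment> \<open>\<open>circ_shift_pi\<close> lies in [0, 2 pi), so the endpoint 2 pi is
      discarded as a null set. For the other t, t + pi - 2 pi n in N means that t - 2 pi (n - 1) is
      in N + pi.\<close>
    have ae: "AE t in lborel. t \<in> {0..2*pi} \<longrightarrow> B (t + pi) = 0 \<or> deriv \<rho> t \<noteq> 0"
      using \<open>AE t in lborel. t \<in> circ_shift_pi N \<longrightarrow> deriv \<rho> t \<noteq> 0\<close> AE_lborel_singleton[of "2 * pi"]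
    proof eventually_elim
      case (elim t)
      show ?case
      proof (intro impI, rule ccontr)
        assume t: "t \<in> {0..2*pi}" and n: "\<not> (B (t + pi) = 0 \<or> deriv \<rho> t \<noteq> 0)"
        then have "t + pi \<in> circ_lift N" using near by blast
        then obtain n :: int where "t + pi - 2 * pi * of_int n \<in> N" by (auto simp: circ_lift_def)
        then have "t - 2 * pi * of_int (n - 1) \<in> (\<lambda>t. t + pi) ` N"
          by (intro image_eqI[of _ _ "t + pi - 2 * pi * of_int n"]) (auto simp: algebra_simps)
        then have "t \<in> circ_lift ((\<lambda>t. t + pi) ` N)" unfolding circ_lift_def by blast
        then have "t \<in> circ_shift_pi N"
          using t elim(2) unfolding circ_shift_pi_def by auto
        then show False using elim(1) n by blast
      qed
    qed
    \<comment> \<open>The conjugate factor is there to be matched with the density: f = \<phi> in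
      the first moment and f = the translate of \<phi> by pi in the second both give the integral of
      B * |f|^2.\<close>
    have moments: "integral {0..2*pi} (\<lambda>t. \<phi> t * (of_real (B t) * cnj (f t))) = 0"
        "integral {0..2*pi} (\<lambda>t. \<phi> (t + pi) * (of_real (B t) * cnj (f t))) = 0"
      if f: "\<And>x. (f has_vector_derivative f' x) (at x)" "continuous_on UNIV f'" "\<And>t. f (t + 2 * pi) = f t" for f f'
    proof -
      let ?\<eta> = "\<lambda>t. of_real (B t) * cnj (f t)" and ?\<eta>' = "\<lambda>t. of_real (B t) * cnj (f' t) + of_real (B' t) * cnj (f t)"
      have fc: "continuous_on UNIV f"
        by (rule continuous_on_vector_derivative[OF has_vector_derivative_at_within[OF f(1)]])
      have 1: "(?\<eta> has_vector_derivative ?\<eta>' x) (at x)" for x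
        by (intro has_vector_derivative_mult has_vector_derivative_of_real B has_vector_derivative_cnj f)
      have 2: "continuous_on UNIV ?\<eta>'" by (intro continuous_intros Bc f fc)
      have 3: "?\<eta> (t + 2 * pi) = ?\<eta> t" for t by (simp add: Bper f)
      have 4: "\<rho> t = \<rho> t0" if "?\<eta> t \<noteq> 0" for t using near[of t] that by auto
      have 5: "AE t in lborel. t \<in> {0..2*pi} \<longrightarrow> ?\<eta> (t + pi) = 0 \<or> deriv \<rho> t \<noteq> 0"
        using ae by eventually_elim auto
      show "integral {0..2*pi} (\<lambda>t. \<phi> t * ?\<eta> t) = 0" "integral {0..2*pi} (\<lambda>t. \<phi> (t + pi) * ?\<eta> t) = 0"
        using localized_moments_vanish[OF \<rho> \<sigma> ks(1) \<phi> zero 1 2 3 4 5] by blast+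
    qed
    have sh: "continuous_on UNIV (\<lambda>t. \<phi> (t + pi))" "continuous_on UNIV (\<lambda>t. \<phi>' (t + pi))"
      by (intro continuous_on_compose2[OF \<phi>c] continuous_on_compose2[OF \<phi>(2)] continuous_intros; simp)+
    have per': "\<phi> (t + 2 * pi + pi) = \<phi> (t + pi)" for t
      using per[of "t + pi"] by (simp add: algebra_simps)
    have "\<phi> t0 = 0"
      by (rule integral_norm_square_eq_0D[OF moments(1)[OF \<phi> per] \<phi>c Bc(1) Bpos(1) t0(1) _ Bpos(2)]) simp
    moreover have "\<phi> (t0 + pi) = 0"
      by (rule integral_norm_square_eq_0D[OF moments(2)[OF has_vector_derivative_shift[OF \<phi>(1)] sh(2) per'] sh(1) Bc(1) Bpos(1) t0(1) _ Bpos(2)]) simp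
    ultimately show ?thesis by blast
  qed
  have pern: "\<phi> (t - 2 * pi * of_int n) = \<phi> t" for t and n :: int
    using periodic_int[where f=\<phi> and t=t and n="- n", OF per] by simp
  have "\<phi> t = 0" if tN: "t \<in> circ_lift N \<union> (\<lambda>t. t + pi) ` circ_lift N" for t
  proof -
    consider "t \<in> circ_lift N" | s where "s \<in> circ_lift N" "t = s + pi" using tN by auto
    then show ?thesis
    proof cases
      case 1
      then obtain n :: int where "t - 2 * pi * of_int n \<in> N" by (auto simp: circ_lift_def)
      then show ?thesis using main pern by metis
    next
      case 2
      then obtain n :: int where "s - 2 * pi * of_int n \<in> N" by (auto simp: circ_lift_def)
      then have "\<phi> (s - 2 * pi * of_int n + pi) = 0" using main by blast
      then show ?thesis using pern[of "s + pi" n] 2 by (simp add: algebra_simps)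
    qed
  qed
  \<comment> \<open>Continuity extends the zeros from the dense union of the lifted set and its
    translate to the whole circle.\<close>
  then have "\<phi> t = 0" for t
    using continuous_constant_on_closure[of "circ_lift N \<union> (\<lambda>t. t + pi) ` circ_lift N" \<phi> 0 t] \<phi>c
    unfolding \<open>closure (circ_lift N \<union> (\<lambda>t. t + pi) ` circ_lift N) = UNIV\<close> by blast
  then show False using \<open>\<exists>t. \<phi> t \<noteq> 0\<close> by blast
qed

end
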